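(* The problem Matrix $k$-Product with Repetitions resulting to Zero Matrix is $\mathsf{W}[1]$-hard when parameterized by $k$, even when restricted to $2\times 2$ integer matrices.
   Context: Matrix $k$-Product with Repetitions resulting to Zero Matrix: given a list of $d\times d$ rational matrices and a parameter $k$, decide whether one can choose $k$ matrices from the list (possibly with repetitions) whose product (in some order) is the $d\times d$ zero matrix. *)

theory Defs
  imports "Jordan_Normal_Form.Matrix"
begin

section \<open>Model of computation\<close>

text \<open>
  The machine model is the language WHILE of N. D. Jones, \<^emph>\<open>Computability and Complexity from a
  Programming Perspective\<close>: imperative programs whose variables hold finite binary trees.
  Every operation is charged the full size of the tree that it produces (not unit cost, so sharing
  gives no advantage). A run of cost \<open>t\<close> writes trees of total size at most \<open>t\<close>, hence is simulated
  by a Turing machine in time polynomial in \<open>t\<close> and the input size; conversely a Turing machine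
  tape is a pair of lists, so Turing machines are simulated with polynomial overhead. The
  notions of computability and of fpt-time below therefore agree with the usual ones.
\<close>

datatype tree = Tip | Node tree tree

fun tsize :: "tree \<Rightarrow> nat" where
  "tsize Tip = 1"
| "tsize (Node a b) = 1 + tsize a + tsize b"

fun hd_tree :: "tree \<Rightarrow> tree" where
  "hd_tree Tip = Tip"
| "hd_tree (Node a b) = a"

fun tl_tree :: "tree \<Rightarrow> tree" where
  "tl_tree Tip = Tip"
| "tl_tree (Node a b) = b"

type_synonym state = "nat \<Rightarrow> tree"

datatype exp = VarE nat | TipE | NodeE exp exp | HdE exp | TlE exp | EqE exp exp

text \<open>\<open>Tip\<close> represents false, every other tree represents true.\<close>

fun eval_exp :: "exp \<Rightarrow> state \<Rightarrow> tree" where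
  "eval_exp (VarE v) s = s v"
| "eval_exp TipE s = Tip"
| "eval_exp (NodeE a b) s = Node (eval_exp a s) (eval_exp b s)"
| "eval_exp (HdE a) s = hd_tree (eval_exp a s)"
| "eval_exp (TlE a) s = tl_tree (eval_exp a s)"
| "eval_exp (EqE a b) s = (if eval_exp a s = eval_exp b s then Node Tip Tip else Tip)"

fun cost_exp :: "exp \<Rightarrow> state \<Rightarrow> nat" where
  "cost_exp (VarE v) s = tsize (s v)"
| "cost_exp TipE s = 1"
| "cost_exp (NodeE a b) s = cost_exp a s + cost_exp b s + tsize (eval_exp (NodeE a b) s)"
| "cost_exp (HdE a) s = cost_exp a s + tsize (eval_exp (HdE a) s)"
| "cost_exp (TlE a) s = cost_exp a s + tsize (eval_exp (TlE a) s)"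
| "cost_exp (EqE a b) s = cost_exp a s + cost_exp b s + tsize (eval_exp (EqE a b) s)"

datatype com =
  Skip
| Assign nat exp
| Seq com com
| Ite exp com com
| While exp com

text \<open>\<open>exec c s t s'\<close>: started in \<open>s\<close>, program \<open>c\<close> halts in \<open>s'\<close> at cost \<open>t\<close>.\<close>

inductive exec :: "com \<Rightarrow> state \<Rightarrow> nat \<Rightarrow> state \<Rightarrow> bool" where
  exec_Skip: "exec Skip s 1 s"
| exec_Assign: "exec (Assign v e) s (1 + cost_exp e s) (s(v := eval_exp e s))"
| exec_Seq: "exec c1 s t1 s' \<Longrightarrow> exec c2 s' t2 s'' \<Longrightarrow> exec (Seq c1 c2) s (t1 + t2) s''"
| exec_IteTrue: "eval_exp e s \<noteq> Tip \<Longrightarrow> exec c1 s t s' \<Longrightarrow>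
    exec (Ite e c1 c2) s (1 + cost_exp e s + t) s'"
| exec_IteFalse: "eval_exp e s = Tip \<Longrightarrow> exec c2 s t s' \<Longrightarrow>
    exec (Ite e c1 c2) s (1 + cost_exp e s + t) s'"
| exec_WhileTrue: "eval_exp e s \<noteq> Tip \<Longrightarrow> exec c s t1 s' \<Longrightarrow> exec (While e c) s' t2 s'' \<Longrightarrow>
    exec (While e c) s (1 + cost_exp e s + t1 + t2) s''"
| exec_WhileFalse: "eval_exp e s = Tip \<Longrightarrow> exec (While e c) s (1 + cost_exp e s) s"

text \<open>Variable \<open>0\<close> holds the input and the output; all other variables are initially \<open>Tip\<close>.\<close>

definition computes_in :: "com \<Rightarrow> tree \<Rightarrow> nat \<Rightarrow> tree \<Rightarrow> bool" where
  "computes_in c x t y \<longleftrightarrow> (\<exists>s. exec c ((\<lambda>_. Tip)(0 := x)) t s \<and> s 0 = y)"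


section \<open>Encodings\<close>

fun enc_list :: "('a \<Rightarrow> tree) \<Rightarrow> 'a list \<Rightarrow> tree" where
  "enc_list enc [] = Tip"
| "enc_list enc (x # xs) = Node (enc x) (enc_list enc xs)"

definition enc_bool :: "bool \<Rightarrow> tree" where
  "enc_bool b = (if b then Node Tip Tip else Tip)"

fun enc_unary :: "nat \<Rightarrow> tree" where
  "enc_unary 0 = Tip"
| "enc_unary (Suc n) = Node Tip (enc_unary n)"

text \<open>Binary digits, least significant first, without superfluous zeros.\<close>

fun bits :: "nat \<Rightarrow> bool list" where
  "bits n = (if n = 0 then [] else odd n # bits (n div 2))"

declare bits.simps [simp del]

definition enc_int :: "int \<Rightarrow> tree" where
  "enc_int z = Node (enc_bool (z < 0)) (enc_list enc_bool (bits (nat \<bar>z\<bar>)))"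

text \<open>Numerator and positive denominator in lowest terms, both in binary.\<close>

definition enc_rat :: "rat \<Rightarrow> tree" where
  "enc_rat r = Node (enc_int (fst (quotient_of r))) (enc_int (snd (quotient_of r)))"

definition enc_mat :: "rat mat \<Rightarrow> tree" where
  "enc_mat A = enc_list (enc_list enc_rat) (mat_to_list A)"


section \<open>Parameterized problems and fpt-reductions\<close>

text \<open>A parameterized problem is the set of its yes-instances \<open>(x, k)\<close> with parameter \<open>k\<close>.\<close>

type_synonym param_problem = "(tree \<times> nat) set"

definition computable :: "(nat \<Rightarrow> nat) \<Rightarrow> bool" where
  "computable f \<longleftrightarrow> (\<exists>c. \<forall>n. \<exists>t. computes_in c (enc_unary n) t (enc_unary (f n)))"

text \<open>
  Writing the parameter in unary is immaterial, since an fpt time bound allows an arbitrary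
  computable factor depending on \<open>k\<close> and the new parameter is bounded in terms of \<open>k\<close>.
\<close>

definition enc_inst :: "tree \<times> nat \<Rightarrow> tree" where
  "enc_inst p = Node (fst p) (enc_unary (snd p))"

definition fpt_computable :: "(tree \<times> nat \<Rightarrow> tree \<times> nat) \<Rightarrow> bool" where
  "fpt_computable R \<longleftrightarrow>
     (\<exists>c f e. computable f \<and>
        (\<forall>x k. \<exists>t. computes_in c (enc_inst (x, k)) t (enc_inst (R (x, k))) \<and>
                   t \<le> f k * tsize x ^ e))"

definition fpt_reduction ::
    "(tree \<times> nat \<Rightarrow> tree \<times> nat) \<Rightarrow> param_problem \<Rightarrow> param_problem \<Rightarrow> bool" where
  "fpt_reduction R P Q \<longleftrightarrow>
     fpt_computable R \<and>
     (\<exists>g. computable g \<and> (\<forall>x k. snd (R (x, k)) \<le> g k)) \<and>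
     (\<forall>x k. (x, k) \<in> P \<longleftrightarrow> R (x, k) \<in> Q)"

definition fpt_reducible :: "param_problem \<Rightarrow> param_problem \<Rightarrow> bool" where
  "fpt_reducible P Q \<longleftrightarrow> (\<exists>R. fpt_reduction R P Q)"


section \<open>Boolean circuits and the W-hierarchy\<close>

text \<open>
  A circuit is a topologically sorted list of gates: gate number \<open>i\<close> refers to its predecessors by
  their positions, which are smaller than \<open>i\<close>. The last gate is the output gate.
\<close>

datatype gate = Input | Neg nat | Conj "nat list" | Disj "nat list"

type_synonym circuit = "gate list"

fun preds :: "gate \<Rightarrow> nat list" where
  "preds Input = []"
| "preds (Neg j) = [j]"
| "preds (Conj js) = js"
| "preds (Disj js) = js"

fun gate_arity_ok :: "gate \<Rightarrow> bool" where
  "gate_arity_ok (Conj js) \<longleftrightarrow> 2 \<le> length js \<and> distinct js"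
| "gate_arity_ok (Disj js) \<longleftrightarrow> 2 \<le> length js \<and> distinct js"
| "gate_arity_ok _ \<longleftrightarrow> True"

definition wf_circuit :: "circuit \<Rightarrow> bool" where
  "wf_circuit C \<longleftrightarrow> C \<noteq> [] \<and>
     (\<forall>i<length C. gate_arity_ok (C ! i) \<and> (\<forall>j\<in>set (preds (C ! i)). j < i))"

definition input_gates :: "circuit \<Rightarrow> nat set" where
  "input_gates C = {i. i < length C \<and> C ! i = Input}"

text \<open>
  \<open>gate_value C A i\<close> is the value of gate \<open>i\<close> when exactly the inputs in \<open>A\<close> are set to true. The
  guards \<open>j < i\<close> always hold in well-formed circuits and only serve to ensure termination.
\<close>

function gate_value :: "circuit \<Rightarrow> nat set \<Rightarrow> nat \<Rightarrow> bool" where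
  "gate_value C A i =
     (case C ! i of
        Input \<Rightarrow> i \<in> A
      | Neg j \<Rightarrow> \<not> (if j < i then gate_value C A j else False)
      | Conj js \<Rightarrow> (\<forall>j\<in>set js. j < i \<longrightarrow> gate_value C A j)
      | Disj js \<Rightarrow> (\<exists>j\<in>set js \<inter> {..<i}. gate_value C A j))"
  by pat_completeness auto
termination
  by (relation "measure (\<lambda>(C, A, i). i)") auto

declare gate_value.simps [simp del]

definition satisfies :: "nat set \<Rightarrow> circuit \<Rightarrow> bool" where
  "satisfies A C \<longleftrightarrow> gate_value C A (length C - 1)"

definition io_path :: "circuit \<Rightarrow> nat list \<Rightarrow> bool" where
  "io_path C p \<longleftrightarrow> p \<noteq> [] \<and> set p \<subseteq> {..<length C} \<and>
     hd p \<in> input_gates C \<and> last p = length C - 1 \<and>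
     successively (\<lambda>i j. i \<in> set (preds (C ! j))) p"

definition large_gate :: "circuit \<Rightarrow> nat \<Rightarrow> bool" where
  "large_gate C i \<longleftrightarrow> 2 < length (preds (C ! i))"

definition weft_le :: "circuit \<Rightarrow> nat \<Rightarrow> bool" where
  "weft_le C t \<longleftrightarrow> (\<forall>p. io_path C p \<longrightarrow> length (filter (large_gate C) p) \<le> t)"

definition depth_le :: "circuit \<Rightarrow> nat \<Rightarrow> bool" where
  "depth_le C d \<longleftrightarrow> (\<forall>p. io_path C p \<longrightarrow> length p - 1 \<le> d)"

text \<open>Gate numbers are written in unary; this is polynomial in the number of gates.\<close>

fun enc_gate :: "gate \<Rightarrow> tree" where
  "enc_gate Input = Node (enc_unary 0) Tip"
| "enc_gate (Neg j) = Node (enc_unary 1) (enc_unary j)"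
| "enc_gate (Conj js) = Node (enc_unary 2) (enc_list enc_unary js)"
| "enc_gate (Disj js) = Node (enc_unary 3) (enc_list enc_unary js)"

text \<open>
  Weighted circuit satisfiability for circuits of weft at most \<open>t\<close> and depth at most \<open>d\<close>: is there
  a satisfying assignment with exactly \<open>k\<close> true inputs?
\<close>

definition WCS :: "nat \<Rightarrow> nat \<Rightarrow> param_problem" where
  "WCS t d = {(enc_list enc_gate C, k) | C k.
     wf_circuit C \<and> weft_le C t \<and> depth_le C d \<and>
     (\<exists>A \<subseteq> input_gates C. card A = k \<and> satisfies A C)}"

definition W :: "nat \<Rightarrow> param_problem set" where
  "W t = {P. \<exists>d\<ge>1. fpt_reducible P (WCS t d)}"

definition W_hard :: "nat \<Rightarrow> param_problem \<Rightarrow> bool" where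
  "W_hard t Q \<longleftrightarrow> (\<forall>P \<in> W t. fpt_reducible P Q)"

text \<open>
  Hardness of \<open>Q\<close> restricted to the inputs in \<open>I\<close>: the reductions only produce inputs from \<open>I\<close>.
\<close>

definition W_hard_restricted_to :: "nat \<Rightarrow> tree set \<Rightarrow> param_problem \<Rightarrow> bool" where
  "W_hard_restricted_to t I Q \<longleftrightarrow>
     (\<forall>P \<in> W t. \<exists>R. fpt_reduction R P Q \<and> (\<forall>x k. fst (R (x, k)) \<in> I))"


section \<open>Matrix products resulting in the zero matrix\<close>

definition mat_product :: "nat \<Rightarrow> rat mat list \<Rightarrow> rat mat" where
  "mat_product d As = foldr (*) As (1\<^sub>m d)"

text \<open>
  The sequence \<open>As\<close> comprises both the choice of \<open>k\<close> matrices, with repetitions, and the order in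
  which they are multiplied.
\<close>

definition matrix_k_product_rep_zero :: param_problem where
  "matrix_k_product_rep_zero = {(enc_list enc_mat Ms, k) | Ms k.
     \<exists>d>0. set Ms \<subseteq> carrier_mat d d \<and>
       (\<exists>As. length As = k \<and> set As \<subseteq> set Ms \<and> mat_product d As = 0\<^sub>m d d)}"

definition integer_2x2_inputs :: "tree set" where
  "integer_2x2_inputs =
     {enc_list enc_mat Ms | Ms. \<forall>A\<in>set Ms. A \<in> carrier_mat 2 2 \<and> elements_mat A \<subseteq> \<int>}"

end

theory Submission
  imports Defs
begin

text \<open>
  In a circuit of weft 1 and depth \<open>d\<close>, the small gates above the large ones can be expanded into a
  disjunction of polynomially many conjunctions of literals, where each literal is the value of a
  gate without large gates below it and hence depends on at most \<open>q = 2 ^ d\<close> inputs. The number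
  \<open>F p A\<close> of literals of the conjunction \<open>p\<close> violated by a set \<open>A\<close> of true inputs is thus a sum of
  functions of at most \<open>q\<close> inputs, and Moebius inversion gives
  \<open>F p A = (\<Sum>J \<subseteq> I \<subseteq> A. (-1) ^ card (I - J) * F p J)\<close> with \<open>I\<close> restricted to \<open>card I \<le> q\<close>. For
  \<open>A = {a\<^sub>1 < \<dots> < a\<^sub>k}\<close> the number of pairs \<open>J \<subseteq> I\<close> depends on \<open>k\<close> and \<open>q\<close> only, and each term is known
  from \<open>p\<close> and at most \<open>q\<close> of the \<open>a\<^sub>i\<close>. So a satisfying set of size \<open>k\<close> is a selection of one term for
  each pair, consistent in \<open>p\<close> and the \<open>a\<^sub>i\<close>, with sum \<open>0\<close>. Consistency and the sum are expressed by the digits of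
  numbers in a base so large that no carries occur: a bounded number of numbers from a list,
  repetitions allowed, has to add up to a target \<open>t\<close>.

  The shears \<open>((1, x), (0, 1))\<close> multiply by adding \<open>x\<close>, and the singular matrix
  \<open>S = ((0, 0), (1, -t))\<close> satisfies \<open>S * ((1, x), (0, 1)) * S = 0\<close> iff \<open>x = t\<close>. A product of shears and copies of \<open>S\<close>
  therefore vanishes iff the shears between two consecutive copies of \<open>S\<close> add up to \<open>t\<close> somewhere.

  That the reduction runs in polynomial time is shown with a class of functions on encoded data
  that is closed under composition, conditionals and folds over lists whose intermediate results have
  polynomial size.
\<close>

text \<open>Hardness is derived from the definition of W[1] and not from a complete problem such as
  Clique. So circuits of every fixed depth and arbitrary source reductions have to be handled, which
  leads to the normal form of weft-1 circuits and to the composition with an unknown program. The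
  selected pieces are independent list entries and can be tied together only by digits. An item
  carries the values it assumes, a reference for a coordinate carries the complement
  \<open>N - a\<close>. Their sum is \<open>N\<close> exactly if they agree, so all items are
  compared with one reference instead of with each other. The conjunction \<open>p\<close> is
  treated as one more coordinate. Index lists with two coordinates force the values to increase,
  hence to be \<open>k\<close> different inputs. Moebius terms are signed but digits are not: each
  term is shifted by \<open>z\<close>, and the target contains the sum of the shifts. The matrices
  do not control how many shears lie between two copies of \<open>S\<close>. Digits 1 count the
  pieces instead; only an upper bound on their number is used, to exclude carries.\<close>

section \<open>Clean programs\<close>

text \<open>The variables \<open>1, \<dots>, N - 1\<close> are scratch space that has to be restored to \<open>Tip\<close>; the
  variables from \<open>N\<close> on are not touched.\<close>

definition runs :: "com \<Rightarrow> nat \<Rightarrow> tree \<Rightarrow> nat \<Rightarrow> tree \<Rightarrow> bool" where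
  "runs c N x T y \<longleftrightarrow> (\<forall>s. s 0 = x \<longrightarrow> (\<forall>v. 0 < v \<and> v < N \<longrightarrow> s v = Tip) \<longrightarrow>
     (\<exists>t \<le> T. exec c s t (s(0 := y))))"

lemma runsI:
  assumes "\<And>s. s 0 = x \<Longrightarrow> (\<And>v. 0 < v \<Longrightarrow> v < N \<Longrightarrow> s v = Tip) \<Longrightarrow> \<exists>t \<le> T. exec c s t (s(0 := y))"
  shows "runs c N x T y"
  using assms by (simp add: runs_def)

lemma runsE:
  assumes "runs c N x T y" "s 0 = x" "\<And>v. 0 < v \<Longrightarrow> v < N \<Longrightarrow> s v = Tip"
  obtains t where "t \<le> T" "exec c s t (s(0 := y))"
  using assms by (auto simp: runs_def)

lemma runs_mono:
  assumes "runs c N x T y" "N \<le> N'" "T \<le> T'"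
  shows "runs c N' x T' y"
proof (rule runsI)
  fix s :: state assume s: "s 0 = x" "\<And>v. 0 < v \<Longrightarrow> v < N' \<Longrightarrow> s v = Tip"
  obtain t where "t \<le> T" "exec c s t (s(0 := y))"
    by (rule runsE[OF assms(1), of s]) (use s assms(2) in auto)
  with assms(3) show "\<exists>t \<le> T'. exec c s t (s(0 := y))"
    by (intro exI[of _ t]) simp
qed

lemma runs_computes_in:
  assumes "runs c N x T y"
  obtains t where "t \<le> T" "computes_in c x t y"
proof -
  obtain t where "t \<le> T" "exec c ((\<lambda>_. Tip)(0 := x)) t (((\<lambda>_. Tip)(0 := x))(0 := y))"
    by (rule runsE[OF assms, of "(\<lambda>_. Tip)(0 := x)"]) auto
  then show thesis
    by (intro that[of t]) (auto simp: computes_in_def simp del: fun_upd_upd)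
qed

lemma exec_Assign':
  "t = 1 + cost_exp e s \<Longrightarrow> s' = s(v := eval_exp e s) \<Longrightarrow> exec (Assign v e) s t s'"
  by (simp only: exec_Assign)

lemma runs_Seq:
  assumes "runs c1 N x T1 y" "runs c2 N y T2 z"
  shows "runs (Seq c1 c2) N x (T1 + T2) z"
proof (rule runsI)
  fix s :: state assume s: "s 0 = x" "\<And>v. 0 < v \<Longrightarrow> v < N \<Longrightarrow> s v = Tip"
  obtain t1 where t1: "t1 \<le> T1" "exec c1 s t1 (s(0 := y))"
    using runsE[OF assms(1)] s by blast
  obtain t2 where t2: "t2 \<le> T2" "exec c2 (s(0 := y)) t2 ((s(0 := y))(0 := z))"
    by (rule runsE[OF assms(2), of "s(0 := y)"]) (use s in auto)
  from exec_Seq[OF t1(2) t2(2)] t1(1) t2(1)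
  show "\<exists>t \<le> T1 + T2. exec (Seq c1 c2) s t (s(0 := z))"
    by (intro exI[of _ "t1 + t2"]) auto
qed

lemma tsize_pos [simp]: "0 < tsize t"
  by (cases t) auto

fun only_input :: "exp \<Rightarrow> bool" where
  "only_input (VarE v) \<longleftrightarrow> v = 0"
| "only_input TipE \<longleftrightarrow> True"
| "only_input (NodeE a b) \<longleftrightarrow> only_input a \<and> only_input b"
| "only_input (HdE a) \<longleftrightarrow> only_input a"
| "only_input (TlE a) \<longleftrightarrow> only_input a"
| "only_input (EqE a b) \<longleftrightarrow> only_input a \<and> only_input b"

lemma tsize_hd_tree: "tsize (hd_tree t) \<le> tsize t"
  by (cases t) auto

lemma tsize_tl_tree: "tsize (tl_tree t) \<le> tsize t"
  by (cases t) auto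

text \<open>Each operator adds at most the sizes of its operands and a constant, so \<open>K\<close>
  depends on the expression alone.\<close>

lemma only_input_cost:
  "only_input e \<Longrightarrow>
    \<exists>K. \<forall>s. cost_exp e s \<le> K * tsize (s 0) \<and> tsize (eval_exp e s) \<le> K * tsize (s 0)"
proof (induction e)
  case (VarE v)
  then show ?case by (auto intro!: exI[of _ 1])
next
  case TipE
  then show ?case by (auto intro!: exI[of _ 1] simp: Suc_le_eq)
next
  case (NodeE a b)
  then obtain K L where "\<forall>s. cost_exp a s \<le> K * tsize (s 0) \<and> tsize (eval_exp a s) \<le> K * tsize (s 0)"
    "\<forall>s. cost_exp b s \<le> L * tsize (s 0) \<and> tsize (eval_exp b s) \<le> L * tsize (s 0)" by auto
  note KL = this(1)[THEN spec] this(2)[THEN spec]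
  show ?case
  proof (intro exI[of _ "2 * K + 2 * L + 1"] allI)
    fix s :: state
    have "0 < tsize (s 0)" by simp
    then show "cost_exp (NodeE a b) s \<le> (2 * K + 2 * L + 1) * tsize (s 0) \<and>
       tsize (eval_exp (NodeE a b) s) \<le> (2 * K + 2 * L + 1) * tsize (s 0)"
      using KL[of s] by (simp add: algebra_simps Suc_le_eq del: tsize_pos)
  qed
next
  case (HdE a)
  then obtain K where "\<forall>s. cost_exp a s \<le> K * tsize (s 0) \<and> tsize (eval_exp a s) \<le> K * tsize (s 0)"
    by auto
  note K = this[THEN spec]
  show ?case
  proof (intro exI[of _ "2 * K"] allI)
    fix s :: state
    show "cost_exp (HdE a) s \<le> 2 * K * tsize (s 0) \<and> tsize (eval_exp (HdE a) s) \<le> 2 * K * tsize (s 0)"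
      using K[of s] tsize_hd_tree[of "eval_exp a s"] by (simp add: algebra_simps)
  qed
next
  case (TlE a)
  then obtain K where "\<forall>s. cost_exp a s \<le> K * tsize (s 0) \<and> tsize (eval_exp a s) \<le> K * tsize (s 0)"
    by auto
  note K = this[THEN spec]
  show ?case
  proof (intro exI[of _ "2 * K"] allI)
    fix s :: state
    show "cost_exp (TlE a) s \<le> 2 * K * tsize (s 0) \<and> tsize (eval_exp (TlE a) s) \<le> 2 * K * tsize (s 0)"
      using K[of s] tsize_tl_tree[of "eval_exp a s"] by (simp add: algebra_simps)
  qed
next
  case (EqE a b)
  then obtain K L where "\<forall>s. cost_exp a s \<le> K * tsize (s 0) \<and> tsize (eval_exp a s) \<le> K * tsize (s 0)"
    "\<forall>s. cost_exp b s \<le> L * tsize (s 0) \<and> tsize (eval_exp b s) \<le> L * tsize (s 0)" by auto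
  note KL = this(1)[THEN spec] this(2)[THEN spec]
  show ?case
  proof (intro exI[of _ "2 * K + 2 * L + 3"] allI)
    fix s :: state
    have "0 < tsize (s 0)" by simp
    then show "cost_exp (EqE a b) s \<le> (2 * K + 2 * L + 3) * tsize (s 0) \<and>
       tsize (eval_exp (EqE a b) s) \<le> (2 * K + 2 * L + 3) * tsize (s 0)"
      using KL[of s] by (simp add: algebra_simps Suc_le_eq del: tsize_pos)
  qed
qed

lemma runs_exp:
  assumes "only_input e"
  obtains K where "\<And>s. runs (Assign 0 e) 1 (s 0) (K * tsize (s 0)) (eval_exp e s)"
proof -
  obtain K where K: "\<And>s. cost_exp e s \<le> K * tsize (s 0)"
    using only_input_cost[OF assms] by auto
  have eq: "eval_exp e s = eval_exp e s'" if "s 0 = s' 0" for s s'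
    using assms that by (induction e) auto
  have "runs (Assign 0 e) 1 (s 0) ((K + 1) * tsize (s 0)) (eval_exp e s)" for s
  proof (rule runsI)
    fix s' :: state assume s': "s' 0 = s 0"
    have "exec (Assign 0 e) s' (1 + cost_exp e s') (s'(0 := eval_exp e s))"
      by (rule exec_Assign') (simp_all add: eq[of s' s, OF s'])
    moreover have "1 + cost_exp e s' \<le> (K + 1) * tsize (s 0)"
      using K[of s'] tsize_pos[of "s 0"] by (simp add: s' Suc_le_eq del: tsize_pos)
    ultimately show "\<exists>t \<le> (K + 1) * tsize (s 0). exec (Assign 0 e) s' t (s'(0 := eval_exp e s))"
      by blast
  qed
  then show thesis by (rule that)
qed

text \<open>As \<open>c1\<close> and \<open>c2\<close> do not touch variables from \<open>N\<close>
  on, \<open>N\<close> can keep the input for \<open>c2\<close> and \<open>N + 1\<close> the result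
  of \<open>c1\<close>.\<close>

definition pair_com :: "nat \<Rightarrow> com \<Rightarrow> com \<Rightarrow> com" where
  "pair_com N c1 c2 =
     Seq (Assign N (VarE 0)) (Seq c1 (Seq (Assign (N + 1) (VarE 0)) (Seq (Assign 0 (VarE N))
     (Seq (Assign N TipE) (Seq c2 (Seq (Assign 0 (NodeE (VarE (N + 1)) (VarE 0)))
     (Assign (N + 1) TipE)))))))"

lemma runs_pair:
  assumes "runs c1 N x T1 y" "runs c2 N x T2 z" "0 < N"
  shows "runs (pair_com N c1 c2) (N + 2) x
           (T1 + T2 + 2 * tsize x + 3 * tsize y + 2 * tsize z + 10) (Node y z)"
proof (rule runsI)
  fix s :: state assume s: "s 0 = x" "\<And>v. 0 < v \<Longrightarrow> v < N + 2 \<Longrightarrow> s v = Tip"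
  define s1 where "s1 = s(N := x)"
  define s2 where "s2 = s1(0 := y)"
  define s3 where "s3 = s2(N + 1 := y)"
  define s4 where "s4 = s3(0 := x)"
  define s5 where "s5 = s4(N := Tip)"
  define s6 where "s6 = s5(0 := z)"
  define s7 where "s7 = s6(0 := Node y z)"
  note defs = s1_def s2_def s3_def s4_def s5_def s6_def s7_def
  have 1: "exec (Assign N (VarE 0)) s (1 + tsize x) s1"
    by (rule exec_Assign') (auto simp: defs s)
  obtain t1 where t1: "t1 \<le> T1" and 2: "exec c1 s1 t1 s2" unfolding s2_def
    by (rule runsE[OF assms(1), of s1]) (use s assms(3) in \<open>auto simp: s1_def\<close>)
  have 3: "exec (Assign (N + 1) (VarE 0)) s2 (1 + tsize y) s3"
    by (rule exec_Assign') (auto simp: defs s)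
  have 4: "exec (Assign 0 (VarE N)) s3 (1 + tsize x) s4"
    by (rule exec_Assign') (use assms(3) in \<open>auto simp: defs s\<close>)
  have 5: "exec (Assign N TipE) s4 2 s5"
    by (rule exec_Assign') (auto simp: defs s)
  obtain t2 where t2: "t2 \<le> T2" and 6: "exec c2 s5 t2 s6" unfolding s6_def
    by (rule runsE[OF assms(2), of s5]) (use s assms(3) in \<open>auto simp: defs\<close>)
  have 7: "exec (Assign 0 (NodeE (VarE (N + 1)) (VarE 0))) s6 (2 + 2 * tsize y + 2 * tsize z) s7"
    by (rule exec_Assign') (use assms(3) in \<open>auto simp: defs s\<close>)
  have 8: "exec (Assign (N + 1) TipE) s7 2 (s(0 := Node y z))"
    by (rule exec_Assign') (use assms(3) s in \<open>auto simp: defs fun_eq_iff\<close>)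
  have "exec (pair_com N c1 c2) s
    ((1 + tsize x) + (t1 + ((1 + tsize y) + ((1 + tsize x) + (2 + (t2 +
      ((2 + 2 * tsize y + 2 * tsize z) + 2))))))) (s(0 := Node y z))"
    unfolding pair_com_def by (intro exec_Seq[OF 1] exec_Seq[OF 2] exec_Seq[OF 3] exec_Seq[OF 4]
        exec_Seq[OF 5] exec_Seq[OF 6] exec_Seq[OF 7] 8)
  moreover have "(1 + tsize x) + (t1 + ((1 + tsize y) + ((1 + tsize x) + (2 + (t2 +
      ((2 + 2 * tsize y + 2 * tsize z) + 2)))))) \<le> T1 + T2 + 2 * tsize x + 3 * tsize y + 2 * tsize z + 10"
    using t1 t2 by simp
  ultimately show "\<exists>t \<le> T1 + T2 + 2 * tsize x + 3 * tsize y + 2 * tsize z + 10.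
      exec (pair_com N c1 c2) s t (s(0 := Node y z))"
    by blast
qed

definition branch_com :: "com \<Rightarrow> com \<Rightarrow> com" where
  "branch_com c1 c2 = Ite (HdE (VarE 0)) (Seq (Assign 0 (TlE (VarE 0))) c1)
     (Seq (Assign 0 (TlE (VarE 0))) c2)"

text \<open>Only the branch taken has to be correct. The final reduction relies on this: its first
  branch is meaningful only for trees that passed the test.\<close>

lemma runs_branch:
  assumes "runs (if b = Tip then c2 else c1) N x T y"
  shows "runs (branch_com c1 c2) N (Node b x) (T + 4 + 3 * tsize b + 3 * tsize x) y"
proof (rule runsI)
  fix s :: state assume s: "s 0 = Node b x" "\<And>v. 0 < v \<Longrightarrow> v < N \<Longrightarrow> s v = Tip"
  let ?c = "if b = Tip then c2 else c1"
  have 1: "exec (Assign 0 (TlE (VarE 0))) s (2 + tsize b + 2 * tsize x) (s(0 := x))"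
    by (rule exec_Assign') (auto simp: s)
  obtain t where t: "t \<le> T" "exec ?c (s(0 := x)) t ((s(0 := x))(0 := y))"
    by (rule runsE[OF assms, of "s(0 := x)"]) (use s in auto)
  have 2: "exec (Seq (Assign 0 (TlE (VarE 0))) ?c) s (2 + tsize b + 2 * tsize x + t) (s(0 := y))"
    using exec_Seq[OF 1 t(2)] by simp
  have "exec (branch_com c1 c2) s
      (1 + cost_exp (HdE (VarE 0)) s + (2 + tsize b + 2 * tsize x + t)) (s(0 := y))"
  proof (cases "b = Tip")
    case True
    then show ?thesis
      unfolding branch_com_def using 2 by (intro exec_IteFalse) (simp_all add: s)
  next
    case False
    then show ?thesis
      unfolding branch_com_def using 2 by (intro exec_IteTrue) (simp_all add: s)
  qed
  with t(1) show "\<exists>t \<le> T + 4 + 3 * tsize b + 3 * tsize x. exec (branch_com c1 c2) s t (s(0 := y))"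
    by (intro exI conjI) (auto simp: s)
qed

text \<open>The loop state in variable \<open>0\<close> is \<open>Node l (Node e s)\<close> with the remaining list \<open>l\<close>,
  the environment \<open>e\<close> and the accumulator \<open>s\<close>.\<close>

definition fold_body :: "nat \<Rightarrow> com \<Rightarrow> com" where
  "fold_body N c =
     Seq (Assign N (VarE 0))
     (Seq (Assign 0 (NodeE (HdE (TlE (VarE 0))) (NodeE (TlE (TlE (VarE 0))) (HdE (HdE (VarE 0))))))
     (Seq c
     (Seq (Assign 0 (NodeE (TlE (HdE (VarE N))) (NodeE (HdE (TlE (VarE N))) (VarE 0))))
     (Assign N TipE))))"

definition fold_com :: "nat \<Rightarrow> com \<Rightarrow> com" where
  "fold_com N c = Seq (While (HdE (VarE 0)) (fold_body N c)) (Assign 0 (TlE (TlE (VarE 0))))"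

lemma fold_body_exec:
  assumes "runs c N (Node e (Node s a)) T s'" "0 < N"
  assumes st: "st 0 = Node (Node a l) (Node e s)" "\<And>v. 0 < v \<Longrightarrow> v < N + 1 \<Longrightarrow> st v = Tip"
  assumes B: "tsize l + tsize a + tsize e + tsize s + tsize s' \<le> B"
  shows "\<exists>t \<le> T + 50 * (B + 1). exec (fold_body N c) st t (st(0 := Node l (Node e s')))"
proof -
  define s1 where "s1 = st(N := st 0)"
  define s2 where "s2 = s1(0 := Node e (Node s a))"
  define s3 where "s3 = s2(0 := s')"
  define s4 where "s4 = s3(0 := Node l (Node e s'))"
  let ?e2 = "NodeE (HdE (TlE (VarE 0))) (NodeE (TlE (TlE (VarE 0))) (HdE (HdE (VarE 0))))"
  let ?e4 = "NodeE (TlE (HdE (VarE N))) (NodeE (HdE (TlE (VarE N))) (VarE 0))"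
  note defs = s1_def s2_def s3_def s4_def
  have 1: "exec (Assign N (VarE 0)) st (1 + tsize (st 0)) s1"
    by (rule exec_Assign') (auto simp: defs)
  have 2: "exec (Assign 0 ?e2) s1 (1 + cost_exp ?e2 s1) s2"
    by (rule exec_Assign') (use assms(2) in \<open>auto simp: defs st\<close>)
  obtain t where t: "t \<le> T" and 3: "exec c s2 t s3" unfolding s3_def
    by (rule runsE[OF assms(1), of s2]) (use st assms(2) in \<open>auto simp: s1_def s2_def\<close>)
  have 4: "exec (Assign 0 ?e4) s3 (1 + cost_exp ?e4 s3) s4"
    by (rule exec_Assign') (use assms(2) in \<open>auto simp: defs st\<close>)
  have 5: "exec (Assign N TipE) s4 2 (st(0 := Node l (Node e s')))"
    by (rule exec_Assign') (use assms(2) st in \<open>auto simp: defs fun_eq_iff\<close>)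
  have "exec (fold_body N c) st ((1 + tsize (st 0)) + ((1 + cost_exp ?e2 s1) + (t +
     ((1 + cost_exp ?e4 s3) + 2)))) (st(0 := Node l (Node e s')))"
    unfolding fold_body_def by (intro exec_Seq[OF 1] exec_Seq[OF 2] exec_Seq[OF 3] exec_Seq[OF 4] 5)
  moreover have "(1 + tsize (st 0)) + ((1 + cost_exp ?e2 s1) + (t + ((1 + cost_exp ?e4 s3) + 2)))
     \<le> T + 50 * (B + 1)"
    using t B assms(2) by (simp add: defs st)
  ultimately show ?thesis by blast
qed

text \<open>Time and size are assumed to be bounded only for the accumulators reached on prefixes of
  the list, so the bounds may exploit invariants of the particular run.\<close>

lemma fold_loop_exec:
  fixes f :: "'s \<Rightarrow> 'a \<Rightarrow> 's" and es :: "'s \<Rightarrow> tree" and ea :: "'a \<Rightarrow> tree"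
  assumes body: "\<And>i. i < length xs \<Longrightarrow> runs c N
       (Node e (Node (es (foldl f s (take i xs))) (ea (xs ! i)))) T (es (f (foldl f s (take i xs)) (xs ! i)))"
  assumes N: "0 < N"
  assumes B: "tsize (enc_list ea xs) + tsize e \<le> B" "\<And>i. tsize (es (foldl f s (take i xs))) \<le> B"
  assumes st: "st 0 = Node (enc_list ea xs) (Node e (es s))" "\<And>v. 0 < v \<Longrightarrow> v < N + 1 \<Longrightarrow> st v = Tip"
  shows "\<exists>t \<le> length xs * (T + 200 * (B + 1)) + 5 * (B + 1).
    exec (While (HdE (VarE 0)) (fold_body N c)) st t (st(0 := Node Tip (Node e (es (foldl f s xs)))))"
  using assms
proof (induction xs arbitrary: s st)
  case Nil
  have "exec (While (HdE (VarE 0)) (fold_body N c)) st (1 + cost_exp (HdE (VarE 0)) st) st"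
    by (rule exec_WhileFalse) (simp add: Nil)
  moreover have "st(0 := Node Tip (Node e (es (foldl f s [])))) = st"
    using Nil by (auto simp: fun_eq_iff)
  moreover have "1 + cost_exp (HdE (VarE 0)) st \<le> 5 * (B + 1)"
    using Nil(3) Nil(4)[of 0] by (simp add: Nil)
  ultimately show ?case
    by (intro exI[of _ "1 + cost_exp (HdE (VarE 0)) st"] conjI) simp_all
next
  case (Cons x xs)
  let ?s' = "f s x"
  let ?st' = "st(0 := Node (enc_list ea xs) (Node e (es ?s')))"
  from Cons.prems(1)[of 0] have t1: "runs c N (Node e (Node (es s) (ea x))) T (es ?s')" by auto
  have Bs: "tsize (es s) \<le> B" "tsize (es ?s') \<le> B"
    using Cons.prems(4)[of 0] Cons.prems(4)[of 1] by auto
  \<comment> \<open>The list together with the environment, the old accumulator and the new one take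
    at most \<open>B\<close> each.\<close>
  from fold_body_exec[where B = "3 * B", OF t1 N, of st "enc_list ea xs"] Cons.prems Bs
  obtain t2 where t2: "t2 \<le> T + 50 * (3 * B + 1)" "exec (fold_body N c) st t2 ?st'"
    by fastforce
  have "\<exists>t \<le> length xs * (T + 200 * (B + 1)) + 5 * (B + 1).
    exec (While (HdE (VarE 0)) (fold_body N c)) ?st' t (?st'(0 := Node Tip (Node e (es (foldl f ?s' xs)))))"
  proof (rule Cons.IH)
    show "runs c N (Node e (Node (es (foldl f ?s' (take i xs))) (ea (xs ! i)))) T
       (es (f (foldl f ?s' (take i xs)) (xs ! i)))" if "i < length xs" for i
      using Cons.prems(1)[of "Suc i"] that by auto
    show "tsize (es (foldl f ?s' (take i xs))) \<le> B" for i
      using Cons.prems(4)[of "Suc i"] by auto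
  qed (use Cons.prems in auto)
  then obtain t3 where t3: "t3 \<le> length xs * (T + 200 * (B + 1)) + 5 * (B + 1)"
    "exec (While (HdE (VarE 0)) (fold_body N c)) ?st' t3 (st(0 := Node Tip (Node e (es (foldl f ?s' xs)))))"
    by auto
  have "exec (While (HdE (VarE 0)) (fold_body N c)) st (1 + cost_exp (HdE (VarE 0)) st + t2 + t3)
     (st(0 := Node Tip (Node e (es (foldl f ?s' xs)))))"
    by (rule exec_WhileTrue[OF _ t2(2) t3(2)]) (simp add: Cons.prems)
  moreover have "1 + cost_exp (HdE (VarE 0)) st + t2 + t3
     \<le> length (x # xs) * (T + 200 * (B + 1)) + 5 * (B + 1)"
    using t2(1) t3(1) Bs Cons.prems(3) by (simp add: Cons.prems(5) algebra_simps)
  ultimately show ?case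
    by (intro exI[of _ "1 + cost_exp (HdE (VarE 0)) st + t2 + t3"] conjI) (simp_all del: fun_upd_apply)
qed

lemma runs_fold:
  fixes f :: "'s \<Rightarrow> 'a \<Rightarrow> 's" and es :: "'s \<Rightarrow> tree" and ea :: "'a \<Rightarrow> tree"
  assumes body: "\<And>i. i < length xs \<Longrightarrow> runs c N
       (Node e (Node (es (foldl f s (take i xs))) (ea (xs ! i)))) T (es (f (foldl f s (take i xs)) (xs ! i)))"
  assumes N: "0 < N"
  assumes B: "tsize (enc_list ea xs) + tsize e \<le> B" "\<And>i. tsize (es (foldl f s (take i xs))) \<le> B"
  shows "runs (fold_com N c) (N + 1) (Node (enc_list ea xs) (Node e (es s)))
    (length xs * (T + 200 * (B + 1)) + 20 * (B + 1)) (es (foldl f s xs))"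
proof (rule runsI)
  fix st :: state
  assume st: "st 0 = Node (enc_list ea xs) (Node e (es s))" "\<And>v. 0 < v \<Longrightarrow> v < N + 1 \<Longrightarrow> st v = Tip"
  let ?r = "Node Tip (Node e (es (foldl f s xs)))"
  let ?e = "TlE (TlE (VarE 0))"
  obtain t where t: "t \<le> length xs * (T + 200 * (B + 1)) + 5 * (B + 1)"
    "exec (While (HdE (VarE 0)) (fold_body N c)) st t (st(0 := ?r))"
    using fold_loop_exec[where st = st, OF body N B st] by blast
  have 2: "exec (Assign 0 ?e) (st(0 := ?r)) (1 + cost_exp ?e (st(0 := ?r))) (st(0 := es (foldl f s xs)))"
    by (rule exec_Assign') auto
  have "1 + cost_exp ?e (st(0 := ?r)) \<le> 15 * (B + 1)"
    using B(1) B(2)[of "length xs"] by simp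
  with t(1) exec_Seq[OF t(2) 2]
  show "\<exists>t \<le> length xs * (T + 200 * (B + 1)) + 20 * (B + 1).
     exec (fold_com N c) st t (st(0 := es (foldl f s xs)))"
    unfolding fold_com_def by (intro exI conjI) auto
qed

section \<open>Polynomial-time functions\<close>

text \<open>Injectivity lets the comparison of trees decide equality in every encoded type.\<close>

class tree_enc =
  fixes to_tree :: "'a \<Rightarrow> tree"
  assumes to_tree_inject: "to_tree x = to_tree y \<Longrightarrow> x = y"

lemma to_tree_eq_iff [simp]: "to_tree x = to_tree y \<longleftrightarrow> x = y"
  using to_tree_inject by blast

lemma runs_weaken:
  "runs c N x T y \<Longrightarrow> N \<le> N' \<Longrightarrow> T \<le> T' \<Longrightarrow> x = x' \<Longrightarrow> y = y' \<Longrightarrow> runs c N' x' T' y'"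
  using runs_mono by blast

lemma enc_list_inj:
  assumes "\<And>x y. x \<in> set xs \<Longrightarrow> y \<in> set ys \<Longrightarrow> f x = f y \<Longrightarrow> x = y" "enc_list f xs = enc_list f ys"
  shows "xs = ys"
  using assms
proof (induction xs arbitrary: ys)
  case Nil
  then show ?case by (cases ys) auto
next
  case (Cons x xs)
  then show ?case by (cases ys) auto
qed

lemma enc_unary_inj: "enc_unary m = enc_unary n \<Longrightarrow> m = n"
proof (induction m arbitrary: n)
  case 0
  then show ?case by (cases n) auto
next
  case (Suc m)
  then show ?case by (cases n) auto
qed

lemma enc_gate_inj: "enc_gate g = enc_gate h \<Longrightarrow> g = h"
  by (cases g; cases h) (auto dest: enc_unary_inj intro: enc_list_inj simp: numeral_eq_Suc)

instantiation tree :: tree_enc begin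
definition to_tree_tree :: "tree \<Rightarrow> tree" where "to_tree_tree t = t"
instance by standard (simp add: to_tree_tree_def)
end

instantiation unit :: tree_enc begin
definition to_tree_unit :: "unit \<Rightarrow> tree" where "to_tree_unit u = Tip"
instance by standard simp
end

instantiation bool :: tree_enc begin
definition to_tree_bool :: "bool \<Rightarrow> tree" where "to_tree_bool = enc_bool"
instance by standard (simp add: to_tree_bool_def enc_bool_def split: if_splits)
end

instantiation nat :: tree_enc begin
definition to_tree_nat :: "nat \<Rightarrow> tree" where "to_tree_nat = enc_unary"
instance by standard (simp add: to_tree_nat_def enc_unary_inj)
end

instantiation list :: (tree_enc) tree_enc begin
definition to_tree_list :: "'a list \<Rightarrow> tree" where "to_tree_list = enc_list to_tree"
instance
proof
  fix xs ys :: "'a list" assume "to_tree xs = to_tree ys"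
  then show "xs = ys" unfolding to_tree_list_def by (rule enc_list_inj[rotated]) simp
qed
end

instantiation prod :: (tree_enc, tree_enc) tree_enc begin
definition to_tree_prod :: "'a \<times> 'b \<Rightarrow> tree" where
  "to_tree_prod p = Node (to_tree (fst p)) (to_tree (snd p))"
instance by standard (simp add: to_tree_prod_def prod_eq_iff)
end

instantiation gate :: tree_enc begin
definition to_tree_gate :: "gate \<Rightarrow> tree" where "to_tree_gate = enc_gate"
instance by standard (simp add: to_tree_gate_def enc_gate_inj)
end

lemma to_tree_simps [simp]:
  "to_tree (t :: tree) = t"
  "to_tree () = Tip"
  "to_tree b = enc_bool b"
  "to_tree (0 :: nat) = Tip"
  "to_tree (Suc n) = Node Tip (to_tree n)"
  "to_tree ([] :: 'a :: tree_enc list) = Tip"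
  "to_tree ((x :: 'a) # xs) = Node (to_tree x) (to_tree xs)"
  "to_tree (x :: 'a, y :: 'b :: tree_enc) = Node (to_tree x) (to_tree y)"
  by (simp_all add: to_tree_tree_def to_tree_unit_def to_tree_bool_def to_tree_nat_def
      to_tree_list_def to_tree_prod_def)

definition sz :: "'a :: tree_enc \<Rightarrow> nat" where "sz x = tsize (to_tree x)"

lemma sz_pos [simp]: "0 < sz x"
  by (simp add: sz_def)

lemma sz_Pair [simp]: "sz (x, y) = 1 + sz x + sz y"
  by (simp add: sz_def)

lemma sz_Nil [simp]: "sz [] = 1"
  by (simp add: sz_def)

lemma sz_Cons [simp]: "sz (x # xs) = 1 + sz x + sz xs"
  by (simp add: sz_def)

lemma sz_nat [simp]: "sz (n :: nat) = 2 * n + 1"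
  by (induction n) (auto simp: sz_def)

lemma sz_append: "sz (xs @ ys) + 1 = sz xs + sz ys"
  by (induction xs) auto

lemma sz_rev [simp]: "sz (rev xs) = sz xs"
proof (induction xs)
  case (Cons x xs)
  then show ?case using sz_append[of "rev xs" "[x]"] by simp
qed simp

lemma sz_elem: "x \<in> set xs \<Longrightarrow> sz x < sz xs"
  by (induction xs) auto

lemma length_less_sz: "length xs < sz xs"
  by (induction xs) auto

lemma sz_list_le: "(\<And>x. x \<in> set xs \<Longrightarrow> sz x \<le> B) \<Longrightarrow> sz xs \<le> 1 + length xs * (B + 1)"
proof (induction xs)
  case (Cons x xs)
  from Cons.prems[of x] Cons.IH[OF Cons.prems] show ?case by simp
qed simp

lemma sz_take_le: "sz (take n xs) \<le> sz xs"
proof (induction xs arbitrary: n)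
  case (Cons x xs)
  then show ?case by (cases n) auto
qed simp

lemma sz_drop_le: "sz (drop n xs) \<le> sz xs"
proof (induction xs arbitrary: n)
  case (Cons x xs)
  then show ?case by (cases n) (auto intro: le_SucI trans_le_add2)
qed simp

section \<open>Polynomial bounds in the size of the encoded argument\<close>

definition pb :: "('a :: tree_enc \<Rightarrow> nat) \<Rightarrow> bool" where
  "pb T \<longleftrightarrow> (\<exists>C e. \<forall>a. T a \<le> C * sz a ^ e)"

lemma pb_mono: "pb T \<Longrightarrow> (\<And>a. U a \<le> T a) \<Longrightarrow> pb U"
  unfolding pb_def by (meson order_trans)

lemma pb_const: "pb (\<lambda>_. C)"
  unfolding pb_def by (intro exI[of _ C] exI[of _ 0]) simp

lemma pb_sz_self: "pb sz"
  unfolding pb_def by (intro exI[of _ 1]) simp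

lemma pb_add:
  assumes "pb T" "pb U"
  shows "pb (\<lambda>a. T a + U a)"
proof -
  obtain C D c d where CD: "\<And>a. T a \<le> C * sz a ^ c" "\<And>a. U a \<le> D * sz a ^ d"
    using assms unfolding pb_def by blast
  have "T a + U a \<le> (C + D) * sz a ^ (c + d)" for a
  proof -
    have "T a \<le> C * sz a ^ (c + d)" "U a \<le> D * sz a ^ (c + d)"
      by (rule order_trans[OF CD(1)] order_trans[OF CD(2)],
          intro mult_le_mono2 power_increasing, simp_all add: Suc_le_eq)+
    then show ?thesis by (simp add: add_mult_distrib)
  qed
  then show ?thesis unfolding pb_def by blast
qed

lemma pb_mult:
  assumes "pb T" "pb U"
  shows "pb (\<lambda>a. T a * U a)"
proof -
  obtain C D c d where CD: "\<And>a. T a \<le> C * sz a ^ c" "\<And>a. U a \<le> D * sz a ^ d"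
    using assms unfolding pb_def by blast
  have "T a * U a \<le> (C * D) * sz a ^ (c + d)" for a
    using mult_le_mono[OF CD(1)[of a] CD(2)[of a]] by (simp add: power_add algebra_simps)
  then show ?thesis unfolding pb_def by blast
qed

lemma pb_power: "pb T \<Longrightarrow> pb (\<lambda>a. T a ^ n)"
  by (induction n) (auto intro: pb_const pb_mult)

lemma pb_Suc: "pb T \<Longrightarrow> pb (\<lambda>a. Suc (T a))"
  using pb_add[OF pb_const[of 1]] by simp

text \<open>The program has to be correct on encodings only, so that no input has to be checked.\<close>

definition pt :: "('a :: tree_enc \<Rightarrow> 'b :: tree_enc) \<Rightarrow> bool" where
  "pt f \<longleftrightarrow> (\<exists>c N T. pb T \<and> (\<forall>a. runs c N (to_tree a) (T a) (to_tree (f a))))"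

lemma ptI: "pb T \<Longrightarrow> (\<And>a. runs c N (to_tree a) (T a) (to_tree (f a))) \<Longrightarrow> pt f"
  unfolding pt_def by blast

lemma ptE:
  assumes "pt f"
  obtains c N C e where "0 < N" "\<And>a. runs c N (to_tree a) (C * sz a ^ e) (to_tree (f a))"
proof -
  obtain c N T where *: "pb T" "\<And>a. runs c N (to_tree a) (T a) (to_tree (f a))"
    using assms unfolding pt_def by blast
  then obtain C e where "\<And>a. T a \<le> C * sz a ^ e" unfolding pb_def by blast
  with * have "runs c (N + 1) (to_tree a) (C * sz a ^ e) (to_tree (f a))" for a
    by (rule_tac runs_mono[of c N _ "T a"]) auto
  then show thesis by (intro that[of "N + 1"]) auto
qed

text \<open>An assignment is charged at least the size of the tree that it writes, so the cost of a
  run also limits the size of its results.\<close>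

lemma exec_size: "exec c s t s' \<Longrightarrow> (\<And>v. tsize (s v) \<le> M) \<Longrightarrow> tsize (s' v) \<le> M + t"
proof (induction arbitrary: M v rule: exec.induct)
  case (exec_Assign v' e s)
  have "tsize (eval_exp e s) \<le> cost_exp e s" by (cases e) auto
  with exec_Assign[of v] show ?case by auto
next
  case (exec_Seq c1 s t1 s' c2 t2 s'')
  then show ?case by (metis add.assoc)
next
  case (exec_IteTrue e s c1 t s' c2)
  then have "tsize (s' v) \<le> M + t" by blast
  then show ?case by simp
next
  case (exec_IteFalse e s c2 t s' c1)
  then have "tsize (s' v) \<le> M + t" by blast
  then show ?case by simp
next
  case (exec_WhileTrue e s c t1 s' t2 s'')
  then have "tsize (s'' v) \<le> M + t1 + t2" by blast
  then show ?case by simp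
next
  case (exec_Skip s)
  then show ?case by (simp add: le_SucI)
next
  case (exec_WhileFalse e s c)
  then show ?case by (simp add: trans_le_add1 le_SucI)
qed

lemma computes_in_size:
  assumes "computes_in c x t y"
  shows "tsize y \<le> tsize x + t"
proof -
  obtain s where s: "exec c ((\<lambda>_. Tip)(0 := x)) t s" "s 0 = y"
    using assms unfolding computes_in_def by blast
  have "tsize (((\<lambda>_. Tip)(0 := x)) v) \<le> tsize x" for v
    using tsize_pos[of x] by (simp add: Suc_le_eq del: tsize_pos)
  from exec_size[OF s(1) this, of 0] s(2) show ?thesis by simp
qed

lemma runs_size: "runs c N x T y \<Longrightarrow> tsize y \<le> tsize x + T"
  by (erule runs_computes_in) (fastforce dest: computes_in_size)

lemma pt_pb_sz:
  assumes "pt f"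
  shows "pb (\<lambda>a. sz (f a))"
proof -
  obtain c N C e where "\<And>a. runs c N (to_tree a) (C * sz a ^ e) (to_tree (f a))"
    using assms by (rule ptE) blast
  from runs_size[OF this] show ?thesis
    by (intro pb_mono[OF pb_add[OF pb_sz_self pb_mult[OF pb_const pb_power[OF pb_sz_self]]]])
      (simp add: sz_def)
qed

lemmas pb_intros = pb_const pb_sz_self pb_add pb_mult pb_power pb_Suc pt_pb_sz

named_theorems pt_intros

lemma pt_exp:
  assumes "only_input e" "\<And>a s. s 0 = to_tree a \<Longrightarrow> eval_exp e s = to_tree (f a)"
  shows "pt f"
proof -
  obtain K where K: "\<And>s. runs (Assign 0 e) 1 (s 0) (K * tsize (s 0)) (eval_exp e s)"
    using runs_exp[OF assms(1)] by blast
  have "runs (Assign 0 e) 1 (to_tree a) (K * sz a) (to_tree (f a))" for a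
    using K[of "\<lambda>_. to_tree a"] assms(2)[of "\<lambda>_. to_tree a" a] by (simp add: sz_def)
  then show ?thesis by (intro ptI[where T = "\<lambda>a. K * sz a"]) (auto intro!: pb_intros)
qed

lemma pt_ident [pt_intros]: "pt (\<lambda>x. x)"
  by (rule pt_exp[of "VarE 0"]) auto

text \<open>A program sees only trees, so a change of type is free: a pair is also a nonempty list,
  a unary number a list of units, and any tree a list of trees.\<close>

lemma pt_recode: "pt f \<Longrightarrow> (\<And>a. to_tree (g a) = to_tree (f a)) \<Longrightarrow> pt g"
  unfolding pt_def by simp

lemma pt_const [pt_intros]: "pt (\<lambda>_. c)"
proof -
  have "\<exists>e. only_input e \<and> (\<forall>s. eval_exp e s = t)" for t
  proof (induction t)
    case Tip
    show ?case by (intro exI[of _ TipE]) simp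
  next
    case (Node t1 t2)
    then obtain e1 e2 where "only_input e1 \<and> (\<forall>s. eval_exp e1 s = t1)"
      "only_input e2 \<and> (\<forall>s. eval_exp e2 s = t2)" by blast
    then show ?case by (intro exI[of _ "NodeE e1 e2"]) simp
  qed
  from this[of "to_tree c"] show ?thesis by (metis pt_exp)
qed

lemma pt_comp:
  assumes "pt g" "pt f"
  shows "pt (\<lambda>x. g (f x))"
proof -
  obtain c1 N1 C1 e1 where 1: "\<And>a. runs c1 N1 (to_tree a) (C1 * sz a ^ e1) (to_tree (f a))"
    using assms(2) by (rule ptE) blast
  obtain c2 N2 C2 e2 where 2: "\<And>a. runs c2 N2 (to_tree a) (C2 * sz a ^ e2) (to_tree (g a))"
    using assms(1) by (rule ptE) blast
  have "runs (Seq c1 c2) (max N1 N2) (to_tree a) (C1 * sz a ^ e1 + C2 * sz (f a) ^ e2) (to_tree (g (f a)))"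
    for a by (rule runs_Seq[OF runs_mono[OF 1] runs_mono[OF 2]]) auto
  then show ?thesis
    by (intro ptI[where T = "\<lambda>a. C1 * sz a ^ e1 + C2 * sz (f a) ^ e2"])
      (auto intro!: pb_intros assms(2))
qed

lemma pt_Pair [pt_intros]:
  assumes "pt f" "pt g"
  shows "pt (\<lambda>x. (f x, g x))"
proof -
  obtain c1 N1 C1 e1 where 1: "0 < N1" "\<And>a. runs c1 N1 (to_tree a) (C1 * sz a ^ e1) (to_tree (f a))"
    using assms(1) by (rule ptE) blast
  obtain c2 N2 C2 e2 where 2: "\<And>a. runs c2 N2 (to_tree a) (C2 * sz a ^ e2) (to_tree (g a))"
    using assms(2) by (rule ptE) blast
  let ?T = "\<lambda>a. C1 * sz a ^ e1 + C2 * sz a ^ e2 + 2 * sz a + 3 * sz (f a) + 2 * sz (g a) + 10"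
  have "runs (pair_com (max N1 N2) c1 c2) (max N1 N2 + 2) (to_tree a) (?T a) (to_tree (f a, g a))" for a
    by (rule runs_weaken[OF runs_pair[OF runs_mono[OF 1(2)[of a], of "max N1 N2"] runs_mono[OF 2[of a]]]])
      (use 1(1) in \<open>auto simp: sz_def\<close>)
  then show ?thesis
    by (intro ptI[where T = ?T]) (auto intro!: pb_intros assms)
qed

text \<open>Functions of several arguments are functions on nested pairs; under a binder, as in
  \<open>pt_map\<close>, the pair consists of the environment and the bound element.\<close>

lemma pt_comp2: "pt (\<lambda>p. F (fst p) (snd p)) \<Longrightarrow> pt f \<Longrightarrow> pt g \<Longrightarrow> pt (\<lambda>x. F (f x) (g x))"
  using pt_comp[OF _ pt_Pair, of "\<lambda>p. F (fst p) (snd p)" f g] by simp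

lemma pt_comp3: "pt (\<lambda>p. F (fst p) (fst (snd p)) (snd (snd p))) \<Longrightarrow> pt f \<Longrightarrow> pt g \<Longrightarrow> pt h \<Longrightarrow>
    pt (\<lambda>x. F (f x) (g x) (h x))"
  using pt_comp[OF _ pt_Pair[OF _ pt_Pair], of "\<lambda>p. F (fst p) (fst (snd p)) (snd (snd p))" f g h] by simp

lemma pt_if [pt_intros]:
  assumes "pt b" "pt f" "pt g"
  shows "pt (\<lambda>x. if b x then f x else g x)"
proof -
  have "pt (\<lambda>p. if fst p then f (snd p) else g (snd p))"
  proof -
    obtain c1 N1 C1 e1 where 1: "\<And>a. runs c1 N1 (to_tree a) (C1 * sz a ^ e1) (to_tree (f a))"
      using assms(2) by (rule ptE) blast
    obtain c2 N2 C2 e2 where 2: "\<And>a. runs c2 N2 (to_tree a) (C2 * sz a ^ e2) (to_tree (g a))"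
      using assms(3) by (rule ptE) blast
    let ?T = "\<lambda>p. (C1 * sz p ^ e1 + C2 * sz p ^ e2) + 4 + 3 * sz p + 3 * sz p"
    have "runs (branch_com c1 c2) (max N1 N2) (to_tree p) (?T p)
        (to_tree (if fst p then f (snd p) else g (snd p)))" for p :: "bool \<times> 'a"
    proof (cases p)
      case (Pair b' a)
      have le: "sz a \<le> sz p" "sz b' \<le> sz p" by (simp_all add: Pair)
      have "C1 * sz a ^ e1 \<le> C1 * sz p ^ e1 + C2 * sz p ^ e2"
        "C2 * sz a ^ e2 \<le> C1 * sz p ^ e1 + C2 * sz p ^ e2"
        by (simp_all add: le power_mono trans_le_add1 trans_le_add2)
      then have "runs (if to_tree b' = Tip then c2 else c1) (max N1 N2) (to_tree a)
          (C1 * sz p ^ e1 + C2 * sz p ^ e2) (to_tree (if b' then f a else g a))"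
        by (auto simp: enc_bool_def intro: runs_mono[OF 1] runs_mono[OF 2])
      from runs_branch[OF this] show ?thesis
        by (rule runs_weaken) (use le in \<open>auto simp: Pair sz_def\<close>)
    qed
    moreover have "pb ?T" by (intro pb_intros)
    ultimately show ?thesis by (rule ptI[rotated])
  qed
  from pt_comp[OF this pt_Pair[OF assms(1) pt_ident]] show ?thesis
    by (simp cong: if_cong)
qed

text \<open>Polynomial steps alone do not give a polynomial fold, since an accumulator that doubles
  in each step grows exponentially. Hence the bound \<open>B\<close> on all intermediate
  results.\<close>

lemma pt_foldl:
  assumes f: "pt (\<lambda>p. f (fst p) (fst (snd p)) (snd (snd p)))"
    and s: "pt s" and l: "pt l"
    and B: "pb B" "\<And>x n. sz (foldl (f x) (s x) (take n (l x))) \<le> B x"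
  shows "pt (\<lambda>x. foldl (f x) (s x) (l x))"
proof -
  obtain c N C e where c: "0 < N" "\<And>a. runs c N (to_tree a) (C * sz a ^ e)
     (to_tree (f (fst a) (fst (snd a)) (snd (snd a))))"
    using f by (rule ptE) blast
  define T where "T x = C * (2 + sz x + B x + sz (l x)) ^ e" for x
  define B' where "B' x = sz (l x) + sz x + B x" for x
  have pbs: "pb T" "pb B'" unfolding T_def B'_def by (auto intro!: pb_intros B l)
  obtain c0 N0 C0 e0 where c0: "\<And>x. runs c0 N0 (to_tree x) (C0 * sz x ^ e0) (to_tree (l x, x, s x))"
    using pt_Pair[OF l pt_Pair[OF pt_ident s]] by (rule ptE) blast
  let ?R = "\<lambda>x. sz (l x) * (T x + 200 * (B' x + 1)) + 20 * (B' x + 1)"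
  have "runs (fold_com N c) (N + 1) (to_tree (l x, x, s x)) (?R x) (to_tree (foldl (f x) (s x) (l x)))" for x
  proof -
    have "runs (fold_com N c) (N + 1) (Node (enc_list to_tree (l x)) (Node (to_tree x) (to_tree (s x))))
      (length (l x) * (T x + 200 * (B' x + 1)) + 20 * (B' x + 1)) (to_tree (foldl (f x) (s x) (l x)))"
    proof (rule runs_fold[OF _ c(1)])
      fix i assume i: "i < length (l x)"
      let ?a = "(x, foldl (f x) (s x) (take i (l x)), l x ! i)"
      have "sz (l x ! i) \<le> sz (l x)" using sz_elem[of "l x ! i" "l x"] i by simp
      then have "sz ?a \<le> 2 + sz x + B x + sz (l x)"
        using B(2)[of x i] by simp
      then have "C * sz ?a ^ e \<le> T x" unfolding T_def by (intro mult_le_mono2 power_mono) auto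
      from runs_mono[OF c(2)[of ?a] order_refl this]
      show "runs c N (Node (to_tree x) (Node (to_tree (foldl (f x) (s x) (take i (l x)))) (to_tree (l x ! i))))
        (T x) (to_tree (f x (foldl (f x) (s x) (take i (l x))) (l x ! i)))" by simp
    next
      show "tsize (enc_list to_tree (l x)) + tsize (to_tree x) \<le> B' x"
        by (simp add: B'_def sz_def to_tree_list_def)
      show "tsize (to_tree (foldl (f x) (s x) (take i (l x)))) \<le> B' x" for i
        using B(2)[of x i] by (simp add: B'_def sz_def)
    qed
    then show ?thesis
    proof (rule runs_weaken)
      show "length (l x) * (T x + 200 * (B' x + 1)) + 20 * (B' x + 1) \<le> ?R x"
        using length_less_sz[of "l x"] by (intro add_le_mono1 mult_le_mono1) simp
    qed (simp_all add: to_tree_list_def)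
  qed
  then have "runs (Seq c0 (fold_com N c)) (max N0 (N+1)) (to_tree x) (C0 * sz x ^ e0 + ?R x)
      (to_tree (foldl (f x) (s x) (l x)))" for x
    by (intro runs_Seq[OF runs_mono[OF c0] runs_mono]) (rule max.cobounded1 max.cobounded2 order_refl | assumption)+
  moreover have "pb (\<lambda>x. C0 * sz x ^ e0 + ?R x)"
    by (intro pb_intros l pbs)
  ultimately show ?thesis by (rule ptI[rotated])
qed

subsection \<open>Lists, numbers and truth values\<close>

lemma pt_fst [pt_intros]: "pt f \<Longrightarrow> pt (\<lambda>x. fst (f x))"
  by (rule pt_comp[of fst], rule pt_exp[of "HdE (VarE 0)"]) (auto simp: to_tree_prod_def)

lemma pt_snd [pt_intros]: "pt f \<Longrightarrow> pt (\<lambda>x. snd (f x))"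
  by (rule pt_comp[of snd], rule pt_exp[of "TlE (VarE 0)"]) (auto simp: to_tree_prod_def)

lemma pt_Cons [pt_intros]:
  assumes "pt f" "pt g"
  shows "pt (\<lambda>x. f x # g x)"
  by (rule pt_recode[OF pt_Pair[OF assms]]) simp

lemma pt_Node [pt_intros]:
  assumes "pt f" "pt g"
  shows "pt (\<lambda>x. Node (f x) (g x))"
  by (rule pt_recode[OF pt_Pair[OF assms]]) simp

lemma pt_to_tree [pt_intros]: "pt f \<Longrightarrow> pt (\<lambda>x. to_tree (f x))"
  by (erule pt_recode) simp

lemma pt_hd_tree [pt_intros]: "pt f \<Longrightarrow> pt (\<lambda>x. hd_tree (f x))"
  by (rule pt_comp[of hd_tree], rule pt_exp[of "HdE (VarE 0)"]) auto

lemma pt_tl_tree [pt_intros]: "pt f \<Longrightarrow> pt (\<lambda>x. tl_tree (f x))"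
  by (rule pt_comp[of tl_tree], rule pt_exp[of "TlE (VarE 0)"]) auto

lemma pt_tl [pt_intros]:
  assumes "pt f"
  shows "pt (\<lambda>x. tl (f x))"
proof (rule pt_comp[OF _ assms], rule pt_exp[of "TlE (VarE 0)"])
  show "eval_exp (TlE (VarE 0)) s = to_tree (tl xs)" if "s 0 = to_tree xs" for s and xs :: "'b list"
    using that by (cases xs) auto
qed simp

lemma pt_eq [pt_intros]:
  assumes "pt f" "pt g"
  shows "pt (\<lambda>x. f x = g x)"
  by (rule pt_comp2[OF _ assms], rule pt_exp[of "EqE (HdE (VarE 0)) (TlE (VarE 0))"])
    (auto simp: to_tree_prod_def enc_bool_def)

lemma pt_Not [pt_intros]: "pt f \<Longrightarrow> pt (\<lambda>x. \<not> f x)"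
  using pt_eq[of f "\<lambda>_. False"] by (simp add: pt_const)

lemma pt_conj [pt_intros]:
  assumes "pt f" "pt g"
  shows "pt (\<lambda>x. f x \<and> g x)"
proof -
  have "(\<lambda>x. f x \<and> g x) = (\<lambda>x. if f x then g x else False)" by auto
  then show ?thesis by (simp only: pt_if pt_const assms)
qed

lemma pt_disj [pt_intros]:
  assumes "pt f" "pt g"
  shows "pt (\<lambda>x. f x \<or> g x)"
proof -
  have "(\<lambda>x. f x \<or> g x) = (\<lambda>x. if f x then True else g x)" by auto
  then show ?thesis by (simp only: pt_if pt_const assms)
qed

lemma foldl_rev_map: "foldl (\<lambda>s a. f a # s) ys xs = rev (map f xs) @ ys"
  by (induction xs arbitrary: ys) auto

lemma foldl_Cons: "foldl (\<lambda>s a. a # s) ys xs = rev xs @ ys"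
  by (induction xs arbitrary: ys) auto

lemma pt_rev [pt_intros]:
  assumes "pt l"
  shows "pt (\<lambda>x. rev (l x))"
proof -
  have "pt (\<lambda>x. foldl (\<lambda>s a. a # s) [] (l x))"
    by (intro pt_foldl[where B = "\<lambda>x. sz (l x)"] pt_intros pb_intros assms)
      (simp add: foldl_Cons sz_take_le)
  then show ?thesis by (simp add: foldl_Cons)
qed

lemma pt_append [pt_intros]:
  assumes "pt k" "pt l"
  shows "pt (\<lambda>x. k x @ l x)"
proof -
  have "sz (foldl (\<lambda>s a. a # s) (l x) (take n (rev (k x)))) \<le> sz (k x) + sz (l x)" for x n
    using sz_append[of "rev (take n (rev (k x)))" "l x"] sz_take_le[of n "rev (k x)"]
    by (simp add: foldl_Cons)
  then have "pt (\<lambda>x. foldl (\<lambda>s a. a # s) (l x) (rev (k x)))"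
    by (intro pt_foldl[where B = "\<lambda>x. sz (k x) + sz (l x)"] pt_intros pb_intros assms)
  then show ?thesis by (simp add: foldl_Cons)
qed

lemma pt_map [pt_intros]:
  assumes f: "pt (\<lambda>p. f (fst p) (snd p))" and l: "pt l"
  shows "pt (\<lambda>x. map (f x) (l x))"
proof -
  obtain C e where Ce: "\<And>x a. sz (f x a) \<le> C * (1 + sz x + sz a) ^ e"
    using pt_pb_sz[OF f] unfolding pb_def by auto
  define B where "B x = 1 + sz (l x) * (C * (1 + sz x + sz (l x)) ^ e + 1)" for x
  have "sz (foldl (\<lambda>s a. f x a # s) [] (take n (l x))) \<le> B x" for x n
  proof -
    have "sz (f x a) \<le> C * (1 + sz x + sz (l x)) ^ e" if "a \<in> set (l x)" for a
      by (rule order_trans[OF Ce], intro mult_le_mono2 power_mono) (use sz_elem[OF that] in auto)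
    then have "sz (map (f x) (take n (l x))) \<le>
        1 + length (map (f x) (take n (l x))) * (C * (1 + sz x + sz (l x)) ^ e + 1)"
      by (intro sz_list_le) (auto dest: in_set_takeD)
    also have "\<dots> \<le> B x"
      unfolding B_def using length_less_sz[of "l x"] by (intro add_left_mono mult_le_mono1) auto
    finally show ?thesis by (simp add: foldl_rev_map)
  qed
  moreover have "pb B" unfolding B_def by (intro pb_intros l)
  ultimately have "pt (\<lambda>x. foldl (\<lambda>s a. f x a # s) [] (l x))"
    by (intro pt_foldl[where B = B and f = "\<lambda>x s a. f x a # s"] pt_intros l pt_comp2[OF f])
  from pt_rev[OF this] show ?thesis by (simp add: foldl_rev_map)
qed

lemma pt_concat [pt_intros]:
  assumes l: "pt l"
  shows "pt (\<lambda>x. concat (l x))"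
proof -
  have eq: "foldl (@) ys xss = ys @ concat xss" for ys :: "'b list" and xss
    by (induction xss arbitrary: ys) auto
  have sz: "sz (concat xss) \<le> sz xss" for xss :: "'b list list"
  proof (induction xss)
    case (Cons xs xss)
    then show ?case using sz_append[of xs "concat xss"] by simp
  qed simp
  have "pt (\<lambda>x. foldl (@) [] (l x))"
    by (intro pt_foldl[where B = "\<lambda>x. sz (l x)"] pt_intros pb_intros l)
      (simp add: eq order_trans[OF sz sz_take_le])
  then show ?thesis by (simp add: eq)
qed

lemma pt_filter [pt_intros]:
  assumes P: "pt (\<lambda>p. P (fst p) (snd p))" and l: "pt l"
  shows "pt (\<lambda>x. filter (P x) (l x))"
proof -
  have eq: "filter Q xs = concat (map (\<lambda>a. if Q a then [a] else []) xs)" for Q and xs :: "'b list"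
    by (induction xs) auto
  show ?thesis unfolding eq by (intro pt_intros P l)
qed

lemma pt_ball [pt_intros]:
  assumes P: "pt (\<lambda>p. P (fst p) (snd p))" and l: "pt l"
  shows "pt (\<lambda>x. \<forall>a \<in> set (l x). P x a)"
proof -
  have "pt (\<lambda>x. filter (\<lambda>a. \<not> P x a) (l x) = [])" by (intro pt_intros P l)
  then show ?thesis by (simp add: filter_empty_conv)
qed

lemma pt_bex [pt_intros]:
  assumes P: "pt (\<lambda>p. P (fst p) (snd p))" and l: "pt l"
  shows "pt (\<lambda>x. \<exists>a \<in> set (l x). P x a)"
proof -
  have "pt (\<lambda>x. filter (P x) (l x) \<noteq> [])" by (intro pt_intros P l)
  then show ?thesis by (simp add: filter_empty_conv)
qed

lemma pt_member [pt_intros]: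
  assumes "pt f" "pt l"
  shows "pt (\<lambda>x. f x \<in> set (l x))"
proof -
  have "pt (\<lambda>x. \<exists>a \<in> set (l x). a = f x)"
    by (intro pt_intros assms pt_comp[OF assms(1)])
  then show ?thesis by simp
qed

lemma to_tree_nat_units: "to_tree n = to_tree (replicate n ())"
  by (induction n) auto

lemma pt_length [pt_intros]:
  assumes "pt l"
  shows "pt (\<lambda>x. length (l x))"
proof -
  have "pt (\<lambda>x. map (\<lambda>_. ()) (l x))" by (intro pt_intros assms)
  then show ?thesis by (rule pt_recode) (simp add: to_tree_nat_units map_replicate_const)
qed

lemma pt_replicate [pt_intros]:
  assumes "pt n" "pt f"
  shows "pt (\<lambda>x. replicate (n x) (f x))"
proof -
  have "pt (\<lambda>x. replicate (n x) ())"
    by (rule pt_recode[OF assms(1)]) (simp add: to_tree_nat_units)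
  then have "pt (\<lambda>x. map (\<lambda>_. f x) (replicate (n x) ()))"
    by (intro pt_intros pt_comp[OF assms(2)])
  then show ?thesis by simp
qed

lemma pt_Suc [pt_intros]: "pt n \<Longrightarrow> pt (\<lambda>x. Suc (n x))"
  using pt_length[OF pt_Cons[OF pt_const pt_replicate[OF _ pt_const]], of n "()" "()"] by simp

lemma pt_plus [pt_intros]:
  assumes "pt m" "pt n"
  shows "pt (\<lambda>x. m x + n x :: nat)"
proof -
  have "pt (\<lambda>x. length (replicate (m x) () @ replicate (n x) ()))" by (intro pt_intros assms)
  then show ?thesis by simp
qed

lemma pt_times [pt_intros]:
  assumes "pt m" "pt n"
  shows "pt (\<lambda>x. m x * n x :: nat)"
proof -
  have "pt (\<lambda>x. length (concat (replicate (m x) (replicate (n x) ()))))" by (intro pt_intros assms)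
  then show ?thesis by (simp add: length_concat sum_list_replicate)
qed

lemma pt_power: "pt m \<Longrightarrow> pt (\<lambda>x. m x ^ e :: nat)"
  by (induction e) (auto intro: pt_const pt_times)

lemma foldl_tl: "foldl (\<lambda>s _. tl s) xs ys = drop (length ys) xs"
  by (induction ys arbitrary: xs) (auto simp: drop_Suc)

lemma pt_drop [pt_intros]:
  assumes n: "pt n" and l: "pt l"
  shows "pt (\<lambda>x. drop (n x) (l x))"
proof -
  have "pt (\<lambda>x. foldl (\<lambda>s _. tl s) (l x) (replicate (n x) ()))"
    by (intro pt_foldl[where B = "\<lambda>x. sz (l x)"] pt_intros pb_intros n l)
      (simp add: foldl_tl sz_drop_le)
  then show ?thesis by (simp add: foldl_tl)
qed

lemma pt_minus [pt_intros]:
  assumes "pt m" "pt n"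
  shows "pt (\<lambda>x. m x - n x :: nat)"
proof -
  have "pt (\<lambda>x. length (drop (n x) (replicate (m x) ())))" by (intro pt_intros assms)
  then show ?thesis by simp
qed

lemma pt_less [pt_intros]:
  assumes "pt m" "pt n"
  shows "pt (\<lambda>x. m x < (n x :: nat))"
proof -
  have "pt (\<lambda>x. n x - m x \<noteq> 0)" by (intro pt_intros assms)
  then show ?thesis by (simp add: not_le)
qed

lemma pt_upt [pt_intros]:
  assumes n: "pt n"
  shows "pt (\<lambda>x. [0..<n x])"
proof -
  have eq: "foldl (\<lambda>s _. s @ [length s]) [] ys = [0..<length ys]" for ys :: "unit list"
    by (induction ys rule: rev_induct) auto
  define B where "B x = 1 + n x * (2 * n x + 1 + 1)" for x
  have "pb B" unfolding B_def
    by (intro pb_intros pb_mono[OF pt_pb_sz[OF n], of n]) simp_all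
  moreover have "sz [0..<m] \<le> B x" if "m \<le> n x" for m x
  proof -
    have "sz [0..<m] \<le> 1 + length [0..<m] * (2 * n x + 1 + 1)"
      by (rule sz_list_le) (use that in auto)
    also have "\<dots> \<le> B x" unfolding B_def using that by (intro add_left_mono mult_le_mono1) auto
    finally show ?thesis .
  qed
  then have "sz (foldl (\<lambda>s _. s @ [length s]) [] (take m (replicate (n x) ()))) \<le> B x" for m x
    unfolding eq by simp
  ultimately have "pt (\<lambda>x. foldl (\<lambda>s _. s @ [length s]) [] (replicate (n x) ()))"
    by (intro pt_foldl[where B = B] pt_intros n)
  then show ?thesis by (simp add: eq)
qed

text \<open>A program has to return something definite on the empty list, where \<open>hd\<close> is
  unspecified.\<close>

definition hd_default :: "'a \<Rightarrow> 'a list \<Rightarrow> 'a" where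
  "hd_default d xs = (if xs = [] then d else hd xs)"

lemma hd_default_simps [simp]: "hd_default d [] = d" "hd_default d (x # xs) = x"
  by (simp_all add: hd_default_def)

lemma pt_hd_default [pt_intros]:
  assumes "pt d" "pt l"
  shows "pt (\<lambda>x. hd_default (d x) (l x))"
proof -
  have eq: "foldl (\<lambda>_ a. a) d xs = (if xs = [] then d else last xs)" for d :: 'b and xs
    by (induction xs arbitrary: d) auto
  have sz: "sz (foldl (\<lambda>_ a. a) (d x) (take n (rev (l x)))) \<le> sz (d x) + sz (l x)" for x n
  proof (cases "take n (rev (l x)) = []")
    case False
    then have "last (take n (rev (l x))) \<in> set (l x)"
      by (metis in_set_takeD last_in_set set_rev)
    from sz_elem[OF this] False show ?thesis by (simp add: eq)
  next
    case True
    show ?thesis unfolding True by simp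
  qed
  have "pt (\<lambda>x. foldl (\<lambda>_ a. a) (d x) (rev (l x)))"
    by (intro pt_foldl[where B = "\<lambda>x. sz (d x) + sz (l x)"] pt_intros pb_intros assms sz)
  then show ?thesis by (simp add: eq hd_default_def last_rev cong: if_cong)
qed

definition nth_default :: "'a \<Rightarrow> 'a list \<Rightarrow> nat \<Rightarrow> 'a" where
  "nth_default d xs i = hd_default d (drop i xs)"

lemma nth_default_Cons [simp]:
  "nth_default d (x # xs) 0 = x"
  "nth_default d (x # xs) (Suc n) = nth_default d xs n"
  by (simp_all add: nth_default_def)

lemma nth_default_nth [simp]: "i < length xs \<Longrightarrow> nth_default d xs i = xs ! i"
  by (simp add: nth_default_def hd_default_def hd_drop_conv_nth)

lemma pt_nth_default [pt_intros]:
  "pt d \<Longrightarrow> pt l \<Longrightarrow> pt n \<Longrightarrow> pt (\<lambda>x. nth_default (d x) (l x) (n x))"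
  unfolding nth_default_def by (intro pt_intros)

section \<open>Circuits of bounded depth\<close>

fun tag :: "gate \<Rightarrow> nat" where
  "tag Input = 0"
| "tag (Neg j) = 1"
| "tag (Conj js) = 2"
| "tag (Disj js) = 3"

abbreviation gate_at :: "circuit \<Rightarrow> nat \<Rightarrow> gate" where
  "gate_at C i \<equiv> nth_default Input C i"

lemma to_tree_gate: "to_tree (g :: gate) = enc_gate g"
  by (simp add: to_tree_gate_def)

lemma pt_tag [pt_intros]: "pt f \<Longrightarrow> pt (\<lambda>x. tag (f x))"
proof (rule pt_comp[of tag])
  have "hd_tree (to_tree g) = to_tree (tag g)" for g
    by (cases g) (auto simp: to_tree_gate to_tree_nat_def)
  then show "pt tag" by (intro pt_exp[of "HdE (VarE 0)"]) auto
qed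

lemma pt_preds [pt_intros]: "pt f \<Longrightarrow> pt (\<lambda>x. preds (f x))"
proof (rule pt_comp[of preds])
  \<comment> \<open>\<open>enc_gate\<close> stores the predecessor of a negation bare, so it is
    wrapped into a one-element list.\<close>
  have "pt (\<lambda>g. if tag g = 1 then Node (tl_tree (to_tree g)) Tip else tl_tree (to_tree g))"
    by (intro pt_intros)
  then show "pt preds"
  proof (rule pt_recode)
    fix g
    show "to_tree (preds g) =
        to_tree (if tag g = 1 then Node (tl_tree (to_tree g)) Tip else tl_tree (to_tree g))"
      by (cases g) (auto simp: to_tree_gate to_tree_nat_def to_tree_list_def)
  qed
qed

text \<open>Recursion on the constant depth replaces recursion on gate numbers: every
  \<open>d\<close> has a program of its own, and polynomial time follows by induction on
  \<open>d\<close>. At level \<open>0\<close> the value is right for input gates only.\<close>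

fun eval :: "nat \<Rightarrow> circuit \<Rightarrow> nat list \<Rightarrow> nat \<Rightarrow> bool" where
  "eval 0 C A i \<longleftrightarrow> i \<in> set A"
| "eval (Suc d) C A i \<longleftrightarrow>
    (if tag (gate_at C i) = 0 then i \<in> set A
     else if tag (gate_at C i) = 1 then \<not> (\<exists>j \<in> set (preds (gate_at C i)). eval d C A j)
     else if tag (gate_at C i) = 2 then \<forall>j \<in> set (preds (gate_at C i)). eval d C A j
     else \<exists>j \<in> set (preds (gate_at C i)). eval d C A j)"

text \<open>A version for programs of fixed nesting depth of the condition that every path from an
  input to gate \<open>i\<close> has at most \<open>d\<close> edges and at most \<open>w\<close>
  large gates; see \<open>ok_iff_paths\<close>.\<close>

fun ok :: "nat \<Rightarrow> nat \<Rightarrow> circuit \<Rightarrow> nat \<Rightarrow> bool" where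
  "ok 0 w C i \<longleftrightarrow> tag (gate_at C i) = 0"
| "ok (Suc d) w C i \<longleftrightarrow>
    tag (gate_at C i) = 0 \<or>
    (if 2 < length (preds (gate_at C i))
     then 0 < w \<and> (\<forall>j \<in> set (preds (gate_at C i)). ok d (w - 1) C j)
     else \<forall>j \<in> set (preds (gate_at C i)). ok d w C j)"

text \<open>A disjunctive normal form of the statement that gate \<open>i\<close> has value \<open>b\<close>, over literals \<open>(j, c)\<close>
  saying that gate \<open>j\<close> has value \<open>c\<close>. In a circuit of weft 1 the gates \<open>j\<close> lie below the large gates.\<close>

fun alts :: "nat \<Rightarrow> circuit \<Rightarrow> nat \<Rightarrow> bool \<Rightarrow> (nat \<times> bool) list list" where
  "alts 0 C i b = [[(i, b)]]"
| "alts (Suc d) C i b =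
    (if tag (gate_at C i) = 0 then [[(i, b)]]
     else if tag (gate_at C i) = 1 then alts d C (nth_default 0 (preds (gate_at C i)) 0) (\<not> b)
     else if 2 < length (preds (gate_at C i)) then
       (if (tag (gate_at C i) = 2) = b then [map (\<lambda>j. (j, b)) (preds (gate_at C i))]
        else map (\<lambda>j. [(j, b)]) (preds (gate_at C i)))
     else if (tag (gate_at C i) = 2) = b then
       concat (map (\<lambda>p. map (\<lambda>q. p @ q) (alts d C (nth_default 0 (preds (gate_at C i)) 1) b))
         (alts d C (nth_default 0 (preds (gate_at C i)) 0) b))
     else alts d C (nth_default 0 (preds (gate_at C i)) 0) b @
       alts d C (nth_default 0 (preds (gate_at C i)) 1) b)"

definition violations :: "nat \<Rightarrow> circuit \<Rightarrow> (nat \<times> bool) list \<Rightarrow> nat list \<Rightarrow> nat" where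
  "violations d C ls A = length (filter (\<lambda>l. eval d C A (fst l) \<noteq> snd l) ls)"

lemma pt_eval [pt_intros]:
  assumes "pt C" "pt A" "pt i"
  shows "pt (\<lambda>x. eval d (C x) (A x) (i x))"
proof (rule pt_comp3[OF _ assms])
  show "pt (\<lambda>p. eval d (fst p) (fst (snd p)) (snd (snd p)))"
  proof (induction d)
    case 0
    show ?case unfolding eval.simps by (intro pt_intros)
  next
    case (Suc d)
    show ?case unfolding eval.simps by (intro pt_intros pt_comp3[OF Suc.IH])
  qed
qed

lemma pt_ok [pt_intros]:
  assumes "pt C" "pt i"
  shows "pt (\<lambda>x. ok d w (C x) (i x))"
proof (rule pt_comp2[OF _ assms])
  show "pt (\<lambda>p. ok d w (fst p) (snd p))"
  proof (induction d arbitrary: w)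
    case 0
    show ?case unfolding ok.simps by (intro pt_intros)
  next
    case (Suc d)
    show ?case unfolding ok.simps
      by (intro pt_intros pt_comp2[OF Suc.IH[of w]] pt_comp2[OF Suc.IH[of "w - 1"]])
  qed
qed

lemma pt_alts [pt_intros]:
  assumes "pt C" "pt i" "pt b"
  shows "pt (\<lambda>x. alts d (C x) (i x) (b x))"
proof (rule pt_comp3[OF _ assms])
  show "pt (\<lambda>p. alts d (fst p) (fst (snd p)) (snd (snd p)))"
  proof (induction d)
    case 0
    show ?case unfolding alts.simps by (intro pt_intros)
  next
    case (Suc d)
    show ?case unfolding alts.simps by (intro pt_intros pt_comp3[OF Suc.IH])
  qed
qed

lemma pt_violations [pt_intros]:
  assumes "pt C" "pt ls" "pt A"
  shows "pt (\<lambda>x. violations d (C x) (ls x) (A x))"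
  by (rule pt_comp3[OF _ assms]) (unfold violations_def, intro pt_intros)

section \<open>Gate values and the disjunctive normal form\<close>

lemma wf_circuitD:
  assumes "wf_circuit C" "i < length C"
  shows "gate_arity_ok (C ! i)" "j \<in> set (preds (C ! i)) \<Longrightarrow> j < i"
  using assms by (auto simp: wf_circuit_def)

lemma wf_preds_nonempty:
  assumes "wf_circuit C" "i < length C" "C ! i \<noteq> Input"
  shows "preds (C ! i) \<noteq> []"
  using wf_circuitD(1)[OF assms(1,2)] assms(3) by (cases "C ! i") auto

lemma tag_eq_0 [simp]: "tag g = 0 \<longleftrightarrow> g = Input"
  by (cases g) auto

lemma gate_value_wf:
  assumes "wf_circuit C" "i < length C"
  shows "gate_value C A i =
    (case C ! i of
        Input \<Rightarrow> i \<in> A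
      | Neg j \<Rightarrow> \<not> gate_value C A j
      | Conj js \<Rightarrow> (\<forall>j \<in> set js. gate_value C A j)
      | Disj js \<Rightarrow> (\<exists>j \<in> set js. gate_value C A j))"
  using wf_circuitD(2)[OF assms] by (subst gate_value.simps) (auto split: gate.split)

lemma eval_gate_value:
  assumes "wf_circuit C"
  shows "i < length C \<Longrightarrow> ok d w C i \<Longrightarrow> eval d C A i = gate_value C (set A) i"
proof (induction d arbitrary: w i)
  case 0
  then show ?case by (simp add: gate_value_wf[OF assms])
next
  case (Suc d)
  have IH: "eval d C A j = gate_value C (set A) j" if "j \<in> set (preds (C ! i))" "C ! i \<noteq> Input" for j
    using Suc.IH[of j w] Suc.IH[of j "w - 1"] Suc.prems that wf_circuitD(2)[OF assms Suc.prems(1) that(1)]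
    by (auto split: if_splits)
  show ?case
    using IH Suc.prems(1) by (subst gate_value_wf[OF assms Suc.prems(1)]) (cases "C ! i"; simp)
qed

lemma ok_mono: "ok d w C i \<Longrightarrow> ok (Suc d) w C i"
proof (induction d arbitrary: w i)
  case (Suc d)
  from Suc.prems have "tag (gate_at C i) = 0 \<or>
    (if 2 < length (preds (gate_at C i))
     then 0 < w \<and> (\<forall>j \<in> set (preds (gate_at C i)). ok d (w - 1) C j)
     else \<forall>j \<in> set (preds (gate_at C i)). ok d w C j)" by (simp only: ok.simps)
  then show ?case using Suc.IH by (subst ok.simps) (metis (no_types, lifting))
qed simp

text \<open>Without large gates every gate has at most two predecessors, so the set of relevant
  inputs at most doubles with each level.\<close>

lemma eval_depends_on:
  assumes "wf_circuit C"
  shows "i < length C \<Longrightarrow> ok d 0 C i \<Longrightarrow>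
    \<exists>U. finite U \<and> card U \<le> 2 ^ d \<and> (\<forall>A. gate_value C A i = gate_value C (A \<inter> U) i)"
proof (induction d arbitrary: i)
  case 0
  then show ?case by (intro exI[of _ "{i}"]) (simp add: gate_value_wf[OF assms])
next
  case (Suc d)
  show ?case
  proof (cases "C ! i = Input")
    case True
    then show ?thesis using Suc.prems
      by (intro exI[of _ "{i}"]) (simp add: gate_value_wf[OF assms])
  next
    case False
    let ?P = "set (preds (C ! i))"
    have len: "length (preds (C ! i)) \<le> 2" and ok: "\<forall>j \<in> ?P. ok d 0 C j"
      using Suc.prems False by (auto split: if_splits)
    have "\<exists>U. finite U \<and> card U \<le> 2 ^ d \<and> (\<forall>A. gate_value C A j = gate_value C (A \<inter> U) j)"
      if "j \<in> ?P" for j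
      using Suc.IH[of j] ok that wf_circuitD(2)[OF assms Suc.prems(1) that] Suc.prems(1) by simp
    then obtain U where U: "\<And>j. j \<in> ?P \<Longrightarrow> finite (U j) \<and> card (U j) \<le> 2 ^ d \<and>
        (\<forall>A. gate_value C A j = gate_value C (A \<inter> U j) j)" by metis
    let ?V = "\<Union>j \<in> ?P. U j"
    have eq: "gate_value C (A \<inter> ?V) j = gate_value C A j" if "j \<in> ?P" for j A
    proof -
      have "A \<inter> ?V \<inter> U j = A \<inter> U j" using that by auto
      then show ?thesis using U[OF that] by metis
    qed
    have "card ?V \<le> (\<Sum>j \<in> ?P. card (U j))" by (rule card_UN_le) simp
    also have "\<dots> \<le> card ?P * 2 ^ d" using sum_bounded_above[of ?P "\<lambda>j. card (U j)" "2 ^ d"] U by simp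
    also have "\<dots> \<le> 2 * 2 ^ d" using len card_length[of "preds (C ! i)"] by (intro mult_le_mono1) simp
    finally have "card ?V \<le> 2 ^ Suc d" by simp
    moreover have "gate_value C A i = gate_value C (A \<inter> ?V) i" for A
      using eq[of _ A] False
      by (subst (1 2) gate_value_wf[OF assms Suc.prems(1)]) (cases "C ! i"; simp)
    moreover have "finite ?V" using U by auto
    ultimately show ?thesis by blast
  qed
qed

lemma ex_conjunction_product:
  "(\<exists>ls \<in> set (concat (map (\<lambda>p. map (\<lambda>q. p @ q) Y) X)). \<forall>l \<in> set ls. P l) \<longleftrightarrow>
    (\<exists>ls \<in> set X. \<forall>l \<in> set ls. P l) \<and> (\<exists>ls \<in> set Y. \<forall>l \<in> set ls. P l)"
  by (auto simp: ball_Un)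

lemma all_literals_product:
  "\<forall>ls \<in> set X. \<forall>l \<in> set ls. P l \<Longrightarrow> \<forall>ls \<in> set Y. \<forall>l \<in> set ls. P l \<Longrightarrow>
    \<forall>ls \<in> set (concat (map (\<lambda>p. map (\<lambda>q. p @ q) Y) X)). \<forall>l \<in> set ls. P l"
  by (simp add: ball_Un)

text \<open>The budget of one large gate is spent at the first large gate met from the top, so its
  predecessors satisfy \<open>ok d 0\<close> and can serve as literals. Above it, the polarity
  \<open>b\<close> decides by De Morgan whether a gate acts as a conjunction or as a disjunction. A
  product of two lists at most squares the number of alternatives, which stays polynomial for fixed
  \<open>d\<close>.\<close>

lemma alts_correct:
  assumes "wf_circuit C"
  shows "i < length C \<Longrightarrow> ok d 1 C i \<Longrightarrow>
    (gate_value C A i = b \<longleftrightarrow> (\<exists>ls \<in> set (alts d C i b). \<forall>l \<in> set ls. gate_value C A (fst l) = snd l)) \<and>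
    (\<forall>ls \<in> set (alts d C i b). \<forall>l \<in> set ls. fst l < length C \<and> ok d 0 C (fst l))"
proof (induction d arbitrary: i b)
  case 0
  then show ?case by simp
next
  case (Suc d)
  define V where "V ls \<longleftrightarrow> (\<forall>l \<in> set ls. gate_value C A (fst l) = snd l)" for ls
  define L where "L ls \<longleftrightarrow> (\<forall>l \<in> set ls. fst l < length C \<and> ok (Suc d) 0 C (fst l))" for ls :: "(nat \<times> bool) list"
  note gv = gate_value_wf[OF assms Suc.prems(1)]
  note lt = wf_circuitD(2)[OF assms Suc.prems(1)]
  have len: "j < length C" if "j \<in> set (preds (C ! i))" for j
    using lt[OF that] Suc.prems(1) by simp
  have prodV: "(\<exists>ls \<in> set (concat (map (\<lambda>p. map (\<lambda>q. p @ q) Y) X)). V ls) \<longleftrightarrow>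
    (\<exists>ls \<in> set X. V ls) \<and> (\<exists>ls \<in> set Y. V ls)" for X Y
    unfolding V_def by (rule ex_conjunction_product)
  have prodL: "\<forall>ls \<in> set X. L ls \<Longrightarrow> \<forall>ls \<in> set Y. L ls \<Longrightarrow>
    \<forall>ls \<in> set (concat (map (\<lambda>p. map (\<lambda>q. p @ q) Y) X)). L ls" for X Y
    unfolding L_def by (rule all_literals_product)
  have g: "gate_at C i = C ! i" using Suc.prems(1) by simp
  have "(gate_value C A i = b \<longleftrightarrow> (\<exists>ls \<in> set (alts (Suc d) C i b). V ls)) \<and>
    (\<forall>ls \<in> set (alts (Suc d) C i b). L ls)"
  proof (cases "C ! i = Input")
    case True
    then show ?thesis using Suc.prems by (simp add: V_def L_def)
  next
    case nInput: False
    show ?thesis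
    proof (cases "2 < length (preds (C ! i))")
      case large: True
      then have ok: "\<forall>j \<in> set (preds (C ! i)). ok d 0 C j" using Suc.prems nInput by simp
      have ok': "j < length C \<and> ok (Suc d) 0 C j" if "j \<in> set (preds (C ! i))" for j
        using ok ok_mono len that by blast
      have t1: "tag (C ! i) \<noteq> 1" using large by (cases "C ! i") auto
      have alts: "alts (Suc d) C i b = (if (tag (C ! i) = 2) = b then [map (\<lambda>j. (j, b)) (preds (C ! i))]
        else map (\<lambda>j. [(j, b)]) (preds (C ! i)))"
        unfolding alts.simps g using large t1 nInput by simp
      have "\<forall>ls \<in> set (alts (Suc d) C i b). L ls"
        unfolding alts L_def using ok' by (auto simp del: ok.simps)
      moreover have "gate_value C A i = b \<longleftrightarrow> (\<exists>ls \<in> set (alts (Suc d) C i b). V ls)"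
        unfolding alts V_def gv using large by (cases "C ! i"; cases b) auto
      ultimately show ?thesis by blast
    next
      case small: False
      then have ok: "\<forall>j \<in> set (preds (C ! i)). ok d 1 C j" using Suc.prems nInput by simp
      have lits: "\<forall>ls \<in> set (alts d C j b'). L ls"
        if "j \<in> set (preds (C ! i))" for j b'
        unfolding L_def using Suc.IH[OF len[OF that]] ok that ok_mono by blast
      have val: "gate_value C A j = b' \<longleftrightarrow> (\<exists>ls \<in> set (alts d C j b'). V ls)"
        if "j \<in> set (preds (C ! i))" for j b'
        unfolding V_def using Suc.IH[OF len[OF that]] ok that by blast
      \<comment> \<open>By duality, only the truth value of \<open>(t = 2) = b\<close> matters for a
        gate with two predecessors.\<close>
      have binary: ?thesis
        if js: "preds (C ! i) = [j, k]" and t: "tag (C ! i) = t" "t = 2 \<or> t = 3" for j k t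
      proof -
        have t01: "t \<noteq> 0" "t \<noteq> 1" using t(2) by auto
        have mem: "j \<in> set (preds (C ! i))" "k \<in> set (preds (C ! i))" using js by simp_all
        note val = val[OF mem(1)] val[OF mem(2)] and lits = lits[OF mem(1)] lits[OF mem(2)]
        have gv': "gate_value C A i \<longleftrightarrow> (if t = 2 then gate_value C A j \<and> gate_value C A k
            else gate_value C A j \<or> gate_value C A k)"
          unfolding gv using js t by (cases "C ! i") auto
        show ?thesis
        proof (cases "(t = 2) = b")
          case True
          have alts: "alts (Suc d) C i b = concat (map (\<lambda>p. map (\<lambda>q. p @ q) (alts d C k b)) (alts d C j b))"
            unfolding alts.simps g js t(1) using t01 True by simp
          have "gate_value C A i = b \<longleftrightarrow> gate_value C A j = b \<and> gate_value C A k = b"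
            using gv' True by auto
          then show ?thesis
            unfolding alts prodV val[symmetric] using prodL[OF lits] by blast
        next
          case False
          have alts: "alts (Suc d) C i b = alts d C j b @ alts d C k b"
            unfolding alts.simps g js t(1) using t01 False by simp
          have "gate_value C A i = b \<longleftrightarrow> gate_value C A j = b \<or> gate_value C A k = b"
            using gv' False by auto
          then show ?thesis
            unfolding alts set_append bex_Un ball_Un val[symmetric] using lits by blast
        qed
      qed
      show ?thesis
      proof (cases "C ! i")
        case Input
        then show ?thesis using nInput by simp
      next
        case (Neg j)
        then have "alts (Suc d) C i b = alts d C j (\<not> b)"
          using Suc.prems(1) by simp
        moreover have "gate_value C A i = b \<longleftrightarrow> gate_value C A j = (\<not> b)"
          unfolding gv using Neg by auto
        ultimately show ?thesis using val[of j "\<not> b"] lits[of j "\<not> b"] Neg by simp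
      next
        case (Conj js)
        with small wf_circuitD(1)[OF assms Suc.prems(1)] have "length js = 2" by simp
        then obtain j k where "js = [j, k]" by (auto simp: numeral_2_eq_2 length_Suc_conv)
        then show ?thesis using Conj binary by simp
      next
        case (Disj js)
        with small wf_circuitD(1)[OF assms Suc.prems(1)] have "length js = 2" by simp
        then obtain j k where "js = [j, k]" by (auto simp: numeral_2_eq_2 length_Suc_conv)
        then show ?thesis using Disj binary by simp
      qed
    qed
  qed
  then show ?case unfolding V_def L_def .
qed

section \<open>Weft and depth as bounds on paths from the inputs to an arbitrary gate\<close>

definition input_path :: "circuit \<Rightarrow> nat \<Rightarrow> nat list \<Rightarrow> bool" where
  "input_path C i p \<longleftrightarrow> p \<noteq> [] \<and> set p \<subseteq> {..<length C} \<and> hd p \<in> input_gates C \<and> last p = i \<and>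
     successively (\<lambda>i j. i \<in> set (preds (C ! j))) p"

lemma input_path_Input:
  assumes "C ! i = Input"
  shows "input_path C i p \<longleftrightarrow> p = [i] \<and> i < length C"
proof (cases p rule: rev_cases)
  case (snoc ys y)
  then show ?thesis using assms
    by (cases ys rule: rev_cases)
      (auto simp: input_path_def successively_append_iff input_gates_def)
qed (simp add: input_path_def)

lemma input_path_step:
  assumes "C ! i \<noteq> Input"
  shows "input_path C i p \<longleftrightarrow>
    (\<exists>q. \<exists>j \<in> set (preds (C ! i)). p = q @ [i] \<and> i < length C \<and> input_path C j q)"
proof (cases p rule: rev_cases)
  case (snoc ys y)
  then show ?thesis using assms
    by (cases ys rule: rev_cases)
      (auto simp: input_path_def successively_append_iff input_gates_def hd_append)
qed (simp add: input_path_def)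

text \<open>Passing to predecessors ends in an input, because all other gates have predecessors and
  these have smaller numbers. Without such a path, bounds on all paths could hold vacuously where
  \<open>ok\<close> fails.\<close>

lemma input_path_exists:
  assumes "wf_circuit C"
  shows "i < length C \<Longrightarrow> \<exists>p. input_path C i p"
proof (induction i rule: less_induct)
  case (less i)
  show ?case
  proof (cases "C ! i = Input")
    case True
    then show ?thesis using less.prems by (auto simp: input_path_Input)
  next
    case False
    then obtain j where j: "j \<in> set (preds (C ! i))"
      using wf_preds_nonempty[OF assms less.prems] by (meson last_in_set)
    from wf_circuitD(2)[OF assms less.prems j] less obtain q where "input_path C j q" by auto
    then show ?thesis using False j less.prems by (auto simp: input_path_step)
  qed
qed

lemma ok_iff_paths:
  assumes "wf_circuit C"
  shows "i < length C \<Longrightarrow> ok d w C i \<longleftrightarrow>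
    (\<forall>p. input_path C i p \<longrightarrow> length p - 1 \<le> d \<and> length (filter (large_gate C) p) \<le> w)"
proof (induction d arbitrary: w i)
  case 0
  show ?case
  proof (cases "C ! i = Input")
    case True
    then show ?thesis using 0 by (simp add: input_path_Input large_gate_def)
  next
    case False
    obtain p where p: "input_path C i p" using input_path_exists[OF assms 0] by blast
    then obtain q j where "p = q @ [i]" "input_path C j q"
      using input_path_step[OF False] by blast
    then have "p = q @ [i]" "q \<noteq> []" by (auto simp: input_path_def)
    then have "\<not> length p - 1 \<le> 0" by simp
    then show ?thesis using p False 0 by auto
  qed
next
  case (Suc d)
  show ?case
  proof (cases "C ! i = Input")
    case True
    then show ?thesis using Suc.prems by (simp add: input_path_Input large_gate_def)
  next
    case False
    let ?P = "set (preds (C ! i))"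
    have IH: "ok d w' C j \<longleftrightarrow>
       (\<forall>p. input_path C j p \<longrightarrow> length p - 1 \<le> d \<and> length (filter (large_gate C) p) \<le> w')"
      if "j \<in> ?P" for j w'
      using Suc.IH[of j w'] wf_circuitD(2)[OF assms Suc.prems that] Suc.prems by simp
    have ne: "0 < length q" if "input_path C j q" for j q
      using that by (simp add: input_path_def)
    \<comment> \<open>As some path leads to a predecessor, a large gate \<open>i\<close> is
      incompatible with \<open>w = 0\<close>.\<close>
    have ex: "\<exists>j \<in> ?P. \<exists>q. input_path C j q"
    proof -
      obtain p where "input_path C i p" using input_path_exists[OF assms Suc.prems] by blast
      then show ?thesis using False by (auto simp: input_path_step)
    qed
    have "(\<forall>p. input_path C i p \<longrightarrow> length p - 1 \<le> Suc d \<and> length (filter (large_gate C) p) \<le> w) \<longleftrightarrow>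
      (\<forall>j \<in> ?P. \<forall>q. input_path C j q \<longrightarrow> length q - 1 \<le> d \<and>
         length (filter (large_gate C) q) + (if large_gate C i then 1 else 0) \<le> w)"
      using Suc.prems ne by (fastforce simp: input_path_step[OF False])
    also have "\<dots> \<longleftrightarrow> ok (Suc d) w C i"
    proof (cases "large_gate C i")
      case True
      then have l: "2 < length (preds (C ! i))" by (simp add: large_gate_def)
      have "ok (Suc d) w C i \<longleftrightarrow> 0 < w \<and> (\<forall>j \<in> ?P. ok d (w - 1) C j)"
        using l False Suc.prems by simp
      also have "\<dots> \<longleftrightarrow> (\<forall>j \<in> ?P. \<forall>q. input_path C j q \<longrightarrow> length q - 1 \<le> d \<and>
         length (filter (large_gate C) q) + (if large_gate C i then 1 else 0) \<le> w)"
        using ex True IH by (cases w) auto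
      finally show ?thesis by simp
    next
      case nl: False
      then have l: "\<not> 2 < length (preds (C ! i))" by (simp add: large_gate_def)
      have "ok (Suc d) w C i \<longleftrightarrow> (\<forall>j \<in> ?P. ok d w C j)"
        using l False Suc.prems by simp
      then show ?thesis using nl IH by simp
    qed
    finally show ?thesis by simp
  qed
qed

lemma ok_iff_weft_depth:
  assumes "wf_circuit C"
  shows "ok d w C (length C - 1) \<longleftrightarrow> weft_le C w \<and> depth_le C d"
proof -
  have "length C - 1 < length C" using assms by (simp add: wf_circuit_def)
  from ok_iff_paths[OF assms this] show ?thesis
    by (auto simp: weft_le_def depth_le_def io_path_def input_path_def)
qed

text \<open>The conditions of \<open>WCS 1 d\<close> on the circuit, phrased with operations known
  to be polynomial; distinctness therefore becomes a comparison of positions.\<close>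

definition check :: "nat \<Rightarrow> circuit \<Rightarrow> bool" where
  "check d C \<longleftrightarrow> C \<noteq> [] \<and>
     (\<forall>i \<in> set [0..<length C]. (tag (gate_at C i) < 2 \<or> 1 < length (preds (gate_at C i)) \<and>
         (\<forall>a \<in> set [0..<length (preds (gate_at C i))]. \<forall>b \<in> set [0..<a].
            nth_default 0 (preds (gate_at C i)) a \<noteq> nth_default 0 (preds (gate_at C i)) b)) \<and>
       (\<forall>j \<in> set (preds (gate_at C i)). j < i)) \<and>
     ok d 1 C (length C - 1)"

lemma pt_check [pt_intros]: "pt f \<Longrightarrow> pt (\<lambda>x. check d (f x))"
  by (rule pt_comp[of "check d"], unfold check_def, intro pt_intros)

lemma distinct_conv_nth_less:
  "distinct xs \<longleftrightarrow> (\<forall>a < length xs. \<forall>b < a. xs ! a \<noteq> xs ! b)"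
proof -
  have "a < b \<or> b < a" if "a \<noteq> b" for a b :: nat using that by auto
  then show ?thesis unfolding distinct_conv_nth
    by (metis (no_types) order.strict_trans nat_neq_iff)
qed

lemma check_iff: "check d C \<longleftrightarrow> wf_circuit C \<and> weft_le C 1 \<and> depth_le C d"
proof -
  have arity: "gate_arity_ok g \<longleftrightarrow> tag g < 2 \<or> 1 < length (preds g) \<and> distinct (preds g)" for g
    by (cases g) auto
  have "check d C \<longleftrightarrow> wf_circuit C \<and> ok d 1 C (length C - 1)"
    unfolding check_def wf_circuit_def arity distinct_conv_nth_less
    by (auto simp: Ball_def)
  then show ?thesis using ok_iff_weft_depth by blast
qed

subsection \<open>Recognising encodings of circuits\<close>

text \<open>Every tree encodes exactly one list of trees. A reduction receives arbitrary trees, so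
  the list structure must be accessible before it is known whether the input encodes a
  circuit.\<close>

fun spine :: "tree \<Rightarrow> tree list" where
  "spine Tip = []"
| "spine (Node a b) = a # spine b"

lemma to_tree_spine [simp]: "to_tree (spine t) = t"
  by (induction t) auto

lemma pt_spine [pt_intros]: "pt f \<Longrightarrow> pt (\<lambda>x. spine (f x))"
  by (erule pt_recode) simp

definition is_unary :: "tree \<Rightarrow> bool" where
  "is_unary t \<longleftrightarrow> (\<forall>u \<in> set (spine t). u = Tip)"

definition is_gate :: "tree \<Rightarrow> bool" where
  "is_gate t \<longleftrightarrow> t = enc_gate Input \<or>
     t \<noteq> Tip \<and> (hd_tree t = enc_unary 1 \<and> is_unary (tl_tree t) \<or>
       (hd_tree t = enc_unary 2 \<or> hd_tree t = enc_unary 3) \<and> (\<forall>u \<in> set (spine (tl_tree t)). is_unary u))"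

definition is_circuit :: "tree \<Rightarrow> bool" where
  "is_circuit t \<longleftrightarrow> (\<forall>u \<in> set (spine t). is_gate u)"

lemma is_unary_iff: "is_unary t \<longleftrightarrow> (\<exists>n. t = enc_unary n)"
proof (induction t)
  case Tip
  show ?case by (auto simp: is_unary_def intro: exI[of _ 0])
next
  case (Node a b)
  have "is_unary (Node a b) \<longleftrightarrow> a = Tip \<and> is_unary b" by (auto simp: is_unary_def)
  also have "\<dots> \<longleftrightarrow> (\<exists>n. Node a b = enc_unary n)"
    using Node.IH(2) by (metis enc_unary.elims enc_unary.simps(2) tree.distinct(1) tree.inject)
  finally show ?case .
qed

lemma spine_decode:
  assumes "\<And>u. P u \<longleftrightarrow> (\<exists>x. u = f x)"
  shows "(\<forall>u \<in> set (spine t). P u) \<longleftrightarrow> (\<exists>xs. t = enc_list f xs)"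
proof (induction t)
  case Tip
  show ?case by (auto intro: exI[of _ "[]"])
next
  case (Node a b)
  have "(\<exists>xs. Node a b = enc_list f xs) \<longleftrightarrow> (\<exists>x xs. a = f x \<and> b = enc_list f xs)"
    by (metis enc_list.elims enc_list.simps(2) tree.distinct(1) tree.inject)
  then show ?case using Node.IH(2) assms[of a] by auto
qed

lemma is_gate_iff: "is_gate t \<longleftrightarrow> (\<exists>g. t = enc_gate g)"
proof
  assume "is_gate t"
  then consider "t = enc_gate Input"
    | a b where "t = Node a b" "a = enc_unary 1" "is_unary b"
    | a b where "t = Node a b" "a = enc_unary 2" "\<forall>u \<in> set (spine b). is_unary u"
    | a b where "t = Node a b" "a = enc_unary 3" "\<forall>u \<in> set (spine b). is_unary u"
    by (cases t) (auto simp: is_gate_def)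
  then show "\<exists>g. t = enc_gate g"
  proof cases
    case 2
    then show ?thesis by (metis is_unary_iff enc_gate.simps(2))
  next
    case 3
    then show ?thesis using spine_decode[of is_unary enc_unary b] is_unary_iff
      by (metis enc_gate.simps(3))
  next
    case 4
    then show ?thesis using spine_decode[of is_unary enc_unary b] is_unary_iff
      by (metis enc_gate.simps(4))
  qed blast
next
  assume "\<exists>g. t = enc_gate g"
  then obtain g where "t = enc_gate g" by blast
  moreover have "\<forall>u \<in> set (spine (enc_list enc_unary js)). is_unary u" for js
    using spine_decode[of is_unary enc_unary "enc_list enc_unary js"] is_unary_iff by blast
  ultimately show "is_gate t"
    by (cases g) (auto simp: is_gate_def is_unary_iff)
qed

lemma is_circuit_iff: "is_circuit t \<longleftrightarrow> (\<exists>C :: circuit. t = to_tree C)"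
  using spine_decode[of is_gate enc_gate t] is_gate_iff
  by (simp add: is_circuit_def to_tree_list_def to_tree_gate_def)

lemma pt_is_unary [pt_intros]: "pt f \<Longrightarrow> pt (\<lambda>x. is_unary (f x))"
  by (rule pt_comp[of is_unary], unfold is_unary_def, intro pt_intros)

lemma pt_is_gate [pt_intros]: "pt f \<Longrightarrow> pt (\<lambda>x. is_gate (f x))"
  by (rule pt_comp[of is_gate], unfold is_gate_def, intro pt_intros)

lemma pt_is_circuit [pt_intros]: "pt f \<Longrightarrow> pt (\<lambda>x. is_circuit (f x))"
  by (rule pt_comp[of is_circuit], unfold is_circuit_def, intro pt_intros)

section \<open>Moebius inversion\<close>

text \<open>The Moebius transform of \<open>f\<close> on the lattice of finite sets.\<close>

definition alternating :: "(nat set \<Rightarrow> int) \<Rightarrow> nat set \<Rightarrow> int" where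
  "alternating f I = (\<Sum>J \<in> Pow I. (-1) ^ card (I - J) * f J)"

text \<open>A discrete derivative in direction \<open>x\<close>: the subsets with \<open>x\<close>
  keep their sign, and those without \<open>x\<close> change it.\<close>

lemma alternating_insert:
  assumes "finite I" "x \<notin> I"
  shows "alternating f (insert x I) = alternating (\<lambda>J. f (insert x J)) I - alternating f I"
proof -
  have 1: "(-1) ^ card (insert x I - J) * f J = - ((-1) ^ card (I - J) * f J)" if "J \<in> Pow I" for J
  proof -
    have "insert x I - J = insert x (I - J)" "x \<notin> I - J" using that assms(2) by auto
    then show ?thesis using assms(1) by simp
  qed
  have 2: "(-1) ^ card (insert x I - insert x J) * f (insert x J) = (-1) ^ card (I - J) * f (insert x J)"
    if "J \<in> Pow I" for J
  proof -
    have "insert x I - insert x J = I - J" using that assms(2) by auto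
    then show ?thesis by simp
  qed
  have inj: "inj_on (insert x) (Pow I)"
    using assms(2) by (auto simp: inj_on_def insert_ident subset_iff)
  have "alternating f (insert x I) = (\<Sum>J \<in> Pow I. (-1) ^ card (insert x I - J) * f J) +
      (\<Sum>J \<in> insert x ` Pow I. (-1) ^ card (insert x I - J) * f J)"
    unfolding alternating_def Pow_insert
    by (rule sum.union_disjoint) (use assms in auto)
  also have "(\<Sum>J \<in> insert x ` Pow I. (-1) ^ card (insert x I - J) * f J) =
      alternating (\<lambda>J. f (insert x J)) I"
    unfolding alternating_def sum.reindex[OF inj] by (rule sum.cong) (use 2 in auto)
  also have "(\<Sum>J \<in> Pow I. (-1) ^ card (insert x I - J) * f J) = - alternating f I"
    unfolding alternating_def sum_negf[symmetric] by (rule sum.cong) (use 1 in auto)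
  finally show ?thesis by simp
qed

text \<open>The sets with \<open>x\<close> contribute the transform of
  \<open>\<lambda>J. f (insert x J)\<close> minus that of \<open>f\<close>, and the latter cancels
  against the sets without \<open>x\<close>. Hence the induction is over all
  \<open>f\<close>.\<close>

lemma alternating_inversion:
  assumes "finite A"
  shows "(\<Sum>I \<in> Pow A. alternating f I) = f A"
  using assms
proof (induction A arbitrary: f)
  case empty
  then show ?case by (simp add: alternating_def)
next
  case (insert x A)
  have inj: "inj_on (insert x) (Pow A)"
    using insert.hyps(2) by (auto simp: inj_on_def insert_ident subset_iff)
  have "(\<Sum>I \<in> Pow (insert x A). alternating f I) =
      (\<Sum>I \<in> Pow A. alternating f I) + (\<Sum>I \<in> insert x ` Pow A. alternating f I)"
    unfolding Pow_insert by (rule sum.union_disjoint) (use insert.hyps in auto)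
  also have "(\<Sum>I \<in> insert x ` Pow A. alternating f I) =
      (\<Sum>I \<in> Pow A. alternating (\<lambda>J. f (insert x J)) I - alternating f I)"
    unfolding sum.reindex[OF inj] comp_def using insert.hyps
    by (intro sum.cong refl alternating_insert) (auto intro: rev_finite_subset[OF insert.hyps(1)])
  finally show ?case by (simp add: sum_subtractf insert.IH)
qed

text \<open>The derivative in a direction \<open>x\<close> on which \<open>f\<close> does not depend
  is zero.\<close>

lemma alternating_vanishes:
  assumes "finite I" "x \<in> I" "x \<notin> U" "\<And>J. f J = f (J \<inter> U)"
  shows "alternating f I = 0"
proof -
  have "insert x J \<inter> U = J \<inter> U" for J using assms(3) by auto
  then have "f (insert x J) = f J" for J using assms(4)[of J] assms(4)[of "insert x J"] by metis
  then have "alternating (\<lambda>J. f (insert x J)) (I - {x}) = alternating f (I - {x})" by presburger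
  then show ?thesis
    using alternating_insert[of "I - {x}" x f] assms(1,2) by (simp add: insert_absorb)
qed

text \<open>The terms with \<open>I\<close> not contained in \<open>U\<close> vanish, so no large sets are needed.\<close>

lemma alternating_bounded:
  assumes "finite A" "finite U" "card U \<le> q" "\<And>J. f J = f (J \<inter> U)"
  shows "(\<Sum>I \<in> {I. I \<subseteq> A \<and> card I \<le> q}. alternating f I) = f A"
proof -
  have "(\<Sum>I \<in> {I. I \<subseteq> A \<and> card I \<le> q}. alternating f I) = (\<Sum>I \<in> Pow A. alternating f I)"
  proof (rule sum.mono_neutral_left)
    show "\<forall>I \<in> Pow A - {I. I \<subseteq> A \<and> card I \<le> q}. alternating f I = 0"
    proof
      fix I assume I: "I \<in> Pow A - {I. I \<subseteq> A \<and> card I \<le> q}"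
      have "\<not> I \<subseteq> U" using I card_mono[OF assms(2), of I] assms(3) by auto
      then obtain x where "x \<in> I" "x \<notin> U" by blast
      moreover have "finite I" using I by (intro rev_finite_subset[OF assms(1)]) auto
      ultimately show "alternating f I = 0" by (intro alternating_vanishes[of I x U f] assms(4))
    qed
  qed (use assms(1) in auto)
  then show ?thesis using alternating_inversion[OF assms(1)] by simp
qed

section \<open>Sorted lists of bounded length\<close>

text \<open>A new head is compared with all later entries, so \<open>R\<close> may be any relation;
  each list arises once if \<open>L\<close> is distinct. For constant \<open>q\<close> the number of
  lists is polynomial.\<close>

fun slists :: "('a \<Rightarrow> 'a \<Rightarrow> bool) \<Rightarrow> nat \<Rightarrow> 'a list \<Rightarrow> 'a list list" where
  "slists R 0 L = [[]]"
| "slists R (Suc q) L =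
    [] # concat (map (\<lambda>w. map (\<lambda>x. x # w) (filter (\<lambda>x. \<forall>y \<in> set w. R x y) L)) (slists R q L))"

lemma set_slists: "set (slists R q L) = {w. set w \<subseteq> set L \<and> length w \<le> q \<and> sorted_wrt R w}"
proof (induction q)
  case 0
  show ?case by auto
next
  case (Suc q)
  have "w \<in> set (slists R (Suc q) L) \<longleftrightarrow> set w \<subseteq> set L \<and> length w \<le> Suc q \<and> sorted_wrt R w" for w
    by (cases w) (auto simp: Suc)
  then show ?case by blast
qed

lemma distinct_slists: "distinct L \<Longrightarrow> distinct (slists R q L)"
proof (induction q)
  case (Suc q)
  have d: "distinct (map (\<lambda>x. x # w) (filter P L))" for w P
    using Suc.prems by (simp add: distinct_map inj_on_def)
  have "distinct (concat (map (\<lambda>w. map (\<lambda>x. x # w) (filter (\<lambda>x. \<forall>y \<in> set w. R x y) L)) ws))"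
    if "distinct ws" for ws
    using that by (induction ws) (use d in auto)
  then show ?case using Suc by auto
qed simp

definition sgn_coords :: "nat \<Rightarrow> (nat \<times> bool) list" where
  "sgn_coords k = concat (map (\<lambda>c. [(c, True), (c, False)]) [0..<k])"

lemma set_sgn_coords [simp]: "set (sgn_coords k) = {..<k} \<times> UNIV"
  by (auto simp: sgn_coords_def)

lemma distinct_sgn_coords: "distinct (sgn_coords k)"
  by (induction k) (auto simp: sgn_coords_def)

text \<open>A list \<open>r\<close> in \<open>index_lists q k\<close> encodes the pair of sets \<open>J \<subseteq> I\<close> where \<open>I\<close> consists of
  all its coordinates and \<open>J\<close> of those marked \<open>True\<close>.\<close>

definition index_lists :: "nat \<Rightarrow> nat \<Rightarrow> (nat \<times> bool) list list" where
  "index_lists q k = slists (\<lambda>x y. fst x < fst y) q (sgn_coords k)"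

lemma set_index_lists:
  "set (index_lists q k) =
    {r. fst ` set r \<subseteq> {..<k} \<and> length r \<le> q \<and> sorted_wrt (\<lambda>x y. fst x < fst y) r}"
  by (auto simp: index_lists_def set_slists subset_iff image_iff)

lemma distinct_index_lists: "distinct (index_lists q k)"
  unfolding index_lists_def by (intro distinct_slists distinct_sgn_coords)

definition marked :: "('a \<times> bool) list \<Rightarrow> 'a list" where
  "marked r = map fst (filter snd r)"

definition unmarked :: "('a \<times> bool) list \<Rightarrow> 'a list" where
  "unmarked r = map fst (filter (\<lambda>x. \<not> snd x) r)"

text \<open>Index lists are in bijection with the pairs of sets: \<open>?g\<close> sorts
  \<open>I\<close> and marks the members of \<open>J\<close>, and \<open>?h\<close> reads both sets
  off again.\<close>

lemma sum_index_lists: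
  "(\<Sum>r \<in> set (index_lists q k). (-1) ^ length (unmarked r) * f (set (marked r))) =
    (\<Sum>I \<in> {I. I \<subseteq> {..<k} \<and> card I \<le> q}. alternating f I)"
proof -
  let ?S = "Sigma {I. I \<subseteq> {..<k} \<and> card I \<le> q} Pow"
  let ?g = "\<lambda>(I, J). map (\<lambda>c. (c, c \<in> J)) (sorted_list_of_set I)"
  let ?h = "\<lambda>r. (fst ` set r, set (marked r))"
  have fin: "finite {I. I \<subseteq> {..<k} \<and> card I \<le> q}"
    by (rule finite_subset[of _ "Pow {..<k}"]) auto
  have sorted: "sorted_wrt (<) (map fst r) \<and> distinct (map fst r)"
    if "r \<in> set (index_lists q k)" for r
  proof -
    have "sorted_wrt (<) (map fst r)" using that by (simp add: set_index_lists sorted_wrt_map)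
    then show ?thesis by (simp add: strict_sorted_iff)
  qed
  have "(\<Sum>I \<in> {I. I \<subseteq> {..<k} \<and> card I \<le> q}. alternating f I) =
      (\<Sum>(I, J) \<in> ?S. (-1) ^ card (I - J) * f J)"
    unfolding alternating_def by (rule sum.Sigma) (use fin in \<open>auto intro: rev_finite_subset[OF finite_lessThan]\<close>)
  also have "\<dots> = (\<Sum>r \<in> set (index_lists q k). (-1) ^ length (unmarked r) * f (set (marked r)))"
  proof (rule sum.reindex_bij_witness[of _ ?h ?g])
    fix p assume p: "p \<in> ?S"
    obtain I J where IJ: "p = (I, J)" "I \<subseteq> {..<k}" "card I \<le> q" "J \<subseteq> I" using p by auto
    have finI: "finite I" using IJ(2) finite_subset by blast
    have fst_g: "fst ` set (?g p) = I" using finI by (simp add: IJ(1) image_image)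
    have marked_g: "set (marked (?g p)) = J"
      using finI IJ(4) by (auto simp: IJ(1) marked_def filter_map comp_def)
    show "?h (?g p) = p"
      using fst_g marked_g by (simp add: IJ(1))
    show "?g p \<in> set (index_lists q k)"
      using finI IJ(2,3) fst_g by (simp add: set_index_lists sorted_wrt_map IJ(1))
    have "length (unmarked (?g p)) = length (filter (\<lambda>c. c \<notin> J) (sorted_list_of_set I))"
      by (simp add: unmarked_def IJ filter_map comp_def)
    also have "\<dots> = card (I - J)"
    proof -
      have "set (filter (\<lambda>c. c \<notin> J) (sorted_list_of_set I)) = I - J" using finI by auto
      then show ?thesis
        using distinct_card[of "filter (\<lambda>c. c \<notin> J) (sorted_list_of_set I)"] by simp
    qed
    finally have "length (unmarked (?g p)) = card (I - J)" .
    with marked_g show "(-1) ^ length (unmarked (?g p)) * f (set (marked (?g p))) =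
        (case p of (I, J) \<Rightarrow> (-1) ^ card (I - J) * f J)" by (simp add: IJ)
  next
    fix r assume r: "r \<in> set (index_lists q k)"
    note s = sorted[OF r]
    have "length r = card (fst ` set r)" using s distinct_card[of "map fst r"] by simp
    then show "?h r \<in> ?S" using r by (auto simp: set_index_lists marked_def)
    have list: "sorted_list_of_set (fst ` set r) = map fst r"
      using s by (metis list.set_map sorted_list_of_set.idem_if_sorted_distinct strict_sorted_iff)
    have "(fst x \<in> fst ` {y \<in> set r. snd y}) = snd x" if "x \<in> set r" for x
      using s that by (auto simp: distinct_map inj_on_def)
    then show "?g (?h r) = r"
      by (auto simp: list marked_def intro!: map_idI)
  qed
  finally show ?thesis by simp
qed

lemma sum_index_lists_eq:
  assumes "inj_on a {..<k}" "finite U" "card U \<le> q" "\<And>B. F B = F (B \<inter> U)"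
  shows "(\<Sum>r \<in> set (index_lists q k). (-1) ^ length (unmarked r) * F (a ` set (marked r))) = (F (a ` {..<k}) :: int)"
proof -
  \<comment> \<open>Inversion takes place on coordinates. Pulled back along \<open>a\<close>, the
    function depends only on the coordinates mapped into \<open>U\<close>; the intersection discards
    those where nothing is known about \<open>a\<close>.\<close>
  define f where "f J = F (a ` (J \<inter> {..<k}))" for J
  define V where "V = {c. c < k \<and> a c \<in> U}"
  have V: "finite V" "card V \<le> q" "f J = f (J \<inter> V)" for J
  proof -
    show "finite V" by (simp add: V_def)
    have "card V = card (a ` V)" using assms(1) by (intro card_image[symmetric]) (auto simp: V_def inj_on_def)
    also have "\<dots> \<le> card U" by (rule card_mono[OF assms(2)]) (auto simp: V_def)
    finally show "card V \<le> q" using assms(3) by simp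
    have "a ` (J \<inter> {..<k}) \<inter> U = a ` (J \<inter> V \<inter> {..<k}) \<inter> U" by (auto simp: V_def)
    then show "f J = f (J \<inter> V)" unfolding f_def by (metis assms(4))
  qed
  have "F (a ` set (marked r)) = f (set (marked r))" if "r \<in> set (index_lists q k)" for r
  proof -
    have "set (marked r) \<inter> {..<k} = set (marked r)"
      using that by (auto simp: set_index_lists marked_def)
    then show ?thesis by (simp add: f_def)
  qed
  then have "(\<Sum>r \<in> set (index_lists q k). (-1) ^ length (unmarked r) * F (a ` set (marked r))) =
      (\<Sum>r \<in> set (index_lists q k). (-1) ^ length (unmarked r) * f (set (marked r)))" by simp
  also have "\<dots> = f {..<k}"
    unfolding sum_index_lists by (rule alternating_bounded[where U = V]) (use V in auto)
  finally show ?thesis by (simp add: f_def)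
qed

section \<open>Numbers given by their digits\<close>

definition num :: "nat \<Rightarrow> nat list \<Rightarrow> nat" where
  "num b ds = foldr (\<lambda>d x. d + 2 ^ b * x) ds 0"

lemma num_simps [simp]: "num b [] = 0" "num b (d # ds) = d + 2 ^ b * num b ds"
  by (simp_all add: num_def)

text \<open>Digits may exceed the base here, as \<open>num\<close> is linear in them. Bounds enter
  only through \<open>num_inject\<close>.\<close>

lemma sum_list_num:
  "sum_list (map (\<lambda>g. num b (map g K)) gs) = num b (map (\<lambda>x. sum_list (map (\<lambda>g. g x) gs)) K)"
proof (induction K)
  case (Cons x K)
  then show ?case by (simp add: sum_list_addf sum_list_const_mult)
qed simp

lemma num_inject:
  assumes "length ds = length es" "\<forall>d \<in> set ds. d < 2 ^ b" "\<forall>e \<in> set es. e < 2 ^ b" "num b ds = num b es"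
  shows "ds = es"
  using assms
proof (induction ds es rule: list_induct2)
  case (Cons d ds e es)
  from Cons.prems have eq: "d + 2 ^ b * num b ds = e + 2 ^ b * num b es" and lt: "d < 2 ^ b" "e < 2 ^ b"
    by auto
  have "(d + 2 ^ b * num b ds) mod 2 ^ b = d" "(e + 2 ^ b * num b es) mod 2 ^ b = e" using lt by simp_all
  with eq have "d = e" by metis
  with eq have "num b ds = num b es" by simp
  with Cons \<open>d = e\<close> show ?case by simp
qed simp

lemma sum_digits_iff:
  assumes "\<And>x. x \<in> set K \<Longrightarrow> sum_list (map (\<lambda>g. g x) gs) < 2 ^ b" "\<And>x. x \<in> set K \<Longrightarrow> t x < 2 ^ b"
  shows "sum_list (map (\<lambda>g. num b (map g K)) gs) = num b (map t K) \<longleftrightarrow>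
    (\<forall>x \<in> set K. sum_list (map (\<lambda>g. g x) gs) = t x)"
proof
  assume "sum_list (map (\<lambda>g. num b (map g K)) gs) = num b (map t K)"
  then have "num b (map (\<lambda>x. sum_list (map (\<lambda>g. g x) gs)) K) = num b (map t K)"
    by (simp add: sum_list_num)
  from num_inject[OF _ _ _ this] assms have "map (\<lambda>x. sum_list (map (\<lambda>g. g x) gs)) K = map t K" by auto
  then show "\<forall>x \<in> set K. sum_list (map (\<lambda>g. g x) gs) = t x" by simp
next
  assume "\<forall>x \<in> set K. sum_list (map (\<lambda>g. g x) gs) = t x"
  then have "map (\<lambda>x. sum_list (map (\<lambda>g. g x) gs)) K = map t K" by simp
  then show "sum_list (map (\<lambda>g. num b (map g K)) gs) = num b (map t K)"
    by (simp only: sum_list_num)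
qed

section \<open>Selecting an assignment by a sum of digits\<close>

text \<open>A key with a list \<open>r\<close> and a coordinate \<open>c\<close> is the digit position \<open>([r], [c])\<close>;
  positions depending on only one or none of the two leave the other component empty. An item is a
  list in \<open>index_lists q k\<close> with a value for each coordinate, together with a value \<open>p\<close> for the
  additional coordinate \<open>k\<close>; a reference fixes the value of one coordinate.\<close>

type_synonym key = "(nat \<times> bool) list list \<times> nat list"

definition low_keys :: "(nat \<times> bool) list list \<Rightarrow> nat \<Rightarrow> key list" where
  "low_keys R k = map (\<lambda>r. ([r], [])) R @ map (\<lambda>c. ([], [c])) [0..<Suc k] @
     concat (map (\<lambda>r. map (\<lambda>c. ([r], [c])) [0..<Suc k]) R)"

text \<open>\<open>([], [])\<close> comes last and is thus the leading digit. It is positive in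
  every number that occurs, so that padding the lower digits yields exact binary
  representations.\<close>

definition keys :: "(nat \<times> bool) list list \<Rightarrow> nat \<Rightarrow> key list" where
  "keys R k = low_keys R k @ [([], [])]"

text \<open>The default 0 for a coordinate that the item does not cover matches the digit 0 of the
  target there.\<close>

definition value_at :: "nat \<Rightarrow> ((nat \<times> bool) \<times> nat) list \<Rightarrow> nat \<Rightarrow> nat \<Rightarrow> nat" where
  "value_at k w p c = (if c = k then p else hd_default 0 (map snd (filter (\<lambda>e. fst (fst e) = c) w)))"

text \<open>\<open>map fst w\<close> is the index list \<open>r\<close> of the item. The digit at
  \<open>([r], [])\<close> counts how often \<open>r\<close> is selected, those at
  \<open>([r], [c])\<close> announce the assumed values, and \<open>([], [])\<close> holds the term
  \<open>v\<close> of the Moebius sum.\<close>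

definition item_digit :: "nat \<Rightarrow> ((nat \<times> bool) \<times> nat) list \<Rightarrow> nat \<Rightarrow> nat \<Rightarrow> key \<Rightarrow> nat" where
  "item_digit k w p v x =
     (if fst x = [] then (if snd x = [] then v else 0)
      else if fst x = [map fst w] then (if snd x = [] then 1 else value_at k w p (hd_default 0 (snd x)))
      else 0)"

text \<open>Every item depends on the conjunction \<open>p\<close>, so coordinate \<open>k\<close>
  is covered by all index lists.\<close>

definition covers :: "nat \<Rightarrow> (nat \<times> bool) list \<Rightarrow> nat \<Rightarrow> bool" where
  "covers k r c \<longleftrightarrow> c = k \<or> c \<in> set (map fst r)"

text \<open>At \<open>([r], [c])\<close> the complement \<open>N - a\<close> fills up the value in
  the item for \<open>r\<close> to \<open>N\<close> exactly if both agree. The 1 at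
  \<open>([], [])\<close> keeps the leading digit positive and is compensated in the target.\<close>

definition ref_digit :: "nat \<Rightarrow> nat \<Rightarrow> nat \<Rightarrow> nat \<Rightarrow> key \<Rightarrow> nat" where
  "ref_digit k N c a x =
     (if snd x = [] then (if fst x = [] then 1 else 0)
      else if snd x \<noteq> [c] then 0
      else if fst x = [] then 1
      else if covers k (hd_default [] (fst x)) c then N - a else 0)"

definition target_digit :: "nat \<Rightarrow> nat \<Rightarrow> nat \<Rightarrow> key \<Rightarrow> nat" where
  "target_digit k N M x =
     (if fst x = [] then (if snd x = [] then M else 1)
      else if snd x = [] then 1
      else if covers k (hd_default [] (fst x)) (hd_default 0 (snd x)) then N else 0)"

text \<open>The shift by \<open>z\<close>, larger than all values of \<open>f\<close>, makes the
  signed term a positive digit; for the same reason the subtraction is not truncated.\<close>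

definition signed_digit :: "nat \<Rightarrow> (nat list \<Rightarrow> nat) \<Rightarrow> ((nat \<times> bool) \<times> nat) list \<Rightarrow> nat" where
  "signed_digit z f w =
     (if even (length (filter (\<lambda>e. \<not> snd (fst e)) w)) then z + f (map snd (filter (\<lambda>e. snd (fst e)) w))
      else z - f (map snd (filter (\<lambda>e. snd (fst e)) w)))"

lemma filter_eq_sym: "filter (\<lambda>e. g e = c) es = filter (\<lambda>e. c = g e) es"
  by (rule filter_cong) auto

lemma sum_list_if:
  "sum_list (map (\<lambda>x. if P x then h x else 0) xs) = (sum_list (map h (filter P xs)) :: nat)"
  by (induction xs) auto

lemma sum_list_by_key:
  assumes "finite R" "\<forall>x \<in> set xs. key x \<in> R"
  shows "sum_list (map h xs) = (\<Sum>r \<in> R. sum_list (map h (filter (\<lambda>x. key x = r) xs)) :: nat)"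
  using assms(2)
proof (induction xs)
  case (Cons x xs)
  have "(\<Sum>r \<in> R. sum_list (map h (filter (\<lambda>x. key x = r) (x # xs)))) =
      (\<Sum>r \<in> R. (if key x = r then h x else 0) + sum_list (map h (filter (\<lambda>x. key x = r) xs)))"
    by (intro sum.cong) auto
  also have "\<dots> = h x + (\<Sum>r \<in> R. sum_list (map h (filter (\<lambda>x. key x = r) xs)))"
    using Cons.prems assms(1) by (simp add: sum.distrib)
  finally show ?case using Cons by simp
qed simp

lemma filter_coord:
  assumes "sorted_wrt (\<lambda>x y. fst (fst x) < fst (fst y)) w" "e \<in> set w"
  shows "filter (\<lambda>e'. fst (fst e') = (fst (fst e) :: nat)) w = [e]"
  using assms
proof (induction w)
  case (Cons x w)
  show ?case
  proof (cases "e = x")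
    case True
    then have "filter (\<lambda>e'. fst (fst e') = fst (fst e)) w = []"
      using Cons.prems(1) by (auto simp: filter_empty_conv)
    then show ?thesis using True by simp
  next
    case False
    then have e: "e \<in> set w" using Cons.prems(2) by simp
    then have "fst (fst x) < fst (fst e)" using Cons.prems(1) by simp
    then show ?thesis using Cons.IH[OF _ e] Cons.prems(1) by simp
  qed
qed simp

text \<open>Abstracts from circuits: sought are a \<open>k\<close>-subset of \<open>X\<close> and
  some \<open>p < nA\<close> where \<open>F\<close> vanishes; \<open>f\<close> is the version of
  \<open>F\<close> on lists that programs can evaluate. The bound \<open>2 \<le> q\<close> provides
  the index lists with two coordinates.\<close>

locale selection =
  fixes k q nA N z :: nat and X :: "nat set" and f :: "nat \<Rightarrow> nat list \<Rightarrow> nat" and F :: "nat \<Rightarrow> nat set \<Rightarrow> nat"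
  assumes X_less: "\<And>x. x \<in> X \<Longrightarrow> x < N" and nA_le: "nA \<le> N" and q_ge: "2 \<le> q"
    and f_F: "\<And>p xs. p < nA \<Longrightarrow> f p xs = F p (set xs)"
    and F_less: "\<And>p B. p < nA \<Longrightarrow> F p B < z"
    and moebius: "\<And>p h. p < nA \<Longrightarrow> inj_on h {..<k} \<Longrightarrow>
      (\<Sum>r \<in> set (index_lists q k). (-1) ^ length (unmarked r) * int (F p (h ` set (marked r)))) =
        int (F p (h ` {..<k}))"
begin

text \<open>Values increase along with the coordinates, so an item with coordinates
  \<open>i < j\<close> certifies that its values differ.\<close>

definition items :: "(((nat \<times> bool) \<times> nat) list \<times> nat) set" where
  "items = {(w, p). sorted_wrt (\<lambda>x y. fst (fst x) < fst (fst y) \<and> snd x < snd y) w \<and> length w \<le> q \<and>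
     (fst \<circ> fst) ` set w \<subseteq> {..<k} \<and> snd ` set w \<subseteq> X \<and> p < nA}"

definition refs :: "(nat \<times> nat) set" where
  "refs = {(c, a). c < k \<and> a \<in> X \<or> c = k \<and> a < nA}"

definition item_fun :: "((nat \<times> bool) \<times> nat) list \<times> nat \<Rightarrow> key \<Rightarrow> nat" where
  "item_fun = (\<lambda>(w, p). item_digit k w p (signed_digit z (f p) w))"

definition ref_fun :: "nat \<times> nat \<Rightarrow> key \<Rightarrow> nat" where
  "ref_fun = (\<lambda>(c, a). ref_digit k N c a)"

abbreviation "R \<equiv> index_lists q k"

text \<open>In the leading digit, \<open>length R * z\<close> is the sum of the shifts and
  \<open>Suc k\<close> the number of references, so the Moebius sum itself has to vanish.\<close>

definition target_fun :: "key \<Rightarrow> nat" where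
  "target_fun = target_digit k N (length R * z + Suc k)"

definition hits_target :: "(((nat \<times> bool) \<times> nat) list \<times> nat) list \<Rightarrow> (nat \<times> nat) list \<Rightarrow> bool" where
  "hits_target xs ys \<longleftrightarrow> (\<forall>x \<in> set (keys R k).
     sum_list (map (\<lambda>e. item_fun e x) xs) + sum_list (map (\<lambda>e. ref_fun e x) ys) = target_fun x)"

definition fill :: "(nat \<Rightarrow> nat) \<Rightarrow> (nat \<times> bool) list \<Rightarrow> ((nat \<times> bool) \<times> nat) list" where
  "fill a r = map (\<lambda>x. (x, a (fst x))) r"

lemma map_fst_fill [simp]: "map fst (fill a r) = r"
  by (simp add: fill_def comp_def)

lemma index_sorted: "r \<in> set R \<Longrightarrow> sorted_wrt (\<lambda>x y. fst x < fst y) r"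
  by (simp add: set_index_lists)

lemma value_at_fill:
  assumes "r \<in> set R" "c \<in> fst ` set r"
  shows "value_at k (fill a r) p c = a c"
proof -
  obtain x where x: "x \<in> set r" "c = fst x" using assms(2) by blast
  have "sorted_wrt (\<lambda>x y. fst (fst x) < fst (fst y)) (fill a r)"
    using index_sorted[OF assms(1)] by (simp add: fill_def sorted_wrt_map)
  from filter_coord[OF this, of "(x, a c)"] x
  have "filter (\<lambda>e. fst (fst e) = c) (fill a r) = [(x, a c)]" by (simp add: fill_def)
  moreover have "c < k" using x assms(1) by (auto simp: set_index_lists)
  ultimately show ?thesis by (simp add: value_at_def)
qed

lemma value_at_fill_not:
  assumes "c \<notin> fst ` set r" "c \<noteq> k"
  shows "value_at k (fill a r) p c = 0"
proof -
  have "filter (\<lambda>e. fst (fst e) = c) (fill a r) = []"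
    using assms by (auto simp: fill_def filter_empty_conv)
  then show ?thesis using assms by (simp add: value_at_def)
qed

lemma value_at_k [simp]: "value_at k w p k = p"
  by (simp add: value_at_def)

lemma signed_digit_fill:
  assumes "p < nA"
  shows "int (signed_digit z (f p) (fill a r)) =
    int z + (-1) ^ length (unmarked r) * int (F p (a ` set (marked r)))"
proof -
  have u: "length (filter (\<lambda>e. \<not> snd (fst e)) (fill a r)) = length (unmarked r)"
    by (simp add: fill_def unmarked_def filter_map comp_def)
  have m: "map snd (filter (\<lambda>e. snd (fst e)) (fill a r)) = map a (marked r)"
    by (simp add: fill_def marked_def filter_map comp_def)
  have "F p (a ` set (marked r)) < z" using F_less[OF assms] .
  then show ?thesis unfolding signed_digit_def u m using f_F[OF assms]
    by (simp add: of_nat_diff)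
qed

text \<open>Every index list receives the item filled in by the increasing enumeration of
  \<open>A\<close>, and every coordinate its reference. By Moebius inversion the signed terms then
  add up to \<open>F p A\<close>.\<close>

lemma complete:
  assumes A: "A \<subseteq> X" "finite A" "card A = k" and p: "p < nA" and F0: "F p A = 0"
  shows "\<exists>xs ys. set xs \<subseteq> items \<and> set ys \<subseteq> refs \<and> length xs + length ys = length R + Suc k \<and> hits_target xs ys"
proof -
  define a where "a c = sorted_list_of_set A ! c" for c
  have mono: "a i < a j" if "i < j" "j < k" for i j
    unfolding a_def using sorted_wrt_nth_less[OF strict_sorted_list_of_set[of A] that(1)] that(2) A by simp
  have img: "a ` {..<k} = A"
  proof -
    have "a ` {..<k} = set (sorted_list_of_set A)"
      unfolding a_def using A by (force simp: set_conv_nth)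
    then show ?thesis using A by simp
  qed
  have inj: "inj_on a {..<k}"
    by (rule inj_onI) (metis lessThan_iff linorder_neqE_nat mono nat_less_le)
  define xs where "xs = map (\<lambda>r. (fill a r, p)) R"
  define ys where "ys = map (\<lambda>c. (c, if c = k then p else a c)) [0..<Suc k]"
  have "set xs \<subseteq> items"
  proof
    fix e assume "e \<in> set xs"
    then obtain r where r: "r \<in> set R" "e = (fill a r, p)" by (auto simp: xs_def)
    have "sorted_wrt (\<lambda>x y. fst x < fst y \<and> a (fst x) < a (fst y)) r"
    proof (rule sorted_wrt_mono_rel[OF _ index_sorted[OF r(1)]])
      fix x y assume "x \<in> set r" "y \<in> set r" "fst x < fst y"
      then show "fst x < fst y \<and> a (fst x) < a (fst y)"
        using r(1) mono by (auto simp: set_index_lists)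
    qed
    then show "e \<in> items"
      using r img A(1) p by (auto simp: items_def fill_def sorted_wrt_map set_index_lists image_image)
  qed
  moreover have "set ys \<subseteq> refs"
    using img A(1) p by (auto simp: ys_def refs_def)
  moreover have "length xs + length ys = length R + Suc k" by (simp add: xs_def ys_def)
  moreover have "hits_target xs ys"
    unfolding hits_target_def
  proof
    fix x assume "x \<in> set (keys R k)"
    \<comment> \<open>The keys check in turn that each index list is used once, that each coordinate
      is referenced once, that values agree, and that the Moebius sum is \<open>0\<close>.\<close>
    then consider r where "x = ([r], [])" "r \<in> set R" | c where "x = ([], [c])" "c \<le> k"
      | r c where "x = ([r], [c])" "r \<in> set R" "c \<le> k" | "x = ([], [])"
      by (auto simp: keys_def low_keys_def less_Suc_eq_le)
    then show "sum_list (map (\<lambda>e. item_fun e x) xs) + sum_list (map (\<lambda>e. ref_fun e x) ys) = target_fun x"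
    proof cases
      case 1
      have "sum_list (map (\<lambda>e. item_fun e x) xs) = (\<Sum>r' \<in> set R. if r = r' then 1 else 0)"
        by (simp add: xs_def comp_def item_fun_def item_digit_def 1
            sum_list_distinct_conv_sum_set[OF distinct_index_lists])
      also have "\<dots> = 1" using 1 by simp
      finally show ?thesis
        by (simp add: ys_def comp_def ref_fun_def ref_digit_def 1 target_fun_def target_digit_def)
    next
      case 2
      have "sum_list (map (\<lambda>e. ref_fun e x) ys) = (\<Sum>c' \<in> set [0..<Suc k]. if c = c' then 1 else 0)"
        unfolding ys_def map_map by (subst sum_list_distinct_conv_sum_set, simp,
            rule sum.cong) (auto simp: ref_fun_def ref_digit_def 2)
      also have "\<dots> = 1" using 2 by (subst sum.delta') auto
      finally show ?thesis
        by (simp add: xs_def comp_def item_fun_def item_digit_def 2 target_fun_def target_digit_def)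
    next
      case 3
      have "sum_list (map (\<lambda>e. item_fun e x) xs) =
          (\<Sum>r' \<in> set R. if r = r' then value_at k (fill a r) p c else 0)"
        unfolding xs_def map_map by (subst sum_list_distinct_conv_sum_set[OF distinct_index_lists],
            rule sum.cong) (auto simp: item_fun_def item_digit_def 3)
      also have "\<dots> = value_at k (fill a r) p c" using 3 by simp
      finally have 1: "sum_list (map (\<lambda>e. item_fun e x) xs) = value_at k (fill a r) p c" .
      have "sum_list (map (\<lambda>e. ref_fun e x) ys) = (\<Sum>c' \<in> set [0..<Suc k].
          if c = c' then (if covers k r c then N - (if c = k then p else a c) else 0) else 0)"
        unfolding ys_def map_map by (subst sum_list_distinct_conv_sum_set, simp,
            rule sum.cong) (auto simp: ref_fun_def ref_digit_def 3)
      also have "\<dots> = (if covers k r c then N - (if c = k then p else a c) else 0)"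
        using 3 by (subst sum.delta') auto
      finally have 2: "sum_list (map (\<lambda>e. ref_fun e x) ys) =
         (if covers k r c then N - (if c = k then p else a c) else 0)" .
      have le: "c < k \<Longrightarrow> a c \<le> N" using X_less[of "a c"] img A(1) by auto
      have t: "target_fun x = (if covers k r c then N else 0)"
        by (simp add: 3 target_fun_def target_digit_def)
      show ?thesis
      proof (cases "c = k")
        case True
        then show ?thesis unfolding 1 2 t using p nA_le by (simp add: covers_def)
      next
        case False
        then have "c < k" using 3 by simp
        then show ?thesis unfolding 1 2 t
          using False le value_at_fill[OF 3(2), of c a p] value_at_fill_not[of c r a p]
          by (auto simp: covers_def)
      qed
    next
      case 4
      have "int (sum_list (map (\<lambda>e. item_fun e x) xs)) = (\<Sum>r \<in> set R. int (signed_digit z (f p) (fill a r)))"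
        by (simp add: xs_def comp_def item_fun_def item_digit_def 4
            sum_list_distinct_conv_sum_set[OF distinct_index_lists])
      also have "\<dots> = int (length R * z) + int (F p (a ` {..<k}))"
        unfolding signed_digit_fill[OF p] sum.distrib
        using moebius[OF p inj] distinct_card[OF distinct_index_lists[of q k]] by simp
      also have "\<dots> = int (length R * z)" using F0 img by simp
      finally have "sum_list (map (\<lambda>e. item_fun e x) xs) = length R * z" by linarith
      moreover have "sum_list (map (\<lambda>e. ref_fun e x) ys) = Suc k"
        by (simp add: ys_def comp_def ref_fun_def ref_digit_def 4 sum_list_triv)
      ultimately show ?thesis by (simp add: 4 target_fun_def target_digit_def)
    qed
  qed
  ultimately show ?thesis by blast
qed

text \<open>Nothing is assumed about the lengths of \<open>xs\<close> and \<open>ys\<close>: the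
  digits 1 determine how often each index list and each coordinate occurs.\<close>

lemma sound:
  assumes xs: "set xs \<subseteq> items" and ys: "set ys \<subseteq> refs" and hits: "hits_target xs ys"
  shows "\<exists>A \<subseteq> X. finite A \<and> card A = k \<and> (\<exists>p < nA. F p A = 0)"
proof -
  note hit = hits[unfolded hits_target_def, rule_format]
  have keys: "([r], []) \<in> set (keys R k)" "([], [c]) \<in> set (keys R k)" "([r], [c]) \<in> set (keys R k)"
    "([], []) \<in> set (keys R k)" if "r \<in> set R" "c \<le> k" for r c
    using that by (auto simp: keys_def low_keys_def less_Suc_eq_le image_iff simp del: upt_Suc)
  have R: "[] \<in> set R" by (simp add: set_index_lists)
  have one: "\<exists>e. filter P es = [e]" if "sum_list (map (\<lambda>e. if P e then 1 else 0) es) = (1::nat)" for P and es :: "'c list"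
    using that by (auto simp: sum_list_if sum_list_triv length_Suc_conv)
  have "\<exists>y. filter (\<lambda>e. c = fst e) ys = [y]" if "c \<le> k" for c
  proof -
    have "sum_list (map (\<lambda>e. ref_fun e ([], [c])) ys) = sum_list (map (\<lambda>e. if c = fst e then 1 else 0) ys)"
      by (rule arg_cong[where f = sum_list]) (auto simp: ref_fun_def ref_digit_def)
    moreover have "item_fun e ([], [c]) = 0" for e
      by (simp add: item_fun_def item_digit_def case_prod_unfold)
    ultimately have "sum_list (map (\<lambda>e. if c = fst e then 1 else 0) ys) = (1 :: nat)"
      using hit[OF keys(2)[OF R that]] by (simp add: target_fun_def target_digit_def)
    then show ?thesis by (rule one)
  qed
  then obtain y where y: "\<And>c. c \<le> k \<Longrightarrow> filter (\<lambda>e. c = fst e) ys = [y c]" by metis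
  define a where "a c = snd (y c)" for c
  have y_mem: "(c, a c) \<in> set ys" "y c = (c, a c)" if "c \<le> k" for c
  proof -
    have "y c \<in> set (filter (\<lambda>e. c = fst e) ys)" using y[OF that] by simp
    then have "y c \<in> set ys" "fst (y c) = c" by auto
    then show "y c = (c, a c)" "(c, a c) \<in> set ys" by (metis a_def prod.collapse)+
  qed
  have aX: "a c \<in> X" if "c < k" for c
    using y_mem(1)[of c] ys that by (auto simp: refs_def)
  have p: "a k < nA" using y_mem(1)[of k] ys by (auto simp: refs_def)
  have aN: "a c \<le> N" if "c \<le> k" for c
    using aX[of c] X_less[of "a c"] p nA_le that by (cases "c = k") auto
  have "\<exists>e. filter (\<lambda>e. r = map fst (fst e)) xs = [e]" if "r \<in> set R" for r
  proof -
    have "sum_list (map (\<lambda>e. item_fun e ([r], [])) xs) = sum_list (map (\<lambda>e. if r = map fst (fst e) then 1 else 0) xs)"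
      by (rule arg_cong[where f = sum_list]) (auto simp: item_fun_def item_digit_def)
    moreover have "ref_fun e ([r], []) = 0" for e
      by (simp add: ref_fun_def ref_digit_def case_prod_unfold)
    ultimately have "sum_list (map (\<lambda>e. if r = map fst (fst e) then 1 else 0) xs) = (1 :: nat)"
      using hit[OF keys(1)[OF that, of 0]] by (simp add: target_fun_def target_digit_def)
    then show ?thesis by (rule one)
  qed
  then obtain e where e: "\<And>r. r \<in> set R \<Longrightarrow> filter (\<lambda>e. r = map fst (fst e)) xs = [e r]" by metis
  have e_mem: "e r \<in> items" "map fst (fst (e r)) = r" if "r \<in> set R" for r
  proof -
    have "e r \<in> set (filter (\<lambda>e. r = map fst (fst e)) xs)" using e[OF that] by simp
    then show "e r \<in> items" "map fst (fst (e r)) = r" using xs by auto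
  qed
  \<comment> \<open>At \<open>([r], [c])\<close> only the item for \<open>r\<close> and the
    reference for \<open>c\<close> contribute; \<open>aN\<close> ensures that \<open>N - a c\<close>
    is not truncated.\<close>
  have val: "value_at k (fst (e r)) (snd (e r)) c = a c"
    if r: "r \<in> set R" and c: "c \<le> k" "covers k r c" for r c
  proof -
    have "sum_list (map (\<lambda>e. item_fun e ([r], [c])) xs) =
        sum_list (map (\<lambda>e. if r = map fst (fst e) then value_at k (fst e) (snd e) c else 0) xs)"
      by (rule arg_cong[where f = sum_list]) (auto simp: item_fun_def item_digit_def)
    then have 1: "sum_list (map (\<lambda>e. item_fun e ([r], [c])) xs) = value_at k (fst (e r)) (snd (e r)) c"
      by (simp add: sum_list_if e[OF r])
    have "sum_list (map (\<lambda>e. ref_fun e ([r], [c])) ys) =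
        sum_list (map (\<lambda>e. if c = fst e then N - snd e else 0) ys)"
      by (rule arg_cong[where f = sum_list]) (use c in \<open>auto simp: ref_fun_def ref_digit_def\<close>)
    then have 2: "sum_list (map (\<lambda>e. ref_fun e ([r], [c])) ys) = N - a c"
      by (simp add: sum_list_if y[OF c(1)] a_def)
    show ?thesis
      using hit[OF keys(3)[OF r c(1)]] aN[OF c(1)] c(2) unfolding 1 2
      by (simp add: target_fun_def target_digit_def)
  qed
  have e_eq: "e r = (fill a r, a k)" if r: "r \<in> set R" for r
  proof -
    have 2: "snd (e r) = a k" using val[OF r, of k] by (simp add: covers_def)
    have s: "sorted_wrt (\<lambda>x y. fst (fst x) < fst (fst y)) (fst (e r))"
      using e_mem(1)[OF r] by (auto simp: items_def intro: sorted_wrt_mono_rel[rotated])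
    have "snd x = a (fst (fst x))" if x: "x \<in> set (fst (e r))" for x
    proof -
      have lt: "fst (fst x) < k" using x e_mem(1)[OF r] by (auto simp: items_def image_subset_iff)
      have "fst (fst x) \<in> fst ` set r" using x by (subst e_mem(2)[OF r, symmetric]) auto
      then have "value_at k (fst (e r)) (snd (e r)) (fst (fst x)) = a (fst (fst x))"
        using lt by (intro val[OF r]) (auto simp: covers_def)
      moreover have "value_at k (fst (e r)) (snd (e r)) (fst (fst x)) = snd x"
        using lt filter_coord[OF s x] by (simp add: value_at_def)
      ultimately show ?thesis by simp
    qed
    then have "fst (e r) = map (\<lambda>x. (fst x, a (fst (fst x)))) (fst (e r))"
      by (intro map_idI[symmetric]) (auto simp: prod_eq_iff)
    also have "\<dots> = fill a (map fst (fst (e r)))" by (simp add: fill_def comp_def)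
    finally show ?thesis using 2 e_mem(2)[OF r] by (simp add: prod_eq_iff)
  qed
  have mono: "a i < a j" if "i < j" "j < k" for i j
  proof -
    \<comment> \<open>The item for this index list has increasing values by definition of
      \<open>items\<close>.\<close>
    have r: "[(i, True), (j, True)] \<in> set R" using that q_ge by (simp add: set_index_lists)
    show ?thesis using e_mem(1)[OF r] unfolding e_eq[OF r] by (simp add: items_def fill_def)
  qed
  have inj: "inj_on a {..<k}"
    by (rule inj_onI) (metis lessThan_iff linorder_neqE_nat mono nat_less_le)
  \<comment> \<open>The leading digit contains one 1 per reference; their number must be known to
    subtract them.\<close>
  have len: "length ys = Suc k"
  proof -
    have "sum_list (map (\<lambda>_. 1 :: nat) ys) = (\<Sum>c \<in> {..k}. sum_list (map (\<lambda>_. 1) (filter (\<lambda>e. fst e = c) ys)))"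
      by (rule sum_list_by_key) (use ys in \<open>auto simp: refs_def\<close>)
    also have "\<dots> = (\<Sum>c \<in> {..k}. 1)"
    proof (rule sum.cong[OF refl])
      fix c assume "c \<in> {..k}"
      then show "sum_list (map (\<lambda>_. 1 :: nat) (filter (\<lambda>e. fst e = c) ys)) = 1"
        using y[of c] by (simp add: filter_eq_sym)
    qed
    finally show ?thesis by (simp add: sum_list_triv)
  qed
  have "sum_list (map (\<lambda>e. item_fun e ([], [])) xs) =
      (\<Sum>r \<in> set R. sum_list (map (\<lambda>e. item_fun e ([], [])) (filter (\<lambda>e. map fst (fst e) = r) xs)))"
  proof (rule sum_list_by_key)
    show "\<forall>e \<in> set xs. map fst (fst e) \<in> set R"
    proof
      fix e assume "e \<in> set xs"
      then obtain w p where w: "e = (w, p)" "(w, p) \<in> items" using xs by (metis surj_pair subsetD)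
      then have "sorted_wrt (\<lambda>x y. fst (fst x) < fst (fst y)) w"
        by (auto simp: items_def intro: sorted_wrt_mono_rel[rotated])
      moreover have "fst ` set (map fst w) \<subseteq> {..<k}" using w(2) by (simp add: items_def image_comp)
      ultimately show "map fst (fst e) \<in> set R"
        using w by (simp add: set_index_lists sorted_wrt_map items_def)
    qed
  qed simp
  also have "\<dots> = (\<Sum>r \<in> set R. signed_digit z (f (a k)) (fill a r))"
  proof (rule sum.cong[OF refl])
    fix r assume "r \<in> set R"
    then show "sum_list (map (\<lambda>e. item_fun e ([], [])) (filter (\<lambda>e. map fst (fst e) = r) xs)) =
      signed_digit z (f (a k)) (fill a r)"
      using e[of r] e_eq[of r] by (simp add: filter_eq_sym item_fun_def item_digit_def)
  qed
  finally have "(\<Sum>r \<in> set R. signed_digit z (f (a k)) (fill a r)) + Suc k = length R * z + Suc k"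
    using hit[OF keys(4)[OF R, of 0]] len
    by (simp add: target_fun_def target_digit_def ref_fun_def ref_digit_def case_prod_unfold sum_list_triv)
  then have "int (length R * z) = int (\<Sum>r \<in> set R. signed_digit z (f (a k)) (fill a r))" by simp
  also have "\<dots> = (\<Sum>r \<in> set R. int z + (-1) ^ length (unmarked r) * int (F (a k) (a ` set (marked r))))"
    using signed_digit_fill[OF p] by simp
  also have "\<dots> = int (length R * z) + int (F (a k) (a ` {..<k}))"
    unfolding sum.distrib using moebius[OF p inj] distinct_card[OF distinct_index_lists[of q k]] by simp
  finally have "F (a k) (a ` {..<k}) = 0" by simp
  moreover have "a ` {..<k} \<subseteq> X" using aX by auto
  moreover have "card (a ` {..<k}) = k" using inj by (simp add: card_image)
  ultimately show ?thesis using p by blast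
qed

text \<open>A digit is 0, 1, a value at most \<open>N\<close>, or a shifted term at most
  \<open>2 * z\<close>; the sum bounds all of them.\<close>

lemma item_fun_le:
  assumes "e \<in> items"
  shows "item_fun e x \<le> N + 2 * z + 1"
proof -
  obtain w p where e: "e = (w, p)" "snd ` set w \<subseteq> X" "p < nA" using assms by (auto simp: items_def)
  have "signed_digit z (f p) w \<le> 2 * z"
  proof -
    have "f p ys < z" for ys using F_less[OF e(3)] f_F[OF e(3)] by simp
    then show ?thesis unfolding signed_digit_def by (simp add: less_imp_le le_diff_conv)
  qed
  moreover have "value_at k w p c \<le> N" for c
  proof (cases "filter (\<lambda>e. fst (fst e) = c) w")
    case Nil
    then show ?thesis using e(3) nA_le by (simp add: value_at_def)
  next
    case (Cons y ys)
    then have "y \<in> set (filter (\<lambda>e. fst (fst e) = c) w)" by simp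
    then have "y \<in> set w" by simp
    then have "snd y < N" using e(2) X_less by auto
    then show ?thesis using e(3) nA_le Cons by (simp add: value_at_def)
  qed
  ultimately show ?thesis by (auto simp: e item_fun_def item_digit_def trans_le_add1 trans_le_add2 le_SucI)
qed

lemma ref_fun_le: "ref_fun e x \<le> N + 2 * z + 1"
  by (auto simp: ref_fun_def ref_digit_def split: prod.split)

lemma target_fun_le: "target_fun x \<le> (length R + Suc k) * (N + 2 * z + 1)"
proof -
  have "length R * z + Suc k \<le> (length R + Suc k) * (N + 2 * z + 1)"
    by (simp add: algebra_simps)
  moreover have "N \<le> (length R + Suc k) * (N + 2 * z + 1)" "1 \<le> (length R + Suc k) * (N + 2 * z + 1)"
    by (simp_all add: algebra_simps)
  ultimately show ?thesis by (simp add: target_fun_def target_digit_def del: mult_Suc_right)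
qed

end

section \<open>Zero products of \<open>2 \<times> 2\<close> matrices\<close>

definition mat2 :: "rat \<Rightarrow> rat \<Rightarrow> rat \<Rightarrow> rat \<Rightarrow> rat mat" where
  "mat2 a b c d = mat 2 2 (\<lambda>(i, j). if i = 0 then (if j = 0 then a else b) else if j = 0 then c else d)"

lemma mat2_carrier [simp]: "mat2 a b c d \<in> carrier_mat 2 2"
  by (simp add: mat2_def)

lemma mat2_index [simp]:
  "mat2 a b c d $$ (0, 0) = a" "mat2 a b c d $$ (0, Suc 0) = b"
  "mat2 a b c d $$ (Suc 0, 0) = c" "mat2 a b c d $$ (Suc 0, Suc 0) = d"
  by (simp_all add: mat2_def)

lemma mat2_dim [simp]: "dim_row (mat2 a b c d) = 2" "dim_col (mat2 a b c d) = 2"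
  by (simp_all add: mat2_def)

lemma mat2_eqI:
  assumes "A \<in> carrier_mat 2 2" "A $$ (0, 0) = a" "A $$ (0, Suc 0) = b" "A $$ (Suc 0, 0) = c" "A $$ (Suc 0, Suc 0) = d"
  shows "A = mat2 a b c d"
proof (rule eq_matI)
  fix i j assume "i < dim_row (mat2 a b c d)" "j < dim_col (mat2 a b c d)"
  then have "i = 0 \<or> i = Suc 0" "j = 0 \<or> j = Suc 0" by (auto simp: less_2_cases_iff)
  then show "A $$ (i, j) = mat2 a b c d $$ (i, j)" using assms by auto
qed (use assms in auto)

lemma mat2_mult:
  "mat2 a b c d * mat2 a' b' c' d' = mat2 (a * a' + b * c') (a * b' + b * d') (c * a' + d * c') (c * b' + d * d')"
  by (rule mat2_eqI) (auto simp: scalar_prod_def numeral_2_eq_2)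

lemma mat2_eq_iff: "mat2 a b c d = mat2 a' b' c' d' \<longleftrightarrow> a = a' \<and> b = b' \<and> c = c' \<and> d = d'"
  by (metis mat2_index)

lemma zero_mat2: "0\<^sub>m 2 2 = mat2 0 0 0 0"
  by (rule mat2_eqI) auto

lemma one_mat2: "1\<^sub>m 2 = mat2 1 0 0 1"
  by (rule mat2_eqI) auto

definition shear :: "nat \<Rightarrow> rat mat" where
  "shear x = mat2 1 (of_nat x) 0 1"

definition singular :: "nat \<Rightarrow> rat mat" where
  "singular t = mat2 0 0 1 (- of_nat t)"

lemma mat_product_simps [simp]:
  "mat_product d [] = 1\<^sub>m d" "mat_product d (A # As) = A * mat_product d As"
  by (simp_all add: mat_product_def)

text \<open>The second case is a product of rank one, where \<open>ss\<close> are the shears to the left of the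
  leftmost singular factor; it can only vanish if a segment between two singular factors sums to \<open>t\<close>.\<close>

lemma mat_product_cases:
  assumes "set As \<subseteq> insert (singular t) (shear ` V)"
  shows "(\<exists>ss. set ss \<subseteq> V \<and> length ss = length As \<and>
        mat_product 2 As = mat2 1 (of_nat (sum_list ss)) 0 1) \<or>
    (\<exists>ss y y'. set ss \<subseteq> V \<and> length ss + 1 \<le> length As \<and> (y \<noteq> 0 \<or> y' \<noteq> 0) \<and>
        mat_product 2 As = mat2 (of_nat (sum_list ss) * y) (of_nat (sum_list ss) * y') y y') \<or>
    (\<exists>ss. set ss \<subseteq> V \<and> length ss + 2 \<le> length As \<and> sum_list ss = t)"
    (is "?A As \<or> ?B As \<or> ?C As")
  using assms
proof (induction As)
  case Nil
  then show ?case by (simp add: one_mat2)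
next
  case (Cons A As)
  then have "?A As \<or> ?B As \<or> ?C As" by simp
  then show ?case
  proof (elim disjE, goal_cases)
    case 1
    then obtain ss where ss: "set ss \<subseteq> V" "length ss = length As"
      "mat_product 2 As = mat2 1 (of_nat (sum_list ss)) 0 1" by blast
    show ?case
    proof (cases "A = singular t")
      case True
      have "?B (A # As)"
        by (intro exI[of _ "[]"] exI[of _ 1] exI[of _ "of_nat (sum_list ss) - of_nat t"])
          (simp add: True ss singular_def mat2_mult)
      then show ?thesis by blast
    next
      case False
      then obtain x where "x \<in> V" "A = shear x" using Cons.prems by auto
      then have "?A (A # As)"
        by (intro exI[of _ "x # ss"]) (simp add: ss shear_def mat2_mult add.commute)
      then show ?thesis by blast
    qed
  next
    case 2
    then obtain ss y y' where ss: "set ss \<subseteq> V" "length ss + 1 \<le> length As" "y \<noteq> 0 \<or> y' \<noteq> 0"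
      "mat_product 2 As = mat2 (of_nat (sum_list ss) * y) (of_nat (sum_list ss) * y') y y'" by blast
    show ?case
    proof (cases "A = singular t")
      case True
      show ?thesis
      proof (cases "sum_list ss = t")
        case True
        then have "?C (A # As)" using ss by auto
        then show ?thesis by blast
      next
        case neq: False
        let ?z = "of_nat (sum_list ss) - of_nat t :: rat"
        have "?z \<noteq> 0" using neq by simp
        then have "?B (A # As)" using ss(2,3)
          by (intro exI[of _ "[]"] exI[of _ "?z * y"] exI[of _ "?z * y'"])
            (simp add: True ss(4) singular_def mat2_mult algebra_simps)
        then show ?thesis by blast
      qed
    next
      case False
      then obtain x where "x \<in> V" "A = shear x" using Cons.prems by auto
      then have "?B (A # As)"
        by (intro exI[of _ "x # ss"] exI[of _ y] exI[of _ y'])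
          (use ss in \<open>simp add: shear_def mat2_mult algebra_simps\<close>)
      then show ?thesis by blast
    qed
  next
    case 3
    then have "?C (A # As)" by fastforce
    then show ?case by blast
  qed
qed

text \<open>Products of the first two kinds in \<open>mat_product_cases\<close> have a nonzero
  entry. Other factors may surround the vanishing segment, so only an upper bound on the number of
  summands remains.\<close>

lemma zero_product_sound:
  assumes "set As \<subseteq> insert (singular t) (shear ` V)" "mat_product 2 As = 0\<^sub>m 2 2"
  shows "\<exists>ss. set ss \<subseteq> V \<and> length ss + 2 \<le> length As \<and> sum_list ss = t"
  using mat_product_cases[OF assms(1)] unfolding assms(2) zero_mat2 mat2_eq_iff by auto

lemma mat_product_shears:
  "mat_product 2 (map shear ss @ [singular t]) =
    mat2 (of_nat (sum_list ss)) (- of_nat (sum_list ss) * of_nat t) 1 (- of_nat t)"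
  by (induction ss) (simp_all add: one_mat2 shear_def singular_def mat2_mult algebra_simps)

lemma zero_product_complete:
  "mat_product 2 (singular (sum_list ss) # map shear ss @ [singular (sum_list ss)]) = 0\<^sub>m 2 2"
  unfolding mat_product_simps mat_product_shears by (simp add: singular_def mat2_mult zero_mat2)

subsection \<open>Encodings of matrices\<close>

lemma bits_0 [simp]: "bits 0 = []"
  by (simp add: bits.simps)

lemma bits_rec: "0 < n \<Longrightarrow> bits n = odd n # bits (n div 2)"
  by (subst bits.simps) simp

lemma bits_inj: "bits m = bits n \<Longrightarrow> m = n"
proof (induction m arbitrary: n rule: less_induct)
  case (less m)
  show ?case
  proof (cases "m = 0 \<or> n = 0")
    case True
    then show ?thesis using less.prems by (cases "m = 0"; cases "n = 0") (auto simp: bits_rec)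
  next
    case False
    then have "odd m = odd n" "bits (m div 2) = bits (n div 2)"
      using less.prems by (auto simp: bits_rec)
    moreover from this have "m div 2 = n div 2" using False by (intro less.IH) auto
    ultimately show ?thesis by presburger
  qed
qed

lemma enc_int_inj: "enc_int x = enc_int y \<Longrightarrow> x = y"
proof -
  assume "enc_int x = enc_int y"
  then have "(x < 0) = (y < 0)" "enc_list enc_bool (bits (nat \<bar>x\<bar>)) = enc_list enc_bool (bits (nat \<bar>y\<bar>))"
    by (auto simp: enc_int_def enc_bool_def split: if_splits)
  moreover from this(2) have "bits (nat \<bar>x\<bar>) = bits (nat \<bar>y\<bar>)"
    by (rule enc_list_inj[rotated]) (simp add: enc_bool_def split: if_splits)
  then have "nat \<bar>x\<bar> = nat \<bar>y\<bar>" by (rule bits_inj)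
  ultimately show "x = y" by (auto split: abs_split)
qed

lemma enc_rat_inj: "enc_rat x = enc_rat y \<Longrightarrow> x = y"
  using enc_int_inj by (simp add: enc_rat_def prod_eq_iff flip: quotient_of_inject_eq)

text \<open>A yes-instance only asserts that some list of matrices has the given encoding, so
  matrices and dimension are recovered from it. Without rows the number of columns would be lost,
  hence \<open>0 < m\<close>.\<close>

lemma enc_mat_inj:
  assumes "enc_mat A = enc_mat B" "A \<in> carrier_mat m n" "B \<in> carrier_mat m' n'" "0 < m"
  shows "A = B"
proof -
  have row: "xs = ys" if "enc_list enc_rat xs = enc_list enc_rat ys" for xs ys
    by (rule enc_list_inj[OF _ that]) (rule enc_rat_inj)
  have "mat_to_list A = mat_to_list B"
    by (rule enc_list_inj[OF row assms(1)[unfolded enc_mat_def]])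
  then have eq: "map (\<lambda>i. map (\<lambda>j. A $$ (i, j)) [0..<n]) [0..<m] = map (\<lambda>i. map (\<lambda>j. B $$ (i, j)) [0..<n']) [0..<m']"
    using assms(2,3) by (simp add: mat_to_list_def)
  from arg_cong[OF this, of length] have m: "m = m'" by simp
  then have rows: "map (\<lambda>j. A $$ (i, j)) [0..<n] = map (\<lambda>j. B $$ (i, j)) [0..<n']" if "i < m" for i
    using eq that by (simp add: map_eq_conv)
  from arg_cong[OF rows[OF assms(4)], of length] have n: "n = n'" by simp
  have "A $$ (i, j) = B $$ (i, j)" if "i < m" "j < n" for i j
    using arg_cong[OF rows[OF that(1)], of "\<lambda>l. l ! j"] that(2) n by simp
  then show ?thesis
    by (intro eq_matI) (use m n carrier_matD[OF assms(2)] carrier_matD[OF assms(3)] in simp_all)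
qed

definition number_tree :: "bool \<Rightarrow> bool list \<Rightarrow> tree" where
  "number_tree s bs = Node (Node (to_tree s) (to_tree bs)) (enc_int 1)"

lemma enc_rat_nat: "enc_rat (of_nat n) = number_tree False (bits n)"
  by (simp add: enc_rat_def number_tree_def enc_int_def to_tree_list_def to_tree_bool_def)

text \<open>Zero is encoded with sign \<open>False\<close>, hence \<open>0 < n\<close>.\<close>

lemma enc_rat_neg: "0 < n \<Longrightarrow> enc_rat (- of_nat n) = number_tree True (bits n)"
proof -
  assume "0 < n"
  have "enc_rat (of_int (- int n)) = number_tree True (bits n)"
    unfolding enc_rat_def quotient_of_rat_of_int using \<open>0 < n\<close>
    by (simp add: number_tree_def enc_int_def to_tree_list_def to_tree_bool_def)
  then show ?thesis by simp
qed

definition matrix_tree :: "tree \<Rightarrow> tree \<Rightarrow> tree \<Rightarrow> tree \<Rightarrow> tree" where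
  "matrix_tree a b c d = to_tree [[a, b], [c, d]]"

lemma enc_mat2: "enc_mat (mat2 a b c d) = matrix_tree (enc_rat a) (enc_rat b) (enc_rat c) (enc_rat d)"
  by (simp add: enc_mat_def mat_to_list_def matrix_tree_def to_tree_list_def numeral_2_eq_2)

definition shear_tree :: "bool list \<Rightarrow> tree" where
  "shear_tree bs = matrix_tree (enc_rat 1) (number_tree False bs) (enc_rat 0) (enc_rat 1)"

definition singular_tree :: "bool list \<Rightarrow> tree" where
  "singular_tree bs = matrix_tree (enc_rat 0) (enc_rat 0) (enc_rat 1) (number_tree True bs)"

lemma enc_mat_shear: "enc_mat (shear n) = shear_tree (bits n)"
  by (simp add: shear_def enc_mat2 shear_tree_def enc_rat_nat)

lemma enc_mat_singular: "0 < n \<Longrightarrow> enc_mat (singular n) = singular_tree (bits n)"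
  by (simp add: singular_def enc_mat2 singular_tree_def enc_rat_neg)

lemma in_problem_iff:
  "(x, k) \<in> matrix_k_product_rep_zero \<longleftrightarrow> (\<exists>Ms. x = enc_list enc_mat Ms \<and> (\<exists>d>0. set Ms \<subseteq> carrier_mat d d \<and>
     (\<exists>As. length As = k \<and> set As \<subseteq> set Ms \<and> mat_product d As = 0\<^sub>m d d)))"
  by (simp add: matrix_k_product_rep_zero_def)

lemma in_problemI:
  "0 < d \<Longrightarrow> set Ms \<subseteq> carrier_mat d d \<Longrightarrow>
    \<exists>As. length As = k \<and> set As \<subseteq> set Ms \<and> mat_product d As = 0\<^sub>m d d \<Longrightarrow>
    (enc_list enc_mat Ms, k) \<in> matrix_k_product_rep_zero"
  unfolding in_problem_iff by blast

lemma shear_list_in_problem: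
  assumes "set ss \<subseteq> set V" "length ss = n" "sum_list ss = t"
  shows "(enc_list enc_mat (singular t # map shear V), n + 2) \<in> matrix_k_product_rep_zero"
proof -
  let ?As = "singular t # map shear ss @ [singular t]"
  have "mat_product 2 ?As = 0\<^sub>m 2 2" using zero_product_complete[of ss] assms(3) by simp
  moreover have "length ?As = n + 2" "set ?As \<subseteq> set (singular t # map shear V)"
    using assms by auto
  ultimately have "\<exists>As. length As = n + 2 \<and> set As \<subseteq> set (singular t # map shear V) \<and> mat_product 2 As = 0\<^sub>m 2 2"
    by blast
  moreover have "set (singular t # map shear V) \<subseteq> carrier_mat 2 2"
    by (auto simp: singular_def shear_def)
  ultimately show ?thesis
    by (intro in_problemI[of 2]) (simp, assumption+)
qed

lemma problem_shear_list:
  assumes "(enc_list enc_mat (singular t # map shear V), n + 2) \<in> matrix_k_product_rep_zero"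
  shows "\<exists>ss. set ss \<subseteq> set V \<and> length ss \<le> n \<and> sum_list ss = t"
proof -
  let ?Ms = "singular t # map shear V"
  obtain Ms d As where *: "enc_list enc_mat ?Ms = enc_list enc_mat Ms" "0 < d"
    "set Ms \<subseteq> carrier_mat d d" "length As = n + 2" "set As \<subseteq> set Ms" "mat_product d As = 0\<^sub>m d d"
    using iffD1[OF in_problem_iff assms] by (elim exE conjE) (rule that)
  have c: "A \<in> carrier_mat 2 2" if "A \<in> set ?Ms" for A
    using that by (auto simp: singular_def shear_def)
  have Ms: "?Ms = Ms"
    using *(1)
  proof (rule enc_list_inj[rotated])
    fix A B assume "A \<in> set ?Ms" "B \<in> set Ms" "enc_mat A = enc_mat B"
    then show "A = B" using enc_mat_inj[OF _ c[of A], of B d d] *(3) by (simp add: subset_iff)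
  qed
  have sing: "singular t \<in> carrier_mat d d" using *(3) unfolding Ms[symmetric] by simp
  have d: "d = 2" using carrier_matD(1)[OF sing] unfolding singular_def mat2_dim by (rule sym)
  have "set As \<subseteq> insert (singular t) (shear ` set V)" using *(5) unfolding Ms[symmetric] by simp
  from zero_product_sound[OF this] *(4,6) d show ?thesis by simp
qed

text \<open>The no-instance that is output for malformed inputs: the empty list offers no
  factor.\<close>

lemma empty_list_not_in_problem: "(Tip, 1) \<notin> matrix_k_product_rep_zero"
proof
  assume "(Tip, 1) \<in> matrix_k_product_rep_zero"
  then obtain Ms As where *: "Tip = enc_list enc_mat Ms" "length As = 1" "set As \<subseteq> set Ms"
    unfolding in_problem_iff by blast
  then have "Ms = []" by (cases Ms) auto
  with * show False by (cases As) auto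
qed

lemma shear_list_integer: "enc_list enc_mat (singular t # map shear V) \<in> integer_2x2_inputs"
proof -
  have "elements_mat (mat2 a b c d) \<subseteq> {a, b, c, d}" for a b c d
  proof
    fix x assume "x \<in> elements_mat (mat2 a b c d)"
    then obtain i j where "i < 2" "j < 2" "x = mat2 a b c d $$ (i, j)" by (auto dest!: elements_matD)
    moreover from this have "i = 0 \<or> i = Suc 0" "j = 0 \<or> j = Suc 0" by (simp_all add: less_2_cases_iff)
    ultimately show "x \<in> {a, b, c, d}" by (elim disjE) simp_all
  qed
  note this[THEN order_trans]
  then have "elements_mat (singular t) \<subseteq> \<int>" "elements_mat (shear x) \<subseteq> \<int>" for x
    unfolding singular_def shear_def by simp_all
  then show ?thesis
    unfolding integer_2x2_inputs_def
    by (intro CollectI exI[of _ "singular t # map shear V"]) (auto simp: singular_def shear_def)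
qed

lemma Tip_integer: "Tip \<in> integer_2x2_inputs"
  unfolding integer_2x2_inputs_def by (intro CollectI exI[of _ "[]"]) auto

subsection \<open>Binary digits\<close>

definition pad :: "nat \<Rightarrow> bool list \<Rightarrow> bool list" where
  "pad b bs = bs @ replicate (b - length bs) False"

lemma bits_shift:
  assumes "0 < x" "d < 2 ^ b"
  shows "bits (d + 2 ^ b * x) = pad b (bits d) @ bits x"
  using assms(2)
proof (induction b arbitrary: d)
  case 0
  then show ?case by (simp add: pad_def)
next
  case (Suc b)
  have pos: "0 < d + 2 ^ Suc b * x" using assms(1) by simp
  have "bits (d + 2 ^ Suc b * x) = odd d # bits (d div 2 + 2 ^ b * x)"
    unfolding bits_rec[OF pos] by (simp add: mult.assoc, simp only: add.commute)
  also have "bits (d div 2 + 2 ^ b * x) = pad b (bits (d div 2)) @ bits x"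
    using Suc.prems by (intro Suc.IH) simp
  also have "odd d # pad b (bits (d div 2)) @ bits x = pad (Suc b) (bits d) @ bits x"
    by (cases "d = 0") (simp_all add: pad_def bits_rec[of d])
  finally show ?case .
qed

lemma num_pos: "0 < v \<Longrightarrow> 0 < num b (ds @ [v])"
  by (induction ds) auto

text \<open>Lets the program write the binary representation directly; the number itself, encoded in
  unary like other naturals, would be exponentially large.\<close>

lemma bits_num:
  assumes "0 < v" "\<forall>d \<in> set ds. d < 2 ^ b"
  shows "bits (num b (ds @ [v])) = concat (map (\<lambda>d. pad b (bits d)) ds) @ bits v"
  using assms(2)
proof (induction ds)
  case (Cons d ds)
  then show ?case using bits_shift[OF num_pos[OF assms(1), of b ds]] by simp
qed simp

text \<open>One step of a ripple-carry increment; the state holds the carry and the reversed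
  output.\<close>

definition inc_step :: "bool \<times> bool list \<Rightarrow> bool \<Rightarrow> bool \<times> bool list" where
  "inc_step s b = (fst s \<and> b, (fst s \<noteq> b) # snd s)"

definition inc_bits :: "bool list \<Rightarrow> bool list" where
  "inc_bits bs = rev (snd (foldl inc_step (True, []) bs)) @
     (if fst (foldl inc_step (True, []) bs) then [True] else [])"

lemma inc_step_Pair [simp]: "inc_step (c, out) b = (c \<and> b, (c \<noteq> b) # out)"
  by (simp add: inc_step_def)

lemma pt_inc_step [pt_intros]: "pt s \<Longrightarrow> pt b \<Longrightarrow> pt (\<lambda>x. inc_step (s x) (b x))"
  unfolding inc_step_def by (intro pt_intros)

lemma foldl_inc_step_False: "foldl inc_step (False, out) bs = (False, rev bs @ out)"
  by (induction bs arbitrary: out) auto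

lemma foldl_inc_step:
  "rev (snd (foldl inc_step (True, out) (bits n))) @ (if fst (foldl inc_step (True, out) (bits n)) then [True] else [])
    = rev out @ bits (Suc n)"
proof (induction n arbitrary: out rule: less_induct)
  case (less n)
  show ?case
  proof (cases "n = 0")
    case True
    then show ?thesis by (simp add: bits_rec)
  next
    case False
    show ?thesis
    proof (cases "even n")
      case True
      then show ?thesis using False
        by (simp add: bits_rec foldl_inc_step_False)
    next
      case odd: False
      then have "Suc n div 2 = Suc (n div 2)" by (auto elim: oddE)
      then show ?thesis using False odd less.IH[of "n div 2" "False # out"]
        by (simp add: bits_rec)
    qed
  qed
qed

lemma inc_bits: "inc_bits (bits n) = bits (Suc n)"
  using foldl_inc_step[of "[]" n] by (simp add: inc_bits_def)

lemma length_bits_le: "length (bits n) \<le> n"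
proof (induction n rule: less_induct)
  case (less n)
  show ?case
  proof (cases "n = 0")
    case False
    then have "length (bits (n div 2)) \<le> n div 2" by (intro less.IH) simp
    then show ?thesis using False by (simp add: bits_rec)
  qed simp
qed

lemma sz_bool: "sz (b :: bool) \<le> 3"
  by (simp add: sz_def enc_bool_def)

lemma sz_bits: "sz (bs :: bool list) \<le> 1 + length bs * 4"
  using sz_list_le[of bs 3] sz_bool by simp

lemma pt_inc_bits [pt_intros]:
  assumes "pt l"
  shows "pt (\<lambda>x. inc_bits (l x))"
proof -
  have "length (snd (foldl inc_step (c, out) bs)) = length out + length bs" for c out bs
    by (induction bs arbitrary: c out) auto
  then have len: "length (snd (foldl inc_step (True, []) bs)) = length bs" for bs by simp
  have "sz (foldl inc_step (True, []) (take n (l x))) \<le> 5 + sz (l x) * 4" for x n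
  proof -
    have "sz (snd (foldl inc_step (True, []) (take n (l x)))) \<le> 1 + length (take n (l x)) * 4"
      using sz_bits[of "snd (foldl inc_step (True, []) (take n (l x)))"] len by simp
    also have "\<dots> \<le> 1 + sz (l x) * 4" using length_less_sz[of "l x"] by simp
    finally show ?thesis
      using sz_bool[of "fst (foldl inc_step (True, []) (take n (l x)))"]
      by (cases "foldl inc_step (True, []) (take n (l x))") simp
  qed
  then have "pt (\<lambda>x. foldl inc_step (True, []) (l x))"
    by (intro pt_foldl[where B = "\<lambda>x. 5 + sz (l x) * 4"] pb_intros pt_intros assms)
  then show ?thesis unfolding inc_bits_def by (intro pt_intros)
qed

text \<open>Counting up to \<open>n\<close> by increments is polynomial because \<open>n\<close> is
  given in unary.\<close>

lemma pt_bits [pt_intros]: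
  assumes "pt n"
  shows "pt (\<lambda>x. bits (n x))"
proof -
  have eq: "foldl (\<lambda>s _. inc_bits s) [] us = bits (length us)" for us :: "unit list"
    by (induction us rule: rev_induct) (auto simp: inc_bits)
  have "sz (foldl (\<lambda>s _. inc_bits s) [] (take m (replicate (n x) ()))) \<le> 1 + sz (n x) * 4" for x m
  proof -
    have "sz (bits (min (n x) m)) \<le> 1 + length (bits (min (n x) m)) * 4" by (rule sz_bits)
    also have "\<dots> \<le> 1 + sz (n x) * 4"
      using length_bits_le[of "min (n x) m"] by simp
    finally show ?thesis unfolding eq by (simp add: min.commute)
  qed
  then have "pt (\<lambda>x. foldl (\<lambda>s _. inc_bits s) [] (replicate (n x) ()))"
    by (intro pt_foldl[where B = "\<lambda>x. 1 + sz (n x) * 4"] pt_intros pb_intros assms)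
  then show ?thesis by (simp add: eq)
qed

lemma pt_pad [pt_intros]: "pt b \<Longrightarrow> pt bs \<Longrightarrow> pt (\<lambda>x. pad (b x) (bs x))"
  unfolding pad_def by (intro pt_intros)

lemma pt_number_tree [pt_intros]: "pt s \<Longrightarrow> pt bs \<Longrightarrow> pt (\<lambda>x. number_tree (s x) (bs x))"
  unfolding number_tree_def by (intro pt_intros)

lemma pt_matrix_tree [pt_intros]:
  "pt a \<Longrightarrow> pt b \<Longrightarrow> pt c \<Longrightarrow> pt d \<Longrightarrow> pt (\<lambda>x. matrix_tree (a x) (b x) (c x) (d x))"
  unfolding matrix_tree_def by (intro pt_intros)

lemma pt_shear_tree [pt_intros]: "pt bs \<Longrightarrow> pt (\<lambda>x. shear_tree (bs x))"
  unfolding shear_tree_def by (intro pt_intros)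

lemma pt_singular_tree [pt_intros]: "pt bs \<Longrightarrow> pt (\<lambda>x. singular_tree (bs x))"
  unfolding singular_tree_def by (intro pt_intros)

section \<open>The reduction\<close>

definition circuit_alts :: "nat \<Rightarrow> circuit \<Rightarrow> (nat \<times> bool) list list" where
  "circuit_alts d C = alts d C (length C - 1) True"

definition input_list :: "circuit \<Rightarrow> nat list" where
  "input_list C = filter (\<lambda>i. gate_at C i = Input) [0..<length C]"

definition alt_violations :: "nat \<Rightarrow> circuit \<Rightarrow> nat \<Rightarrow> nat list \<Rightarrow> nat" where
  "alt_violations d C p A = violations d C (nth_default [] (circuit_alts d C) p) A"

text \<open>Bounds both the gate numbers, which are the values of the first \<open>k\<close>
  coordinates, and the positions of alternatives, the values of coordinate \<open>k\<close>.\<close>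

definition value_bound :: "nat \<Rightarrow> circuit \<Rightarrow> nat" where
  "value_bound d C = length C + length (circuit_alts d C)"

text \<open>Exceeds the number of literals in any alternative, hence every count of
  violations.\<close>

definition offset :: "nat \<Rightarrow> circuit \<Rightarrow> nat" where
  "offset d C = Suc (length (concat (circuit_alts d C)))"

text \<open>The bound on digit sums is itself taken as the number of bits per digit, by
  \<open>n < 2 ^ n\<close>; the waste is polynomial.\<close>

definition width :: "nat \<Rightarrow> circuit \<Rightarrow> nat \<Rightarrow> nat" where
  "width d C k = (length (index_lists (2 ^ d) k) + Suc k) * (value_bound d C + 2 * offset d C + 1)"

definition item_list :: "nat \<Rightarrow> circuit \<Rightarrow> nat \<Rightarrow> (((nat \<times> bool) \<times> nat) list \<times> nat) list" where
  "item_list d C k =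
     concat (map (\<lambda>w. map (\<lambda>p. (w, p)) [0..<length (circuit_alts d C)])
       (slists (\<lambda>x y. fst (fst x) < fst (fst y) \<and> snd x < snd y) (2 ^ d)
         (concat (map (\<lambda>s. map (\<lambda>a. (s, a)) (input_list C)) (sgn_coords k)))))"

definition ref_list :: "nat \<Rightarrow> circuit \<Rightarrow> nat \<Rightarrow> (nat \<times> nat) list" where
  "ref_list d C k = concat (map (\<lambda>c. map (\<lambda>a. (c, a)) (input_list C)) [0..<k]) @
     map (\<lambda>a. (k, a)) [0..<length (circuit_alts d C)]"

definition num_bits :: "nat \<Rightarrow> (key \<Rightarrow> nat) \<Rightarrow> (nat \<times> bool) list list \<Rightarrow> nat \<Rightarrow> bool list" where
  "num_bits b g R k = concat (map (\<lambda>x. pad b (bits (g x))) (low_keys R k)) @ bits (g ([], []))"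

definition item_key_digit :: "nat \<Rightarrow> circuit \<Rightarrow> nat \<Rightarrow> ((nat \<times> bool) \<times> nat) list \<times> nat \<Rightarrow> key \<Rightarrow> nat" where
  "item_key_digit d C k e =
     item_digit k (fst e) (snd e) (signed_digit (offset d C) (alt_violations d C (snd e)) (fst e))"

definition ref_key_digit :: "nat \<Rightarrow> circuit \<Rightarrow> nat \<Rightarrow> nat \<times> nat \<Rightarrow> key \<Rightarrow> nat" where
  "ref_key_digit d C k e = ref_digit k (value_bound d C) (fst e) (snd e)"

definition target_key_digit :: "nat \<Rightarrow> circuit \<Rightarrow> nat \<Rightarrow> key \<Rightarrow> nat" where
  "target_key_digit d C k =
     target_digit k (value_bound d C) (length (index_lists (2 ^ d) k) * offset d C + Suc k)"

definition matrix_trees :: "nat \<Rightarrow> circuit \<Rightarrow> nat \<Rightarrow> tree list" where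
  "matrix_trees d C k =
     singular_tree (num_bits (width d C k) (target_key_digit d C k) (index_lists (2 ^ d) k) k) #
     map (\<lambda>e. shear_tree (num_bits (width d C k) (item_key_digit d C k e) (index_lists (2 ^ d) k) k)) (item_list d C k) @
     map (\<lambda>e. shear_tree (num_bits (width d C k) (ref_key_digit d C k e) (index_lists (2 ^ d) k) k)) (ref_list d C k)"

text \<open>The new parameter counts one item per index list, \<open>Suc k\<close> references and
  two singular factors.\<close>

definition reduce :: "nat \<Rightarrow> circuit \<times> nat \<Rightarrow> tree \<times> nat" where
  "reduce d p =
     (if check d (fst p) then (to_tree (matrix_trees d (fst p) (snd p)), length (index_lists (2 ^ d) (snd p)) + Suc (snd p) + 2)
      else (Tip, 1))"

subsection \<open>Running time\<close>

lemma pt_slists: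
  assumes "pt (\<lambda>p. R (fst p) (snd p))" "pt L"
  shows "pt (\<lambda>x. slists R q (L x))"
proof (rule pt_comp[OF _ assms(2)])
  show "pt (slists R q)"
  proof (induction q)
    case 0
    show ?case unfolding slists.simps by (intro pt_intros)
  next
    case (Suc q)
    show ?case unfolding slists.simps
      by (intro pt_intros pt_comp2[OF assms(1)] pt_comp[OF Suc.IH])
  qed
qed

lemma pt_sgn_coords [pt_intros]: "pt k \<Longrightarrow> pt (\<lambda>x. sgn_coords (k x))"
  unfolding sgn_coords_def by (intro pt_intros)

lemma pt_index_lists [pt_intros]: "pt k \<Longrightarrow> pt (\<lambda>x. index_lists q (k x))"
  unfolding index_lists_def by (intro pt_slists pt_intros)

lemma pt_circuit_alts [pt_intros]: "pt C \<Longrightarrow> pt (\<lambda>x. circuit_alts d (C x))"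
  by (rule pt_comp[of "circuit_alts d"], unfold circuit_alts_def, intro pt_intros)

lemma pt_input_list [pt_intros]: "pt C \<Longrightarrow> pt (\<lambda>x. input_list (C x))"
  by (rule pt_comp[of input_list], unfold input_list_def, intro pt_intros)

lemma pt_alt_violations [pt_intros]:
  assumes "pt C" "pt p" "pt A"
  shows "pt (\<lambda>x. alt_violations d (C x) (p x) (A x))"
  by (rule pt_comp3[OF _ assms], unfold alt_violations_def, intro pt_intros)

lemma pt_value_bound [pt_intros]: "pt C \<Longrightarrow> pt (\<lambda>x. value_bound d (C x))"
  by (rule pt_comp[of "value_bound d"], unfold value_bound_def, intro pt_intros)

lemma pt_offset [pt_intros]: "pt C \<Longrightarrow> pt (\<lambda>x. offset d (C x))"
  by (rule pt_comp[of "offset d"], unfold offset_def, intro pt_intros)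

lemma pt_width [pt_intros]:
  assumes "pt C" "pt k"
  shows "pt (\<lambda>x. width d (C x) (k x))"
  by (rule pt_comp2[OF _ assms], unfold width_def, intro pt_intros)

lemma pt_item_list [pt_intros]:
  assumes "pt C" "pt k"
  shows "pt (\<lambda>x. item_list d (C x) (k x))"
  by (rule pt_comp2[OF _ assms], unfold item_list_def, intro pt_slists pt_intros)

lemma pt_ref_list [pt_intros]:
  assumes "pt C" "pt k"
  shows "pt (\<lambda>x. ref_list d (C x) (k x))"
  by (rule pt_comp2[OF _ assms], unfold ref_list_def, intro pt_intros)

lemma pt_even_length [pt_intros]:
  assumes "pt l"
  shows "pt (\<lambda>x. even (length (l x)))"
proof -
  have eq: "foldl (\<lambda>s _. \<not> s) b xs = (b = even (length xs))" for b and xs :: "'b list"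
    by (induction xs arbitrary: b) auto
  have "pt (\<lambda>x. foldl (\<lambda>s _. \<not> s) True (l x))"
    by (intro pt_foldl[where B = "\<lambda>_. 3"] pt_intros pb_intros assms sz_bool)
  then show ?thesis by (simp add: eq)
qed

lemma pt_value_at [pt_intros]:
  "pt k \<Longrightarrow> pt w \<Longrightarrow> pt p \<Longrightarrow> pt c \<Longrightarrow> pt (\<lambda>x. value_at (k x) (w x) (p x) (c x))"
  unfolding value_at_def by (intro pt_intros pt_comp[of c fst])

lemma pt_signed_digit:
  assumes "pt z" "pt (\<lambda>p. f (fst p) (snd p))" "pt w"
  shows "pt (\<lambda>x. signed_digit (z x) (f x) (w x))"
  unfolding signed_digit_def by (intro pt_intros pt_comp2[OF assms(2)] assms(1,3))

lemma pt_item_digit [pt_intros]: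
  "pt k \<Longrightarrow> pt w \<Longrightarrow> pt p \<Longrightarrow> pt v \<Longrightarrow> pt y \<Longrightarrow>
    pt (\<lambda>x. item_digit (k x) (w x) (p x) (v x) (y x))"
  unfolding item_digit_def by (intro pt_intros)

lemma pt_covers [pt_intros]: "pt k \<Longrightarrow> pt r \<Longrightarrow> pt c \<Longrightarrow> pt (\<lambda>x. covers (k x) (r x) (c x))"
  unfolding covers_def by (intro pt_intros)

lemma pt_ref_digit [pt_intros]:
  "pt k \<Longrightarrow> pt N \<Longrightarrow> pt c \<Longrightarrow> pt a \<Longrightarrow> pt y \<Longrightarrow>
    pt (\<lambda>x. ref_digit (k x) (N x) (c x) (a x) (y x))"
  unfolding ref_digit_def by (intro pt_intros)

lemma pt_target_digit [pt_intros]: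
  "pt k \<Longrightarrow> pt N \<Longrightarrow> pt M \<Longrightarrow> pt y \<Longrightarrow> pt (\<lambda>x. target_digit (k x) (N x) (M x) (y x))"
  unfolding target_digit_def by (intro pt_intros)

lemma pt_low_keys [pt_intros]:
  assumes "pt R" "pt k"
  shows "pt (\<lambda>x. low_keys (R x) (k x))"
  by (rule pt_comp2[OF _ assms], unfold low_keys_def, intro pt_intros)

lemma pt_num_bits:
  assumes "pt b" "pt (\<lambda>p. g (fst p) (snd p))" "pt R" "pt k"
  shows "pt (\<lambda>x. num_bits (b x) (g x) (R x) (k x))"
  unfolding num_bits_def by (intro pt_intros pt_comp2[OF assms(2)] pt_comp[OF assms(1)] assms(1,3,4))

lemma pt_item_key_digit [pt_intros]:
  "pt C \<Longrightarrow> pt k \<Longrightarrow> pt e \<Longrightarrow> pt y \<Longrightarrow> pt (\<lambda>x. item_key_digit d (C x) (k x) (e x) (y x))"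
  unfolding item_key_digit_def
  by (intro pt_intros pt_signed_digit pt_comp[of C fst] pt_comp[of e fst])

lemma pt_ref_key_digit [pt_intros]:
  "pt C \<Longrightarrow> pt k \<Longrightarrow> pt e \<Longrightarrow> pt y \<Longrightarrow> pt (\<lambda>x. ref_key_digit d (C x) (k x) (e x) (y x))"
  unfolding ref_key_digit_def by (intro pt_intros)

lemma pt_target_key_digit [pt_intros]:
  "pt C \<Longrightarrow> pt k \<Longrightarrow> pt y \<Longrightarrow> pt (\<lambda>x. target_key_digit d (C x) (k x) (y x))"
  unfolding target_key_digit_def by (intro pt_intros)

lemma pt_matrix_trees [pt_intros]:
  assumes "pt C" "pt k"
  shows "pt (\<lambda>x. matrix_trees d (C x) (k x))"
  by (rule pt_comp2[OF _ assms], unfold matrix_trees_def, intro pt_intros pt_num_bits)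

lemma pt_reduce: "pt (reduce d)"
  unfolding reduce_def by (intro pt_intros)

subsection \<open>Correctness\<close>

definition alt_value :: "nat \<Rightarrow> circuit \<Rightarrow> nat \<Rightarrow> nat set \<Rightarrow> nat" where
  "alt_value d C p B = length (filter (\<lambda>l. gate_value C B (fst l) \<noteq> snd l) (circuit_alts d C ! p))"

lemma check_ok:
  assumes "check d C"
  shows "wf_circuit C" "length C - 1 < length C" "ok d 1 C (length C - 1)"
  using assms check_iff[of d C] ok_iff_weft_depth[of C d 1] by (auto simp: wf_circuit_def)

lemma circuit_alts_literals:
  assumes "check d C" "p < length (circuit_alts d C)" "l \<in> set (circuit_alts d C ! p)"
  shows "fst l < length C" "ok d 0 C (fst l)"
  using alts_correct[OF check_ok[OF assms(1)], of undefined True] assms(2,3) nth_mem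
  unfolding circuit_alts_def by blast+

lemma satisfies_iff_alt_value:
  assumes "check d C"
  shows "satisfies A C \<longleftrightarrow> (\<exists>p < length (circuit_alts d C). alt_value d C p A = 0)"
proof -
  have "satisfies A C \<longleftrightarrow>
      (\<exists>ls \<in> set (circuit_alts d C). \<forall>l \<in> set ls. gate_value C A (fst l) = snd l)"
    using alts_correct[OF check_ok[OF assms], of A True] unfolding satisfies_def circuit_alts_def by simp
  also have "\<dots> \<longleftrightarrow> (\<exists>p < length (circuit_alts d C).
      \<forall>l \<in> set (circuit_alts d C ! p). gate_value C A (fst l) = snd l)"
    by (metis in_set_conv_nth)
  finally show ?thesis
    by (simp add: alt_value_def filter_empty_conv)
qed

lemma alt_violations_eq:
  assumes "check d C" "p < length (circuit_alts d C)"
  shows "alt_violations d C p A = alt_value d C p (set A)"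
proof -
  have "eval d C A (fst l) = gate_value C (set A) (fst l)" if "l \<in> set (circuit_alts d C ! p)" for l
    using circuit_alts_literals[OF assms that] by (rule eval_gate_value[OF check_ok(1)[OF assms(1)]])
  then show ?thesis using assms(2)
    unfolding alt_violations_def violations_def alt_value_def
    by (simp cong: filter_cong)
qed

lemma alt_value_less:
  assumes "p < length (circuit_alts d C)"
  shows "alt_value d C p B < offset d C"
proof -
  have "alt_value d C p B \<le> length (circuit_alts d C ! p)" by (simp add: alt_value_def)
  also have "\<dots> \<le> length (concat (circuit_alts d C))"
    unfolding length_concat using assms by (intro member_le_sum_list) auto
  finally show ?thesis by (simp add: offset_def)
qed

text \<open>A whole alternative may depend on arbitrarily many inputs. Bounded inversion applies to
  single literals, and both sides are additive over them.\<close>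

lemma moebius_literals:
  assumes "wf_circuit C" "inj_on h {..<k}" "\<forall>l \<in> set ls. fst l < length C \<and> ok d 0 C (fst l)"
  shows "(\<Sum>r \<in> set (index_lists (2 ^ d) k). (-1) ^ length (unmarked r) *
      int (length (filter (\<lambda>l. gate_value C (h ` set (marked r)) (fst l) \<noteq> snd l) ls))) =
    int (length (filter (\<lambda>l. gate_value C (h ` {..<k}) (fst l) \<noteq> snd l) ls))"
  using assms(3)
proof (induction ls)
  case (Cons l ls)
  define F where "F B = (of_bool (gate_value C B (fst l) \<noteq> snd l) :: int)" for B
  have split: "int (length (filter (\<lambda>l. gate_value C B (fst l) \<noteq> snd l) (l # ls))) =
      F B + int (length (filter (\<lambda>l. gate_value C B (fst l) \<noteq> snd l) ls))" for B
    by (simp add: F_def)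
  obtain U where U: "finite U" "card U \<le> 2 ^ d" "\<And>B. gate_value C B (fst l) = gate_value C (B \<inter> U) (fst l)"
    using eval_depends_on[OF assms(1), of "fst l" d] Cons.prems by auto
  have "F B = F (B \<inter> U)" for B unfolding F_def by (simp only: U(3)[of B])
  from sum_index_lists_eq[of h k U "2 ^ d" F, OF assms(2) U(1,2) this]
  have "(\<Sum>r \<in> set (index_lists (2 ^ d) k). (-1) ^ length (unmarked r) * F (h ` set (marked r))) = F (h ` {..<k})" .
  then show ?case
    unfolding split distrib_left sum.distrib using Cons by simp
qed simp

lemma set_input_list: "set (input_list C) = input_gates C"
  by (auto simp: input_list_def input_gates_def)

lemma selection_circuit:
  assumes "check d C" "1 \<le> d"
  shows "selection k (2 ^ d) (length (circuit_alts d C)) (value_bound d C) (offset d C) (input_gates C)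
    (alt_violations d C) (alt_value d C)"
proof
  show "x < value_bound d C" if "x \<in> input_gates C" for x
    using that by (simp add: value_bound_def input_gates_def)
  show "length (circuit_alts d C) \<le> value_bound d C" by (simp add: value_bound_def)
  \<comment> \<open>The depth bounds in \<open>W\<close> are at least 1, so index lists with two
    coordinates exist.\<close>
  show "2 \<le> (2::nat) ^ d" using power_increasing[OF assms(2), of "2::nat"] by simp
  show "(\<Sum>r \<in> set (index_lists (2 ^ d) k). (-1) ^ length (unmarked r) * int (alt_value d C p (h ` set (marked r)))) =
      int (alt_value d C p (h ` {..<k}))"
    if "p < length (circuit_alts d C)" "inj_on h {..<k}" for p and h :: "nat \<Rightarrow> nat"
    unfolding alt_value_def
    using circuit_alts_literals[OF assms(1) that(1)] by (intro moebius_literals[OF check_ok(1)[OF assms(1)] that(2)]) blast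
qed (use alt_violations_eq[OF assms(1)] alt_value_less in auto)

text \<open>Different pieces may yield the same number; any preimages will do, as only the sum
  matters.\<close>

lemma split_list_image:
  fixes f :: "'a \<Rightarrow> nat" and g :: "'b \<Rightarrow> nat"
  assumes "set ss \<subseteq> f ` A \<union> g ` B"
  shows "\<exists>xs ys. set xs \<subseteq> A \<and> set ys \<subseteq> B \<and> length xs + length ys = length ss \<and>
    sum_list ss = sum_list (map f xs) + sum_list (map g ys)"
  using assms
proof (induction ss)
  case (Cons s ss)
  then obtain xs ys where *: "set xs \<subseteq> A" "set ys \<subseteq> B" "length xs + length ys = length ss"
    "sum_list ss = sum_list (map f xs) + sum_list (map g ys)" by auto
  from Cons.prems consider x where "x \<in> A" "s = f x" | y where "y \<in> B" "s = g y" by auto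
  then show ?case
  proof cases
    case 1
    then show ?thesis using * by (intro exI[of _ "x # xs"] exI[of _ ys]) simp
  next
    case 2
    then show ?thesis using * by (intro exI[of _ xs] exI[of _ "y # ys"]) simp
  qed
qed simp

lemma bits_num_keys:
  assumes "0 < g ([], [])" "\<And>x. g x < 2 ^ b"
  shows "bits (num b (map g (keys R k))) = num_bits b g R k"
  using bits_num[of "g ([], [])" "map g (low_keys R k)" b] assms
  by (simp add: keys_def num_bits_def comp_def)

lemma reduce_correct:
  assumes check: "check d C" and d: "1 \<le> d"
  shows "fst (reduce d (C, k)) \<in> integer_2x2_inputs \<and>
    (reduce d (C, k) \<in> matrix_k_product_rep_zero \<longleftrightarrow>
      (\<exists>A \<subseteq> input_gates C. card A = k \<and> satisfies A C))"
proof -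
  interpret selection k "2 ^ d" "length (circuit_alts d C)" "value_bound d C" "offset d C" "input_gates C"
    "alt_violations d C" "alt_value d C"
    by (rule selection_circuit[OF check d])
  define m where "m = length R + Suc k"
  define b where "b = width d C k"
  have b: "b = m * (value_bound d C + 2 * offset d C + 1)" by (simp add: b_def width_def m_def)
  have less: "n < 2 ^ b" if "n \<le> b" for n
    by (rule le_less_trans[OF that less_exp])
  have sub: "set w \<subseteq> ({..<k} \<times> UNIV) \<times> input_gates C \<longleftrightarrow>
      (fst \<circ> fst) ` set w \<subseteq> {..<k} \<and> snd ` set w \<subseteq> input_gates C" for w :: "((nat \<times> bool) \<times> nat) list"
    by (simp add: image_subset_iff subset_eq mem_Times_iff ball_conj_distrib)
  have pairs: "set (concat (map (\<lambda>s. map (\<lambda>a. (s, a)) (input_list C)) (sgn_coords k))) =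
      ({..<k} \<times> UNIV) \<times> input_gates C"
    by (auto simp: set_input_list)
  have product: "set (concat (map (\<lambda>w. map (\<lambda>p. (w, p)) [0..<n]) ws)) = {(w, p). w \<in> set ws \<and> p < n}"
    for n :: nat and ws :: "((nat \<times> bool) \<times> nat) list list"
    by auto
  have items: "set (item_list d C k) = items"
    unfolding item_list_def items_def product set_slists pairs sub
    by (rule Collect_cong) (simp add: case_prod_unfold conj_ac)
  have refs: "set (ref_list d C k) = refs"
    by (auto simp: ref_list_def refs_def set_input_list)
  have item_key: "item_key_digit d C k e = item_fun e" for e
    by (simp add: fun_eq_iff item_key_digit_def item_fun_def case_prod_unfold)
  have ref_key: "ref_key_digit d C k e = ref_fun e" for e
    by (simp add: fun_eq_iff ref_key_digit_def ref_fun_def case_prod_unfold)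
  have target_key: "target_key_digit d C k = target_fun"
    by (simp add: fun_eq_iff target_key_digit_def target_fun_def)
  have m1: "1 \<le> m" by (simp add: m_def)
  define D where "D = value_bound d C + 2 * offset d C + 1"
  have Db: "D \<le> b" unfolding b D_def[symmetric] using m1 by simp
  define item_num where "item_num e = num b (map (item_fun e) (keys R k))" for e
  define ref_num where "ref_num e = num b (map (ref_fun e) (keys R k))" for e
  define t where "t = num b (map target_fun (keys R k))"
  define V where "V = map item_num (item_list d C k) @ map ref_num (ref_list d C k)"
  have bits_item: "bits (item_num e) = num_bits b (item_key_digit d C k e) R k" if e_items: "e \<in> items" for e
    unfolding item_num_def item_key
  proof (rule bits_num_keys)
    obtain w p where e: "e = (w, p)" "p < length (circuit_alts d C)" using e_items by (auto simp: items_def)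
    have "alt_violations d C p xs < offset d C" for xs using F_less f_F e(2) by simp
    moreover have "0 < offset d C" by (simp add: offset_def)
    ultimately show "0 < item_fun e ([], [])"
      by (simp add: e(1) item_fun_def item_digit_def signed_digit_def)
    show "item_fun e x < 2 ^ b" for x
      using item_fun_le[OF e_items, of x] Db by (intro less) (simp add: D_def)
  qed
  have bits_ref: "bits (ref_num e) = num_bits b (ref_key_digit d C k e) R k" for e
    unfolding ref_num_def ref_key
  proof (rule bits_num_keys)
    show "0 < ref_fun e ([], [])"
      by (simp add: ref_fun_def ref_digit_def case_prod_unfold)
    show "ref_fun e x < 2 ^ b" for x
      using ref_fun_le[of e x] Db by (intro less) (simp add: D_def)
  qed
  have target_less: "target_fun x < 2 ^ b" for x
    using target_fun_le[of x] by (intro less) (simp add: b m_def)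
  have pos: "0 < target_fun ([], [])"
    by (simp add: target_fun_def target_digit_def)
  have bits_t: "bits t = num_bits b (target_key_digit d C k) R k"
    unfolding t_def target_key using pos target_less by (rule bits_num_keys)
  have t_pos: "0 < t"
    unfolding t_def keys_def map_append list.map by (rule num_pos[OF pos])
  have trees: "matrix_trees d C k = map enc_mat (singular t # map shear V)"
    using items by (simp add: matrix_trees_def enc_mat_singular[OF t_pos] enc_mat_shear bits_t V_def
        bits_item bits_ref comp_def flip: b_def)
  have enc_map: "enc_list (\<lambda>t. t) (map enc_mat Ms) = enc_list enc_mat Ms" for Ms
    by (induction Ms) auto
  have red: "reduce d (C, k) = (enc_list enc_mat (singular t # map shear V), m + 2)"
    using check by (simp only: reduce_def fst_conv snd_conv if_True trees to_tree_list_def m_def)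
      (simp add: enc_map[symmetric] to_tree_tree_def[abs_def])
  \<comment> \<open>At most \<open>m\<close> pieces with digits at most \<open>D\<close> keep all
    digit sums within \<open>b\<close>, which is below the base \<open>2 ^ b\<close>.\<close>
  have hits: "hits_target xs ys \<longleftrightarrow> sum_list (map item_num xs) + sum_list (map ref_num ys) = t"
    if "set xs \<subseteq> items" "length xs + length ys \<le> m" for xs ys
  proof -
    let ?gs = "map item_fun xs @ map ref_fun ys"
    have "sum_list (map (\<lambda>g. g x) ?gs) < 2 ^ b" for x
    proof (rule less)
      have "sum_list (map (\<lambda>g. g x) ?gs) \<le> length ?gs * D"
      proof -
        have "g x \<le> D" if "g \<in> set ?gs" for g
          using that item_fun_le[of _ x] ref_fun_le[of _ x] \<open>set xs \<subseteq> items\<close> by (auto simp: D_def)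
        then have "sum_list (map (\<lambda>g. g x) ?gs) \<le> sum_list (map (\<lambda>_. D) ?gs)"
          by (rule sum_list_mono)
        then show ?thesis by (simp add: comp_def sum_list_triv add_mult_distrib)
      qed
      also have "\<dots> \<le> b" unfolding b D_def[symmetric] using that(2) by (intro mult_le_mono1) simp
      finally show "sum_list (map (\<lambda>g. g x) ?gs) \<le> b" .
    qed
    from sum_digits_iff[of "keys R k" ?gs b target_fun, OF this target_less]
    have "sum_list (map (\<lambda>e. item_num e) xs) + sum_list (map (\<lambda>e. ref_num e) ys) = t \<longleftrightarrow> hits_target xs ys"
      unfolding item_num_def ref_num_def t_def hits_target_def by (simp add: comp_def)
    then show ?thesis by simp
  qed
  have "fst (reduce d (C, k)) \<in> integer_2x2_inputs"
    unfolding red fst_conv by (rule shear_list_integer)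
  moreover have "reduce d (C, k) \<in> matrix_k_product_rep_zero \<longleftrightarrow>
      (\<exists>A \<subseteq> input_gates C. card A = k \<and> satisfies A C)"
  proof
    assume "reduce d (C, k) \<in> matrix_k_product_rep_zero"
    from problem_shear_list[OF this[unfolded red]]
    obtain ss where ss: "set ss \<subseteq> set V" "length ss \<le> m" "sum_list ss = t" by blast
    have "set ss \<subseteq> item_num ` items \<union> ref_num ` refs"
      using ss(1) items refs by (simp add: V_def)
    from split_list_image[OF this] obtain xs ys where xs: "set xs \<subseteq> items" "set ys \<subseteq> refs"
      "length xs + length ys = length ss" "sum_list ss = sum_list (map item_num xs) + sum_list (map ref_num ys)"
      by blast
    have "hits_target xs ys" using hits[of xs ys] xs ss by simp
    from sound[OF xs(1,2) this] show "\<exists>A \<subseteq> input_gates C. card A = k \<and> satisfies A C"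
      unfolding satisfies_iff_alt_value[OF check] by blast
  next
    assume "\<exists>A \<subseteq> input_gates C. card A = k \<and> satisfies A C"
    then obtain A p where A: "A \<subseteq> input_gates C" "card A = k" "p < length (circuit_alts d C)" "alt_value d C p A = 0"
      unfolding satisfies_iff_alt_value[OF check] by blast
    have "finite A" by (rule finite_subset[OF A(1)]) (simp add: input_gates_def)
    from complete[OF A(1) this A(2-4)] obtain xs ys where xs: "set xs \<subseteq> items" "set ys \<subseteq> refs"
      "length xs + length ys = m" "hits_target xs ys" unfolding m_def by blast
    have "sum_list (map item_num xs @ map ref_num ys) = t" using hits[of xs ys] xs by simp
    moreover have "set (map item_num xs @ map ref_num ys) \<subseteq> set V"
      using xs items refs by (auto simp: V_def)
    ultimately show "reduce d (C, k) \<in> matrix_k_product_rep_zero"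
      unfolding red using xs(3) by (intro shear_list_in_problem[where ss = "map item_num xs @ map ref_num ys"]) auto
  qed
  ultimately show ?thesis by blast
qed

lemma WCS_iff:
  "(to_tree C, k) \<in> WCS 1 d \<longleftrightarrow> check d C \<and> (\<exists>A \<subseteq> input_gates C. card A = k \<and> satisfies A C)"
proof -
  have "to_tree C = enc_list enc_gate C' \<longleftrightarrow> C' = C" for C'
  proof -
    have "to_tree C = enc_list enc_gate C' \<longleftrightarrow> to_tree C = to_tree C'"
      by (simp add: to_tree_list_def to_tree_gate_def)
    then show ?thesis by auto
  qed
  then show ?thesis unfolding WCS_def check_iff by auto
qed

lemma WCS_is_circuit: "(x, k) \<in> WCS 1 d \<Longrightarrow> is_circuit x"
  unfolding is_circuit_iff WCS_def by (auto simp: to_tree_list_def to_tree_gate_def)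

text \<open>Choice suffices here: the decoded circuit has the given tree as its encoding, so no
  program has to decode anything.\<close>

definition decode_circuit :: "tree \<Rightarrow> circuit" where
  "decode_circuit x = (SOME C. x = to_tree C)"

lemma decode_circuit: "is_circuit x \<Longrightarrow> to_tree (decode_circuit x) = x"
  unfolding is_circuit_iff decode_circuit_def by (rule someI_ex[THEN sym])

definition reduction :: "nat \<Rightarrow> tree \<times> nat \<Rightarrow> tree \<times> nat" where
  "reduction d p = (if is_circuit (fst p) then reduce d (decode_circuit (fst p), snd p) else (Tip, 1))"

lemma reduction_correct:
  assumes "1 \<le> d"
  shows "p \<in> WCS 1 d \<longleftrightarrow> reduction d p \<in> matrix_k_product_rep_zero"
    and "fst (reduction d p) \<in> integer_2x2_inputs"
proof -
  obtain x k where p: "p = (x, k)" by (cases p)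
  show "p \<in> WCS 1 d \<longleftrightarrow> reduction d p \<in> matrix_k_product_rep_zero"
  proof (cases "is_circuit x")
    case True
    define C where "C = decode_circuit x"
    have x: "x = to_tree C" using decode_circuit[OF True] by (simp add: C_def)
    have r: "reduction d p = reduce d (C, k)" using True by (simp add: reduction_def p C_def)
    show ?thesis
    proof (cases "check d C")
      case True
      then show ?thesis unfolding r using reduce_correct[OF True assms, of k] WCS_iff[of C k d] p x by simp
    next
      case False
      then show ?thesis unfolding r
        using WCS_iff[of C k d] p x empty_list_not_in_problem by (simp add: reduce_def)
    qed
  next
    case False
    then show ?thesis
      using WCS_is_circuit[of x k d] empty_list_not_in_problem by (auto simp: reduction_def p)
  qed
  show "fst (reduction d p) \<in> integer_2x2_inputs"
  proof (cases "is_circuit x \<and> check d (decode_circuit x)")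
    case True
    then show ?thesis using reduce_correct[OF _ assms] by (simp add: reduction_def p)
  next
    case False
    then show ?thesis using Tip_integer by (auto simp: reduction_def reduce_def p)
  qed
qed

text \<open>The true branch runs the program for \<open>reduce\<close> on the unchanged tree, read
  as a circuit. Only the test justifies this reading, so the program is built from
  \<open>branch_com\<close> instead of by \<open>pt_if\<close>.\<close>

lemma pt_reduction: "pt (reduction d)"
proof -
  obtain c1 N1 C1 e1 where 1: "\<And>a. runs c1 N1 (to_tree a) (C1 * sz a ^ e1) (to_tree (reduce d a))"
    using pt_reduce by (rule ptE) blast
  have "pt (\<lambda>p :: tree \<times> nat. (Tip, 1 :: nat))" by (intro pt_intros)
  then obtain c2 N2 C2 e2 where 2: "\<And>a :: tree \<times> nat. runs c2 N2 (to_tree a) (C2 * sz a ^ e2) (to_tree (Tip, 1 :: nat))"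
    by (rule ptE) blast
  have "pt (\<lambda>p :: tree \<times> nat. (is_circuit (fst p), p))" by (intro pt_intros)
  then obtain c0 N0 C0 e0 where 0: "\<And>p :: tree \<times> nat. runs c0 N0 (to_tree p) (C0 * sz p ^ e0) (to_tree (is_circuit (fst p), p))"
    by (rule ptE) blast
  define N where "N = max N0 (max N1 N2)"
  define T where "T p = C1 * sz p ^ e1 + C2 * sz p ^ e2" for p :: "tree \<times> nat"
  have "runs (Seq c0 (branch_com c1 c2)) N (to_tree p)
     (C0 * sz p ^ e0 + (T p + 4 + 9 + 3 * sz p)) (to_tree (reduction d p))" for p
  proof (rule runs_Seq)
    show "runs c0 N (to_tree p) (C0 * sz p ^ e0) (to_tree (is_circuit (fst p), p))"
      by (rule runs_mono[OF 0]) (simp_all add: N_def)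
    have "runs (if to_tree (is_circuit (fst p)) = Tip then c2 else c1) N (to_tree p) (T p) (to_tree (reduction d p))"
    proof (cases "is_circuit (fst p)")
      case True
      have p: "to_tree (decode_circuit (fst p), snd p) = to_tree p"
        using decode_circuit[OF True] by (cases p) simp
      then have "sz (decode_circuit (fst p), snd p) = sz p" unfolding sz_def by simp
      then show ?thesis using True p runs_mono[OF 1[of "(decode_circuit (fst p), snd p)"], of N "T p"]
        by (simp add: enc_bool_def reduction_def N_def T_def)
    next
      case False
      then show ?thesis using runs_mono[OF 2[of p], of N "T p"]
        by (simp add: enc_bool_def reduction_def N_def T_def)
    qed
    from runs_mono[OF runs_branch[OF this] order_refl]
    show "runs (branch_com c1 c2) N (to_tree (is_circuit (fst p), p)) (T p + 4 + 9 + 3 * sz p) (to_tree (reduction d p))"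
      by (simp add: sz_def enc_bool_def)
  qed
  moreover have "pb (\<lambda>p. C0 * sz p ^ e0 + (T p + 4 + 9 + 3 * sz p))"
    unfolding T_def by (intro pb_intros pt_intros)
  ultimately show ?thesis by (rule ptI[rotated])
qed

lemma length_slists_le: "length (slists R q L) \<le> (Suc (length L)) ^ q"
proof (induction q)
  case (Suc q)
  have "length (concat (map (\<lambda>w. map (\<lambda>x. x # w) (filter (\<lambda>x. \<forall>y \<in> set w. R x y) L)) ws)) \<le> length ws * length L" for ws
  proof (induction ws)
    case (Cons w ws)
    show ?case using add_mono[OF length_filter_le[of "\<lambda>x. \<forall>y \<in> set w. R x y" L] Cons.IH] by simp
  qed simp
  from this[of "slists R q L"] have "length (slists R (Suc q) L) \<le> 1 + length (slists R q L) * length L" by simp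
  also have "\<dots> \<le> Suc (length L) ^ q + Suc (length L) ^ q * length L"
    using Suc by (intro add_mono mult_le_mono1) simp_all
  finally show ?case by (simp add: mult.commute)
qed simp

lemma reduction_parameter: "snd (reduction d (x, k)) \<le> Suc (2 * k) ^ (2 ^ d) + Suc k + 2"
proof -
  have "length (sgn_coords k) = 2 * k" by (induction k) (auto simp: sgn_coords_def)
  then have "length (index_lists (2 ^ d) k) \<le> Suc (2 * k) ^ (2 ^ d)"
    using length_slists_le[of _ "2 ^ d" "sgn_coords k"] by (simp add: index_lists_def)
  then show ?thesis by (simp add: reduction_def reduce_def)
qed

section \<open>Composition with an arbitrary reduction\<close>

fun exp_bound :: "exp \<Rightarrow> nat" where
  "exp_bound (VarE v) = Suc v"
| "exp_bound TipE = 0"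
| "exp_bound (NodeE a b) = max (exp_bound a) (exp_bound b)"
| "exp_bound (HdE a) = exp_bound a"
| "exp_bound (TlE a) = exp_bound a"
| "exp_bound (EqE a b) = max (exp_bound a) (exp_bound b)"

fun com_bound :: "com \<Rightarrow> nat" where
  "com_bound Skip = 0"
| "com_bound (Assign v e) = max (Suc v) (exp_bound e)"
| "com_bound (Seq c1 c2) = max (com_bound c1) (com_bound c2)"
| "com_bound (Ite e c1 c2) = max (exp_bound e) (max (com_bound c1) (com_bound c2))"
| "com_bound (While e c) = max (exp_bound e) (com_bound c)"

lemma exp_frame:
  assumes "exp_bound e \<le> N" "\<And>v. v < N \<Longrightarrow> r v = s v"
  shows "eval_exp e r = eval_exp e s \<and> cost_exp e r = cost_exp e s"
  using assms by (induction e) auto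

text \<open>A run neither reads nor writes variables from \<open>com_bound c\<close> on, so it can
  take place within a larger program that keeps data there.\<close>

lemma exec_frame:
  assumes "exec c s t s'" "com_bound c \<le> N" "\<And>v. v < N \<Longrightarrow> r v = s v"
  shows "exec c r t (\<lambda>v. if v < N then s' v else r v)"
  using assms
proof (induction arbitrary: r rule: exec.induct)
  case (exec_Skip s)
  then have "(\<lambda>v. if v < N then s v else r v) = r" by auto
  then show ?case by (simp add: exec.exec_Skip[of r, simplified])
next
  case (exec_Assign v e s)
  have e: "eval_exp e r = eval_exp e s" "cost_exp e r = cost_exp e s"
    using exp_frame[of e N r s] exec_Assign by auto
  show ?case by (rule exec_Assign') (use exec_Assign e in auto)
next
  case (exec_Seq c1 s t1 s' c2 t2 s'')
  let ?r = "\<lambda>v. if v < N then s' v else r v"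
  have 1: "exec c1 r t1 ?r" using exec_Seq by auto
  have "exec c2 ?r t2 (\<lambda>v. if v < N then s'' v else ?r v)"
    by (rule exec_Seq.IH(2)) (use exec_Seq.prems in auto)
  moreover have "(\<lambda>v. if v < N then s'' v else ?r v) = (\<lambda>v. if v < N then s'' v else r v)" by auto
  ultimately show ?case using exec.exec_Seq[OF 1] by metis
next
  case (exec_IteTrue e s c1 t s' c2)
  have e: "eval_exp e r = eval_exp e s" "cost_exp e r = cost_exp e s"
    using exp_frame[of e N r s] exec_IteTrue.prems by auto
  have "exec c1 r t (\<lambda>v. if v < N then s' v else r v)" using exec_IteTrue by auto
  from exec.exec_IteTrue[OF _ this, of e c2] show ?case using e exec_IteTrue.hyps(1) by metis
next
  case (exec_IteFalse e s c2 t s' c1)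
  have e: "eval_exp e r = eval_exp e s" "cost_exp e r = cost_exp e s"
    using exp_frame[of e N r s] exec_IteFalse.prems by auto
  have "exec c2 r t (\<lambda>v. if v < N then s' v else r v)" using exec_IteFalse by auto
  from exec.exec_IteFalse[OF _ this, of e c1] show ?case using e exec_IteFalse.hyps(1) by metis
next
  case (exec_WhileTrue e s c t1 s' t2 s'')
  have e: "eval_exp e r = eval_exp e s" "cost_exp e r = cost_exp e s"
    using exp_frame[of e N r s] exec_WhileTrue.prems by auto
  let ?r = "\<lambda>v. if v < N then s' v else r v"
  have 1: "exec c r t1 ?r" using exec_WhileTrue.IH(1) exec_WhileTrue.prems by auto
  have "exec (While e c) ?r t2 (\<lambda>v. if v < N then s'' v else ?r v)"
    by (rule exec_WhileTrue.IH(2)) (use exec_WhileTrue.prems in auto)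
  moreover have "(\<lambda>v. if v < N then s'' v else ?r v) = (\<lambda>v. if v < N then s'' v else r v)" by auto
  ultimately have "exec (While e c) ?r t2 (\<lambda>v. if v < N then s'' v else r v)" by metis
  from exec.exec_WhileTrue[OF _ 1 this] show ?case using e exec_WhileTrue.hyps(1) by metis
next
  case (exec_WhileFalse e s c)
  have e: "eval_exp e r = eval_exp e s" "cost_exp e r = cost_exp e s"
    using exp_frame[of e N r s] exec_WhileFalse.prems by auto
  have "(\<lambda>v. if v < N then s v else r v) = r" using exec_WhileFalse.prems by auto
  then show ?case using exec.exec_WhileFalse[of e r c] e exec_WhileFalse.hyps by metis
qed

fun clear_com :: "nat \<Rightarrow> com" where
  "clear_com 0 = Skip"
| "clear_com (Suc n) = Seq (clear_com n) (Assign (Suc n) TipE)"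

lemma exec_clear_com: "exec (clear_com n) s (1 + 2 * n) (\<lambda>v. if 0 < v \<and> v \<le> n then Tip else s v)"
proof (induction n)
  case 0
  have "(\<lambda>v. if 0 < v \<and> v \<le> 0 then Tip else s v) = s" by auto
  then show ?case using exec_Skip[of s] by simp
next
  case (Suc n)
  let ?s = "\<lambda>v. if 0 < v \<and> v \<le> n then Tip else s v"
  have "exec (Assign (Suc n) TipE) ?s 2 (\<lambda>v. if 0 < v \<and> v \<le> Suc n then Tip else s v)"
    by (rule exec_Assign') (auto simp: fun_eq_iff)
  from exec_Seq[OF Suc this] show ?case by simp
qed

text \<open>Makes an arbitrary program clean: a source reduction may leave anything in its
  variables, and \<open>clear_com\<close> removes it.\<close>

lemma computes_in_runs:
  assumes "computes_in c x t y" "com_bound c \<le> N" "0 < N"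
  shows "runs (Seq c (clear_com N)) (N + 1) x (t + 1 + 2 * N) y"
proof (rule runsI)
  fix r :: state assume r: "r 0 = x" "\<And>v. 0 < v \<Longrightarrow> v < N + 1 \<Longrightarrow> r v = Tip"
  obtain s where s: "exec c ((\<lambda>_. Tip)(0 := x)) t s" "s 0 = y"
    using assms(1) unfolding computes_in_def by blast
  have 1: "exec c r t (\<lambda>v. if v < N then s v else r v)"
    by (rule exec_frame[OF s(1) assms(2)]) (use r in auto)
  have "(\<lambda>v. if 0 < v \<and> v \<le> N then Tip else if v < N then s v else r v) = r(0 := y)"
    using r s(2) assms(3) by (auto simp: fun_eq_iff)
  then have "exec (Seq c (clear_com N)) r (t + (1 + 2 * N)) (r(0 := y))"
    using exec_Seq[OF 1 exec_clear_com[of N "\<lambda>v. if v < N then s v else r v"]] by simp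
  then show "\<exists>t' \<le> t + 1 + 2 * N. exec (Seq c (clear_com N)) r t' (r(0 := y))"
    by (intro exI[of _ "t + (1 + 2 * N)"]) simp
qed

text \<open>Extends \<open>computable\<close> to all encoded types; pairs serve to combine
  \<open>f k\<close> with \<open>k\<close> in the time bound.\<close>

definition computable_fun :: "('a :: tree_enc \<Rightarrow> 'b :: tree_enc) \<Rightarrow> bool" where
  "computable_fun f \<longleftrightarrow> (\<exists>c N T. \<forall>a. runs c N (to_tree a) (T a) (to_tree (f a)))"

lemma computable_iff: "computable f \<longleftrightarrow> computable_fun f"
proof
  assume "computable f"
  then obtain c where "\<forall>n. \<exists>t. computes_in c (enc_unary n) t (enc_unary (f n))"
    unfolding computable_def by blast
  then obtain T where "\<And>n. computes_in c (enc_unary n) (T n) (enc_unary (f n))" by metis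
  from computes_in_runs[OF this, of "Suc (com_bound c)"]
  have "runs (Seq c (clear_com (Suc (com_bound c)))) (Suc (com_bound c) + 1) (to_tree n)
      (T n + 1 + 2 * Suc (com_bound c)) (to_tree (f n))" for n
    by (simp add: to_tree_nat_def)
  then show "computable_fun f"
    unfolding computable_fun_def by (intro exI allI)
next
  assume "computable_fun f"
  then obtain c N T where "\<And>n. runs c N (to_tree n) (T n) (to_tree (f n))"
    unfolding computable_fun_def by blast
  then have "\<exists>t. computes_in c (to_tree n) t (to_tree (f n))" for n
    using runs_computes_in by blast
  then show "computable f"
    unfolding computable_def to_tree_nat_def by blast
qed

lemma computable_fun_pt: "pt f \<Longrightarrow> computable_fun f"
  unfolding pt_def computable_fun_def by blast

lemma computable_fun_comp:
  assumes "computable_fun g" "computable_fun f"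
  shows "computable_fun (\<lambda>x. g (f x))"
proof -
  obtain c1 N1 T1 where 1: "\<And>a. runs c1 N1 (to_tree a) (T1 a) (to_tree (f a))"
    using assms(2) unfolding computable_fun_def by blast
  obtain c2 N2 T2 where 2: "\<And>a. runs c2 N2 (to_tree a) (T2 a) (to_tree (g a))"
    using assms(1) unfolding computable_fun_def by blast
  have "runs (Seq c1 c2) (max N1 N2) (to_tree a) (T1 a + T2 (f a)) (to_tree (g (f a)))" for a
    by (rule runs_Seq[OF runs_mono[OF 1] runs_mono[OF 2]]) auto
  then show ?thesis unfolding computable_fun_def by (intro exI allI)
qed

lemma computable_fun_Pair:
  assumes "computable_fun f" "computable_fun g"
  shows "computable_fun (\<lambda>x. (f x, g x))"
proof -
  obtain c1 N1 T1 where 1: "\<And>a. runs c1 N1 (to_tree a) (T1 a) (to_tree (f a))"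
    using assms(1) unfolding computable_fun_def by blast
  obtain c2 N2 T2 where 2: "\<And>a. runs c2 N2 (to_tree a) (T2 a) (to_tree (g a))"
    using assms(2) unfolding computable_fun_def by blast
  define N where "N = max (Suc N1) N2"
  have "runs (pair_com N c1 c2) (N + 2) (to_tree a)
      (T1 a + T2 a + 2 * tsize (to_tree a) + 3 * tsize (to_tree (f a)) + 2 * tsize (to_tree (g a)) + 10)
      (to_tree (f a, g a))" for a
    unfolding to_tree_simps
    by (rule runs_pair[OF runs_mono[OF 1] runs_mono[OF 2]]) (auto simp: N_def)
  then show ?thesis unfolding computable_fun_def by (intro exI allI)
qed

lemma enc_inst_eq: "enc_inst p = to_tree p"
  by (simp add: enc_inst_def to_tree_prod_def to_tree_nat_def)

lemma sz_tree: "sz (x :: tree) = tsize x"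
  by (simp add: sz_def)

text \<open>The total must again be a factor depending on \<open>k\<close> times a power of
  \<open>n\<close>, although the second program is charged for an argument whose size mixes
  \<open>n\<close>, \<open>k\<close> and the cost \<open>t\<close> of the first.\<close>

lemma composed_cost_bound:
  fixes n k t t' :: nat
  assumes "1 \<le> n" "t \<le> a * n ^ e" "t' \<le> C * (n + 2 * k + 2 + t) ^ e'"
  shows "t + 1 + 2 * N + t' \<le> (1 + C) * (2 * k + 4 + 2 * N + a) ^ (e' + 1) * n ^ ((e + 1) * (e' + 1))"
proof -
  \<comment> \<open>The exponent \<open>e + 1\<close> dominates both \<open>n\<close> and
    \<open>n ^ e\<close>; below, \<open>e' + 1\<close> does the same for \<open>Y\<close> and
    \<open>Y ^ e'\<close>.\<close>
  define Y where "Y = (2 * k + 4 + 2 * N + a) * n ^ (e + 1)"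
  have n: "n \<le> n ^ (e + 1)" "1 \<le> n ^ (e + 1)" "n ^ e \<le> n ^ (e + 1)"
    using assms(1) power_increasing[of 1 "e + 1" n] by (auto intro: power_increasing)
  have t: "t \<le> a * n ^ (e + 1)"
    using assms(2) mult_le_mono2[OF n(3), of a] by linarith
  have k: "2 * k + 2 \<le> (2 * k + 2) * n ^ (e + 1)" and N: "1 + 2 * N \<le> (1 + 2 * N) * n ^ (e + 1)"
    using n(2) mult_le_mono2[OF n(2), of "2 * k + 2"] mult_le_mono2[OF n(2), of "1 + 2 * N"] by simp_all
  have Y: "Y = (2 * k + 2) * n ^ (e + 1) + (1 + 2 * N) * n ^ (e + 1) + n ^ (e + 1) + a * n ^ (e + 1)"
    by (simp add: Y_def algebra_simps)
  have 1: "t + 1 + 2 * N \<le> Y" and 2: "n + 2 * k + 2 + t \<le> Y"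
    using t k N n(1) unfolding Y by linarith+
  have Y1: "1 \<le> Y" using 1 by simp
  have "t' \<le> C * Y ^ e'" 
    by (rule order_trans[OF assms(3)]) (intro mult_le_mono2 power_mono 2 le0)
  also have "\<dots> \<le> C * Y ^ (e' + 1)" using Y1 by (intro mult_le_mono2 power_increasing) auto
  finally have "t' \<le> C * Y ^ (e' + 1)" .
  moreover have "Y \<le> Y ^ (e' + 1)" using power_increasing[of 1 "e' + 1" Y] Y1 by simp
  ultimately have "t + 1 + 2 * N + t' \<le> (1 + C) * Y ^ (e' + 1)"
    unfolding add_mult_distrib mult_1 using 1 by linarith
  then show ?thesis
    unfolding Y_def by (simp only: power_mult_distrib power_mult mult.assoc)
qed

lemma fpt_reduction_compose:
  assumes R1: "fpt_reduction R1 P (WCS 1 d)" and d: "1 \<le> d"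
  shows "fpt_reduction (\<lambda>p. reduction d (R1 p)) P matrix_k_product_rep_zero"
proof -
  obtain c f e where c: "computable f"
    "\<And>x k. \<exists>t. computes_in c (enc_inst (x, k)) t (enc_inst (R1 (x, k))) \<and> t \<le> f k * tsize x ^ e"
    using R1 unfolding fpt_reduction_def fpt_computable_def by blast
  obtain g where g: "computable g" "\<And>x k. snd (R1 (x, k)) \<le> g k"
    using R1 unfolding fpt_reduction_def by blast
  have iff: "(x, k) \<in> P \<longleftrightarrow> R1 (x, k) \<in> WCS 1 d" for x k
    using R1 unfolding fpt_reduction_def by blast
  obtain c2 N2 C2 e2 where c2: "\<And>p. runs c2 N2 (to_tree p) (C2 * sz p ^ e2) (to_tree (reduction d p))"
    using pt_reduction by (rule ptE) blast
  define N where "N = Suc (com_bound c)"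
  define F where "F k = (1 + C2) * (2 * k + 4 + 2 * N + f k) ^ (e2 + 1)" for k
  have "computable F"
  proof -
    define H where "H p = (1 + C2) * (2 * snd p + 4 + 2 * N + fst p) ^ (e2 + 1)" for p :: "nat \<times> nat"
    have "pt H" unfolding H_def by (intro pt_times pt_power pt_intros)
    from computable_fun_comp[OF computable_fun_pt[OF this]
        computable_fun_Pair[OF c(1)[unfolded computable_iff] computable_fun_pt[OF pt_ident]]]
    show ?thesis by (simp add: computable_iff H_def F_def[abs_def])
  qed
  moreover have "\<exists>t. computes_in (Seq (Seq c (clear_com N)) c2) (enc_inst (x, k)) t (enc_inst (reduction d (R1 (x, k)))) \<and>
      t \<le> F k * tsize x ^ ((e + 1) * (e2 + 1))" for x k
  proof -
    obtain t1 where t1: "computes_in c (to_tree (x, k)) t1 (to_tree (R1 (x, k)))" "t1 \<le> f k * tsize x ^ e"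
      using c(2)[of x k] unfolding enc_inst_eq by blast
    have 1: "runs (Seq c (clear_com N)) (N + 1) (to_tree (x, k)) (t1 + 1 + 2 * N) (to_tree (R1 (x, k)))"
      by (rule computes_in_runs[OF t1(1)]) (simp_all add: N_def)
    have "runs (Seq (Seq c (clear_com N)) c2) (max (N + 1) N2) (to_tree (x, k))
        (t1 + 1 + 2 * N + C2 * sz (R1 (x, k)) ^ e2) (to_tree (reduction d (R1 (x, k))))"
      by (rule runs_Seq[OF runs_mono[OF 1] runs_mono[OF c2]]) simp_all
    then obtain t where t: "t \<le> t1 + 1 + 2 * N + C2 * sz (R1 (x, k)) ^ e2"
      "computes_in (Seq (Seq c (clear_com N)) c2) (to_tree (x, k)) t (to_tree (reduction d (R1 (x, k))))"
      by (rule runs_computes_in)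
    have "sz (R1 (x, k)) \<le> sz (x, k) + t1" using computes_in_size[OF t1(1)] by (simp only: sz_def)
    then have "C2 * sz (R1 (x, k)) ^ e2 \<le> C2 * (tsize x + 2 * k + 2 + t1) ^ e2"
      by (intro mult_le_mono2 power_mono) (simp_all add: sz_tree)
    from composed_cost_bound[OF _ t1(2) this, of N] t(1)
    have "t \<le> F k * tsize x ^ ((e + 1) * (e2 + 1))"
      using tsize_pos[of x] unfolding F_def by linarith
    then show ?thesis using t(2) unfolding enc_inst_eq by blast
  qed
  ultimately have "fpt_computable (\<lambda>p. reduction d (R1 p))"
    unfolding fpt_computable_def by blast
  moreover have "\<exists>g. computable g \<and> (\<forall>x k. snd (reduction d (R1 (x, k))) \<le> g k)"
  proof (intro exI conjI allI)
    have "pt (\<lambda>y :: nat. Suc (2 * y) ^ (2 ^ d) + Suc y + 2)" by (intro pt_power pt_intros)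
    from computable_fun_comp[OF computable_fun_pt[OF this] g(1)[unfolded computable_iff]]
    show "computable (\<lambda>k. Suc (2 * g k) ^ (2 ^ d) + Suc (g k) + 2)"
      unfolding computable_iff .
    fix x k
    \<comment> \<open>The bound of \<open>reduction_parameter\<close> increases with the
      intermediate parameter, so \<open>g k\<close> may replace the latter.\<close>
    have "snd (reduction d (R1 (x, k))) \<le> Suc (2 * snd (R1 (x, k))) ^ (2 ^ d) + Suc (snd (R1 (x, k))) + 2"
      using reduction_parameter[of d "fst (R1 (x, k))" "snd (R1 (x, k))"] by simp
    also have "\<dots> \<le> Suc (2 * g k) ^ (2 ^ d) + Suc (g k) + 2"
      using g(2)[of x k] by (intro add_mono power_mono) simp_all
    finally show "snd (reduction d (R1 (x, k))) \<le> Suc (2 * g k) ^ (2 ^ d) + Suc (g k) + 2" .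
  qed
  ultimately show ?thesis
    unfolding fpt_reduction_def using iff reduction_correct(1)[OF d] by blast
qed

theorem theorem7:
  shows "W_hard 1 matrix_k_product_rep_zero \<and>
         W_hard_restricted_to 1 integer_2x2_inputs matrix_k_product_rep_zero"
proof -
  have "W_hard_restricted_to 1 integer_2x2_inputs matrix_k_product_rep_zero"
    unfolding W_hard_restricted_to_def
  proof
    fix P assume "P \<in> W 1"
    then obtain d R1 where d: "1 \<le> d" and R1: "fpt_reduction R1 P (WCS 1 d)"
      unfolding W_def fpt_reducible_def by blast
    from fpt_reduction_compose[OF R1 d] reduction_correct(2)[OF d]
    show "\<exists>R. fpt_reduction R P matrix_k_product_rep_zero \<and> (\<forall>x k. fst (R (x, k)) \<in> integer_2x2_inputs)"
      by blast
  qed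
  then show ?thesis
    unfolding W_hard_restricted_to_def W_hard_def fpt_reducible_def by blast
qed

end
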